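(* Let $G$ be a finite group, let $|G|$ denote its order, and let $k\in\{2,3\}$. Then $G$ embeds in the group $B_{|G|}/\Gamma_k(P_{|G|})$ if and only if $\gcd(|G|,k!)=1$.
   Context: For $n\in\mathbb{N}$, $B_n$ denotes the Artin braid group on $n$ strings, with generators $\sigma_1,\ldots,\sigma_{n-1}$ and relations $\sigma_i\sigma_j=\sigma_j\sigma_i$ for $|i-j|\geq 2$ and $\sigma_i\sigma_{i+1}\sigma_i=\sigma_{i+1}\sigma_i\sigma_{i+1}$ for $1\leq i\leq n-2$. The pure braid group $P_n$ is the kernel of the surjective homomorphism $\sigma\colon B_n\to S_n$ onto the symmetric group given by $\sigma(\sigma_i)=(i,i+1)$. For a group $\Pi$, the lower central series is defined by $\Gamma_1(\Pi)=\Pi$ and $\Gamma_k(\Pi)=[\Gamma_{k-1}(\Pi),\Pi]$ for $k\geq 2$. Since $P_n$ is normal in $B_n$, $\Gamma_k(P_n)$ is normal in $B_n$, so the quotient $B_n/\Gamma_k(P_n)$ is a group. A group $G$ embeds in a group $\Pi$ if there is an injective homomorphism $G\to\Pi$. *)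

theory Defs
  imports "HOL-Algebra.Sym_Groups"
begin

section \<open>Groups given by generators and relations\<close>

text \<open>
  In a word over \<^term>\<open>S\<close>, the letter \<^term>\<open>(x, True)\<close> stands for the generator \<^term>\<open>x\<close> and
  \<^term>\<open>(x, False)\<close> for its formal inverse. A relation is a pair of words that are to become
  equal.
\<close>

type_synonym 'a group_word = "('a \<times> bool) list"

definition group_words :: "'a set \<Rightarrow> 'a group_word set"
  where "group_words S = lists (S \<times> UNIV)"

inductive word_cong ::
    "'a set \<Rightarrow> ('a group_word \<times> 'a group_word) set \<Rightarrow> 'a group_word \<Rightarrow> 'a group_word \<Rightarrow> bool"
  for S R where
  refl: "u \<in> group_words S \<Longrightarrow> word_cong S R u u"
| sym: "word_cong S R u v \<Longrightarrow> word_cong S R v u"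
| trans: "word_cong S R u v \<Longrightarrow> word_cong S R v w \<Longrightarrow> word_cong S R u w"
| append: "word_cong S R u v \<Longrightarrow> word_cong S R u' v' \<Longrightarrow> word_cong S R (u @ u') (v @ v')"
| cancel: "x \<in> S \<Longrightarrow> word_cong S R [(x, b), (x, \<not> b)] []"
| relator: "(u, v) \<in> R \<Longrightarrow> u \<in> group_words S \<Longrightarrow> v \<in> group_words S \<Longrightarrow> word_cong S R u v"

definition word_rel ::
    "'a set \<Rightarrow> ('a group_word \<times> 'a group_word) set \<Rightarrow> ('a group_word \<times> 'a group_word) set"
  where "word_rel S R = {(u, v). word_cong S R u v}"

definition presented_group ::
    "'a set \<Rightarrow> ('a group_word \<times> 'a group_word) set \<Rightarrow> 'a group_word set monoid"
  where "presented_group S R =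
    \<lparr> carrier = group_words S // word_rel S R,
      mult = (\<lambda>A B. \<Union>u\<in>A. \<Union>v\<in>B. word_rel S R `` {u @ v}),
      one = word_rel S R `` {[]} \<rparr>"

definition word_eval :: "('b, 'c) monoid_scheme \<Rightarrow> ('a \<Rightarrow> 'b) \<Rightarrow> 'a group_word \<Rightarrow> 'b"
  where "word_eval H f w =
    foldr (\<lambda>(x, b) h. (if b then f x else inv\<^bsub>H\<^esub> (f x)) \<otimes>\<^bsub>H\<^esub> h) w \<one>\<^bsub>H\<^esub>"

text \<open>
  When \<^term>\<open>f\<close> respects the relations, \<^term>\<open>word_eval H f\<close> is constant on each congruence class,
  so the following picks its unique value (see \<open>presented_lift_hom\<close> and \<open>presented_lift_generator\<close>).
\<close>

definition presented_lift ::
    "('b, 'c) monoid_scheme \<Rightarrow> ('a \<Rightarrow> 'b) \<Rightarrow> 'a group_word set \<Rightarrow> 'b"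
  where "presented_lift H f A = the_elem (word_eval H f ` A)"

lemma word_cong_words:
  "word_cong S R u v \<Longrightarrow> u \<in> group_words S \<and> v \<in> group_words S"
  by (induction rule: word_cong.induct) (auto simp: group_words_def)

lemma equiv_word_rel: "equiv (group_words S) (word_rel S R)"
  unfolding equiv_def refl_on_def sym_def trans_def word_rel_def
  using word_cong_words[of S R] by (blast intro: word_cong.intros)

lemma word_rel_class_eq:
  "word_cong S R u v \<Longrightarrow> word_rel S R `` {u} = word_rel S R `` {v}"
  by (rule equiv_class_eq[OF equiv_word_rel]) (simp add: word_rel_def)

lemma presented_carrierI:
  "u \<in> group_words S \<Longrightarrow> word_rel S R `` {u} \<in> carrier (presented_group S R)"
  by (simp add: presented_group_def quotientI)

lemma presented_carrierE:
  assumes "A \<in> carrier (presented_group S R)"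
  obtains u where "u \<in> group_words S" "A = word_rel S R `` {u}"
  using assms by (auto simp: presented_group_def elim!: quotientE)

lemma presented_mult:
  assumes "u \<in> group_words S" "v \<in> group_words S"
  shows "word_rel S R `` {u} \<otimes>\<^bsub>presented_group S R\<^esub> word_rel S R `` {v} = word_rel S R `` {u @ v}"
proof -
  have "word_rel S R `` {u' @ v'} = word_rel S R `` {u @ v}"
    if "u' \<in> word_rel S R `` {u}" "v' \<in> word_rel S R `` {v}" for u' v'
  proof (rule word_rel_class_eq)
    have "word_cong S R u' u" "word_cong S R v' v"
      using that by (auto simp: word_rel_def intro: word_cong.sym)
    then show "word_cong S R (u' @ v') (u @ v)" by (rule word_cong.append)
  qed
  moreover have "u \<in> word_rel S R `` {u}" "v \<in> word_rel S R `` {v}"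
    using assms by (simp_all add: word_rel_def word_cong.refl)
  ultimately have "(\<Union>u'\<in>word_rel S R `` {u}. \<Union>v'\<in>word_rel S R `` {v}. word_rel S R `` {u' @ v'}) =
      word_rel S R `` {u @ v}"
    by blast
  then show ?thesis
    by (simp add: presented_group_def)
qed

lemma word_cong_inverse:
  "w \<in> group_words S \<Longrightarrow> word_cong S R (rev (map (\<lambda>(x, b). (x, \<not> b)) w) @ w) []"
proof (induction w)
  case Nil
  show ?case by (auto simp: group_words_def intro: word_cong.refl)
next
  case (Cons a w)
  obtain x b where a: "a = (x, b)" by force
  let ?r = "rev (map (\<lambda>(x, b). (x, \<not> b)) w)"
  have w: "w \<in> group_words S" and x: "x \<in> S"
    using Cons.prems by (auto simp: group_words_def a)
  have r: "?r \<in> group_words S"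
    using w by (force simp: group_words_def)
  have "word_cong S R [(x, \<not> b), (x, b)] []"
    using word_cong.cancel[OF x, of R "\<not> b"] by simp
  then have c: "word_cong S R ([(x, \<not> b), (x, b)] @ w) ([] @ w)"
    by (rule word_cong.append[OF _ word_cong.refl[OF w]])
  have "word_cong S R (?r @ ([(x, \<not> b), (x, b)] @ w)) (?r @ ([] @ w))"
    by (rule word_cong.append[OF word_cong.refl[OF r] c])
  then show ?case
    using word_cong.trans[OF _ Cons.IH[OF w]] by (simp only: a append_assoc append_Nil rev.simps
      list.map case_prod_conv append_Cons)
qed

lemma presented_one: "\<one>\<^bsub>presented_group S R\<^esub> = word_rel S R `` {[]}"
  by (simp add: presented_group_def)

lemma group_presented_group: "group (presented_group S R)"
proof (rule groupI)
  show "\<one>\<^bsub>presented_group S R\<^esub> \<in> carrier (presented_group S R)"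
    by (simp add: presented_one presented_carrierI group_words_def)
next
  fix A B assume "A \<in> carrier (presented_group S R)" "B \<in> carrier (presented_group S R)"
  then show "A \<otimes>\<^bsub>presented_group S R\<^esub> B \<in> carrier (presented_group S R)"
    by (elim presented_carrierE) (auto simp: presented_mult group_words_def intro!: presented_carrierI)
next
  fix A B C
  assume "A \<in> carrier (presented_group S R)" "B \<in> carrier (presented_group S R)"
    "C \<in> carrier (presented_group S R)"
  moreover have "u @ v \<in> group_words S" if "u \<in> group_words S" "v \<in> group_words S" for u v :: "'a group_word"
    using that by (auto simp: group_words_def)
  ultimately show "A \<otimes>\<^bsub>presented_group S R\<^esub> B \<otimes>\<^bsub>presented_group S R\<^esub> C =
      A \<otimes>\<^bsub>presented_group S R\<^esub> (B \<otimes>\<^bsub>presented_group S R\<^esub> C)"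
    by (elim presented_carrierE) (simp add: presented_mult)
next
  fix A assume A: "A \<in> carrier (presented_group S R)"
  then obtain u where u: "u \<in> group_words S" "A = word_rel S R `` {u}"
    by (rule presented_carrierE)
  have nil: "[] \<in> group_words S" by (simp add: group_words_def)
  show "\<one>\<^bsub>presented_group S R\<^esub> \<otimes>\<^bsub>presented_group S R\<^esub> A = A"
    using u nil by (simp add: presented_one presented_mult)
  let ?r = "rev (map (\<lambda>(x, b). (x, \<not> b)) u)"
  have r: "?r \<in> group_words S"
    using u by (force simp: group_words_def)
  have "word_rel S R `` {?r} \<otimes>\<^bsub>presented_group S R\<^esub> A = \<one>\<^bsub>presented_group S R\<^esub>"
    unfolding u(2) presented_mult[OF r u(1)] presented_one
    by (rule word_rel_class_eq[OF word_cong_inverse[OF u(1)]])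
  then show "\<exists>B\<in>carrier (presented_group S R). B \<otimes>\<^bsub>presented_group S R\<^esub> A = \<one>\<^bsub>presented_group S R\<^esub>"
    using presented_carrierI[OF r] by blast
qed

context group
begin

lemma word_eval_closed:
  "f \<in> S \<rightarrow> carrier G \<Longrightarrow> w \<in> group_words S \<Longrightarrow> word_eval G f w \<in> carrier G"
  by (induction w) (auto simp: word_eval_def group_words_def Pi_iff)

lemma word_eval_append:
  assumes f: "f \<in> S \<rightarrow> carrier G" and v: "v \<in> group_words S"
  shows "u \<in> group_words S \<Longrightarrow> word_eval G f (u @ v) = word_eval G f u \<otimes> word_eval G f v"
proof (induction u)
  case Nil
  then show ?case using word_eval_closed[OF f v] by (simp add: word_eval_def)
next
  case (Cons a u)
  obtain x b where a: "a = (x, b)" by force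
  have u: "u \<in> group_words S" and "x \<in> S" using Cons.prems by (auto simp: a group_words_def)
  then have "f x \<in> carrier G" using f by auto
  with Cons.IH[OF u] word_eval_closed[OF f u] word_eval_closed[OF f v] show ?case
    by (simp add: word_eval_def a m_assoc)
qed

lemma word_eval_cong:
  assumes f: "f \<in> S \<rightarrow> carrier G"
    and R: "\<And>u v. (u, v) \<in> R \<Longrightarrow> word_eval G f u = word_eval G f v"
  shows "word_cong S R u v \<Longrightarrow> word_eval G f u = word_eval G f v"
proof (induction rule: word_cong.induct)
  case (append u v u' v')
  then show ?case
    using word_cong_words word_eval_append[OF f] by metis
next
  case (cancel x b)
  then have "f x \<in> carrier G" using f by auto
  then show ?case by (auto simp: word_eval_def)
qed (auto simp: R)

lemma presented_lift_class:
  assumes f: "f \<in> S \<rightarrow> carrier G"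
    and R: "\<And>u v. (u, v) \<in> R \<Longrightarrow> word_eval G f u = word_eval G f v"
    and u: "u \<in> group_words S"
  shows "presented_lift G f (word_rel S R `` {u}) = word_eval G f u"
proof -
  have "word_eval G f v = word_eval G f u" if "v \<in> word_rel S R `` {u}" for v
  proof -
    have "word_cong S R u v" using that by (simp add: word_rel_def)
    then show ?thesis using word_eval_cong[OF f R] by simp
  qed
  moreover have "u \<in> word_rel S R `` {u}"
    using word_cong.refl[OF u] by (simp add: word_rel_def)
  ultimately have "word_eval G f ` (word_rel S R `` {u}) = {word_eval G f u}"
    by blast
  then show ?thesis by (simp add: presented_lift_def)
qed

lemma presented_lift_hom:
  assumes f: "f \<in> S \<rightarrow> carrier G"
    and R: "\<And>u v. (u, v) \<in> R \<Longrightarrow> word_eval G f u = word_eval G f v"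
  shows "presented_lift G f \<in> hom (presented_group S R) G"
proof (rule homI)
  fix A assume "A \<in> carrier (presented_group S R)"
  then show "presented_lift G f A \<in> carrier G"
    by (elim presented_carrierE) (simp add: presented_lift_class[OF f R] word_eval_closed[OF f])
next
  fix A B assume "A \<in> carrier (presented_group S R)" "B \<in> carrier (presented_group S R)"
  moreover have "u @ v \<in> group_words S" if "u \<in> group_words S" "v \<in> group_words S" for u v
    using that by (auto simp: group_words_def)
  ultimately show "presented_lift G f (A \<otimes>\<^bsub>presented_group S R\<^esub> B) =
      presented_lift G f A \<otimes> presented_lift G f B"
    by (elim presented_carrierE)
      (simp add: presented_mult presented_lift_class[OF f R] word_eval_append[OF f])
qed

lemma presented_lift_generator:
  assumes f: "f \<in> S \<rightarrow> carrier G"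
    and R: "\<And>u v. (u, v) \<in> R \<Longrightarrow> word_eval G f u = word_eval G f v"
    and x: "x \<in> S"
  shows "presented_lift G f (word_rel S R `` {[(x, True)]}) = f x"
proof -
  have "f x \<in> carrier G" using f x by auto
  moreover have "[(x, True)] \<in> group_words S" using x by (simp add: group_words_def)
  ultimately show ?thesis
    by (simp add: presented_lift_class[OF f R]) (simp add: word_eval_def)
qed

end

section \<open>Lower central series\<close>

definition commutator_subgroup :: "('a, 'b) monoid_scheme \<Rightarrow> 'a set \<Rightarrow> 'a set \<Rightarrow> 'a set"
  where "commutator_subgroup G H K =
    generate G (\<Union>h\<in>H. \<Union>k\<in>K. {h \<otimes>\<^bsub>G\<^esub> k \<otimes>\<^bsub>G\<^esub> inv\<^bsub>G\<^esub> h \<otimes>\<^bsub>G\<^esub> inv\<^bsub>G\<^esub> k})"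

text \<open>The series starts at index 1; the value at 0 is a dummy.\<close>

fun lower_central :: "('a, 'b) monoid_scheme \<Rightarrow> nat \<Rightarrow> 'a set" where
  "lower_central G 0 = carrier G"
| "lower_central G (Suc 0) = carrier G"
| "lower_central G (Suc (Suc k)) = commutator_subgroup G (lower_central G (Suc k)) (carrier G)"

context group
begin

lemma commutator_subgroup_normal:
  assumes H: "H \<lhd> G" and K: "K \<lhd> G"
  shows "commutator_subgroup G H K \<lhd> G" and "commutator_subgroup G H K \<subseteq> K"
proof -
  interpret H: normal H G by (rule H)
  interpret K: normal K G by (rule K)
  let ?C = "\<Union>h\<in>H. \<Union>k\<in>K. {h \<otimes> k \<otimes> inv h \<otimes> inv k}"
  have C: "?C \<subseteq> K"
    using K.inv_op_closed2 by auto
  then show "commutator_subgroup G H K \<subseteq> K"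
    unfolding commutator_subgroup_def by (intro generate_subgroup_incl K.subgroup_axioms)
  show "commutator_subgroup G H K \<lhd> G"
    unfolding commutator_subgroup_def
  proof (rule normal_generateI)
    show "?C \<subseteq> carrier G" using C K.subset by blast
  next
    fix c g assume "c \<in> ?C" and g: "g \<in> carrier G"
    then obtain h k where hk: "h \<in> H" "k \<in> K" "c = h \<otimes> k \<otimes> inv h \<otimes> inv k" by auto
    then have hk': "h \<in> carrier G" "k \<in> carrier G" by auto
    have cancel: "inv g \<otimes> (g \<otimes> x) = x" if "x \<in> carrier G" for x
      using g that by (simp add: m_assoc[symmetric])
    have "g \<otimes> c \<otimes> inv g = (g \<otimes> h \<otimes> inv g) \<otimes> (g \<otimes> k \<otimes> inv g) \<otimes>
        inv (g \<otimes> h \<otimes> inv g) \<otimes> inv (g \<otimes> k \<otimes> inv g)"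
      using g hk' by (simp add: hk(3) inv_mult_group m_assoc cancel)
    moreover have "g \<otimes> h \<otimes> inv g \<in> H" "g \<otimes> k \<otimes> inv g \<in> K"
      using g hk H.inv_op_closed2 K.inv_op_closed2 by auto
    ultimately show "g \<otimes> c \<otimes> inv g \<in> ?C" by blast
  qed
qed

lemma lower_central_normal:
  assumes N: "N \<lhd> G"
  shows "lower_central (G\<lparr>carrier := N\<rparr>) k \<lhd> G \<and> lower_central (G\<lparr>carrier := N\<rparr>) k \<subseteq> N"
proof (induction k)
  case 0
  show ?case using N by simp
next
  case (Suc k)
  let ?H = "G\<lparr>carrier := N\<rparr>"
  let ?L = "lower_central ?H k"
  have sub: "subgroup N G" using N by (rule normal_imp_subgroup)
  have L: "?L \<lhd> G" "?L \<subseteq> N" using Suc by auto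
  have "h \<otimes> k \<otimes> inv h \<otimes> inv k \<in> N" if "h \<in> ?L" "k \<in> N" for h k
  proof -
    have "h \<in> N" using subsetD[OF L(2) that(1)] .
    then show ?thesis
      using that by (intro subgroup.m_closed[OF sub] subgroup.m_inv_closed[OF sub])
  qed
  then have "(\<Union>h\<in>?L. \<Union>k\<in>N. {h \<otimes> k \<otimes> inv h \<otimes> inv k}) \<subseteq> N"
    by (intro UN_least) simp
  moreover have "(\<Union>h\<in>?L. \<Union>k\<in>N. {h \<otimes> k \<otimes> inv\<^bsub>?H\<^esub> h \<otimes> inv\<^bsub>?H\<^esub> k}) =
      (\<Union>h\<in>?L. \<Union>k\<in>N. {h \<otimes> k \<otimes> inv h \<otimes> inv k})"
  proof (intro SUP_cong HOL.refl)
    fix h k assume "h \<in> ?L" "k \<in> N"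
    then show "{h \<otimes> k \<otimes> inv\<^bsub>?H\<^esub> h \<otimes> inv\<^bsub>?H\<^esub> k} = {h \<otimes> k \<otimes> inv h \<otimes> inv k}"
      using subsetD[OF L(2)] by (simp add: m_inv_consistent[OF sub])
  qed
  ultimately have "commutator_subgroup ?H ?L N = commutator_subgroup G ?L N"
    by (simp add: commutator_subgroup_def generate_consistent[OF _ sub])
  then show ?case
    using commutator_subgroup_normal[OF L(1) N] N by (cases k) simp_all
qed

end

section \<open>Braid groups and pure braid groups\<close>

definition braid_relations :: "nat \<Rightarrow> (nat group_word \<times> nat group_word) set"
  where "braid_relations n =
    {([(i, True), (j, True)], [(j, True), (i, True)]) | i j.
       i \<in> {1..<n} \<and> j \<in> {1..<n} \<and> \<bar>int i - int j\<bar> \<ge> 2} \<union>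
    {([(i, True), (i + 1, True), (i, True)], [(i + 1, True), (i, True), (i + 1, True)]) | i.
       1 \<le> i \<and> i + 2 \<le> n}"

definition braid_group :: "nat \<Rightarrow> nat group_word set monoid"
  where "braid_group n = presented_group {1..<n} (braid_relations n)"

definition braid_generator :: "nat \<Rightarrow> nat \<Rightarrow> nat group_word set"
  where "braid_generator n i = word_rel {1..<n} (braid_relations n) `` {[(i, True)]}"

definition braid_perm :: "nat \<Rightarrow> nat group_word set \<Rightarrow> (nat \<Rightarrow> nat)"
  where "braid_perm n = presented_lift (sym_group n) (\<lambda>i. Transposition.transpose i (i + 1))"

definition pure_braids :: "nat \<Rightarrow> nat group_word set set"
  where "pure_braids n = kernel (braid_group n) (sym_group n) (braid_perm n)"

definition pure_braid_group :: "nat \<Rightarrow> nat group_word set monoid"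
  where "pure_braid_group n = (braid_group n)\<lparr>carrier := pure_braids n\<rparr>"

definition embeds_in :: "('a, 'c) monoid_scheme \<Rightarrow> ('b, 'd) monoid_scheme \<Rightarrow> bool"
  where "embeds_in G H \<longleftrightarrow> (\<exists>f. f \<in> mon G H)"

lemma group_braid_group: "group (braid_group n)"
  by (simp add: braid_group_def group_presented_group)

lemma transpose_in_sym_group:
  "(\<lambda>i. Transposition.transpose i (i + 1)) \<in> {1..<n} \<rightarrow> carrier (sym_group n)"
  by (auto simp: sym_group_def intro!: permutes_swap_id)

lemma transpose_respects_braid_relations:
  assumes "(u, v) \<in> braid_relations n"
  shows "word_eval (sym_group n) (\<lambda>i. Transposition.transpose i (i + 1)) u =
    word_eval (sym_group n) (\<lambda>i. Transposition.transpose i (i + 1)) v"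
proof -
  have inv: "Transposition.transpose i (i + 1) \<circ> (Transposition.transpose j (j + 1) \<circ> id) =
      Transposition.transpose j (j + 1) \<circ> (Transposition.transpose i (i + 1) \<circ> id)"
    if "\<bar>int i - int j\<bar> \<ge> 2" for i j
  proof -
    have "i \<noteq> j" "i + 1 \<noteq> j" "i \<noteq> j + 1" using that by auto
    then show ?thesis by (simp add: fun_eq_iff transpose_def)
  qed
  have "Transposition.transpose i (i + 1) \<circ> (Transposition.transpose (i + 1) (i + 1 + 1) \<circ>
        (Transposition.transpose i (i + 1) \<circ> id)) =
      Transposition.transpose (i + 1) (i + 1 + 1) \<circ> (Transposition.transpose i (i + 1) \<circ>
        (Transposition.transpose (i + 1) (i + 1 + 1) \<circ> id))" for i :: nat
    by (simp add: fun_eq_iff transpose_def)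
  with inv assms show ?thesis
    unfolding braid_relations_def word_eval_def sym_group_def by auto
qed

lemma braid_perm_hom: "braid_perm n \<in> hom (braid_group n) (sym_group n)"
  unfolding braid_perm_def braid_group_def
  by (rule group.presented_lift_hom[OF sym_group_is_group transpose_in_sym_group])
    (rule transpose_respects_braid_relations)

lemma braid_perm_generator:
  "i \<in> {1..<n} \<Longrightarrow> braid_perm n (braid_generator n i) = Transposition.transpose i (i + 1)"
  unfolding braid_perm_def braid_generator_def
  by (rule group.presented_lift_generator[OF sym_group_is_group transpose_in_sym_group])
    (rule transpose_respects_braid_relations)

lemma pure_braids_normal: "pure_braids n \<lhd> braid_group n"
  unfolding pure_braids_def
  by (intro group_hom.normal_kernel group_hom.intro group_hom_axioms.intro
      group_braid_group sym_group_is_group braid_perm_hom)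

lemma group_pure_braid_group: "group (pure_braid_group n)"
  unfolding pure_braid_group_def
  by (intro subgroup.subgroup_is_group normal_imp_subgroup pure_braids_normal group_braid_group)

lemma lower_central_pure_braid_normal: "lower_central (pure_braid_group n) k \<lhd> braid_group n"
  unfolding pure_braid_group_def
  using group.lower_central_normal[OF group_braid_group pure_braids_normal] by blast

lemma group_braid_quotient: "group (braid_group n Mod lower_central (pure_braid_group n) k)"
  by (rule normal.factorgroup_is_group[OF lower_central_pure_braid_normal])

end

theory Submission
  imports
    Defs
    "HOL-Algebra.FiniteProduct"
    "HOL-Algebra.Sylow"
    "HOL-Algebra.Multiplicative_Group"
begin

text \<open>
  Linking numbers \<open>l\<close> detect \<open>P\<^sub>n / \<Gamma>\<^sub>2\<close>, which is free abelian on the pairs of strands, and the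
  triple invariants \<open>m\<close> (of Milnor type) detect \<open>\<Gamma>\<^sub>2 / \<Gamma>\<^sub>3\<close>, which is free abelian on the triples.
  If \<open>x\<^sup>p\<close> lies in \<open>\<Gamma>\<^sub>k\<close> and the permutation of \<open>x\<close> is not trivial, then \<open>x\<close> permutes two or three
  strands cyclically. For \<open>p = 2\<close> the strands cross an odd number of times, and for \<open>p = 3\<close> the
  triple invariant of \<open>x\<^sup>3\<close> is 2 modulo 3 (compare the Borromean rings), so \<open>x\<^sup>p\<close> cannot lie in
  \<open>\<Gamma>\<^sub>k\<close>. Hence \<open>x\<close> is pure, and it lies in \<open>\<Gamma>\<^sub>k\<close> because the quotients are torsion-free.

  Conversely, let \<open>G\<close> act on itself by left multiplication. If its order is coprime to \<open>k!\<close>, then it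
  acts freely on the pairs (and triples) of strands, so that the lower central quotients are free
  \<open>G\<close>-modules and the extension of \<open>G\<close> by \<open>P\<^sub>n / \<Gamma>\<^sub>k\<close> splits.
\<close>

section \<open>A nilpotent invariant of braids\<close>

text \<open>The pure braid group enters only as a kernel, without a presentation, so the invariants
  must be shown to be well defined and also complete. For the first, \<open>l\<close> and
  \<open>m\<close> are packed with a permutation into one group, and it suffices to check the braid
  relations there. This defines the invariants on all braids, as the torsion argument requires: it
  evaluates them on braids that are not pure. For completeness, the number of generators has to be
  bounded by the number of invariants. \<open>P\<close> is generated by conjugates of squares of
  generators; any two of them on the same pair of strands agree modulo \<open>\<Gamma>2\<close>, and
  modulo \<open>\<Gamma>3\<close> all commutators of two of them on the same triple are governed by
  a single one. The splitting is built by hand in place of a vanishing theorem for cohomology: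
  deviation from equivariance is a crossed homomorphism, and its zero set is a subgroup. Linking
  numbers are treated before triple invariants, since the latter are additive only on
  \<open>\<Gamma>2\<close>.\<close>

type_synonym magnus = "(nat \<Rightarrow> nat \<Rightarrow> int) \<times> (nat \<Rightarrow> nat \<Rightarrow> nat \<Rightarrow> int) \<times> (nat \<Rightarrow> nat)"

text \<open>
  Artin's action makes a braid on strands \<open>1, \<dots>, n\<close> conjugate the \<open>a\<close>-th free generator by a
  word, the longitude of strand \<open>a\<close>. In a triple \<open>(l, m, q)\<close>, the integers \<open>l a b\<close> and \<open>m a b c\<close>
  are the coefficients of \<open>X\<^sub>b\<close> and \<open>X\<^sub>b X\<^sub>c\<close> in the Magnus expansion of the longitude of \<open>a\<close>,
  the latter being meaningful for distinct \<open>a\<close>, \<open>b\<close>, \<open>c\<close>, and \<open>q\<close> is the inverse of the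
  permutation of the braid.
\<close>

fun magnus_mult :: "magnus \<Rightarrow> magnus \<Rightarrow> magnus" where
  "magnus_mult (l, m, q) (l', m', q') =
    (\<lambda>a b. l a b + l' (q a) (q b),
     \<lambda>a b c. m a b c + m' (q a) (q b) (q c) + l' (q a) (q b) * l b c +
       l' (q a) (q c) * (l a b - l c b),
     q' \<circ> q)"

definition magnus_group :: "magnus monoid" where
  "magnus_group = \<lparr> carrier = {(l, m, q). bij q}, mult = magnus_mult,
     one = (\<lambda>a b. 0, \<lambda>a b c. 0, id) \<rparr>"

text \<open>The law is composition of Artin automorphisms, truncated after degree two. Write
  \<open>L_b\<close> for the sum of all \<open>l b c * X_c\<close>. The longitude of
  \<open>a\<close> in a product is its longitude in the first factor times that of
  \<open>q a\<close> in the second, after the first factor has replaced the generator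
  \<open>q b\<close> by the \<open>b\<close>-th one conjugated by its longitude, that is
  \<open>X_(q b)\<close> by \<open>X_b + X_b L_b - L_b X_b\<close>. The last two summands of
  \<open>magnus_mult\<close> collect the new coefficients of \<open>X_b X_c\<close>. The formula is
  imposed at repeated indices too and is a group law there as well.\<close>

lemma group_magnus_group: "group magnus_group"
proof (rule groupI)
  fix x y z assume "x \<in> carrier magnus_group" "y \<in> carrier magnus_group" "z \<in> carrier magnus_group"
  show "x \<otimes>\<^bsub>magnus_group\<^esub> y \<otimes>\<^bsub>magnus_group\<^esub> z = x \<otimes>\<^bsub>magnus_group\<^esub> (y \<otimes>\<^bsub>magnus_group\<^esub> z)"
    by (cases x; cases y; cases z) (simp add: magnus_group_def fun_eq_iff algebra_simps)
next
  fix x assume "x \<in> carrier magnus_group"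
  then obtain l m q where x: "x = (l, m, q)" and q: "bij q"
    by (auto simp: magnus_group_def)
  define r where "r = inv' q"
  define l' where "l' = (\<lambda>a b. - l (r a) (r b))"
  define m' where "m' = (\<lambda>a b c. - (m (r a) (r b) (r c) + l (r a) (r b) * l' b c +
    l (r a) (r c) * (l' a b - l' c b)))"
  have "bij r" using q by (simp add: r_def bij_imp_bij_inv)
  moreover have "q \<circ> r = id" using q by (simp add: r_def bij_is_surj surj_iff[symmetric])
  ultimately have "(l', m', r) \<in> carrier magnus_group"
    "(l', m', r) \<otimes>\<^bsub>magnus_group\<^esub> x = \<one>\<^bsub>magnus_group\<^esub>"
    by (simp_all add: x magnus_group_def fun_eq_iff l'_def m'_def)
  then show "\<exists>y\<in>carrier magnus_group. y \<otimes>\<^bsub>magnus_group\<^esub> x = \<one>\<^bsub>magnus_group\<^esub>" by blast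
qed (auto simp: magnus_group_def intro: bij_comp)

text \<open>Only strand \<open>i\<close> acquires a longitude, the single letter
  \<open>i + 1\<close>; hence there are no quadratic coefficients and the linear ones are not
  symmetric. \<open>link_flip\<close> measures the asymmetry.\<close>

definition magnus_generator :: "nat \<Rightarrow> magnus" where
  "magnus_generator i = (\<lambda>a b. of_bool (a = i \<and> b = i + 1), \<lambda>a b c. 0, transpose i (i + 1))"

lemma magnus_generator_closed: "magnus_generator \<in> S \<rightarrow> carrier magnus_group"
  by (auto simp: magnus_generator_def magnus_group_def)

lemma magnus_generator_braid:
  assumes "(u, v) \<in> braid_relations n"
  shows "word_eval magnus_group magnus_generator u = word_eval magnus_group magnus_generator v"
proof -
  have "magnus_mult (magnus_generator i) (magnus_generator j) =
      magnus_mult (magnus_generator j) (magnus_generator i)" if "\<bar>int i - int j\<bar> \<ge> 2" for i j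
  proof -
    have "i \<noteq> j" "i + 1 \<noteq> j" "i \<noteq> j + 1" using that by auto
    then show ?thesis
      by (auto simp: magnus_generator_def fun_eq_iff transpose_def of_bool_def)
  qed
  moreover have "magnus_mult (magnus_generator i)
      (magnus_mult (magnus_generator (Suc i)) (magnus_generator i)) =
    magnus_mult (magnus_generator (Suc i))
      (magnus_mult (magnus_generator i) (magnus_generator (Suc i)))" for i
    by (auto simp: magnus_generator_def fun_eq_iff transpose_def of_bool_def)
  moreover have [simp]: "magnus_mult x (\<lambda>a b. 0, \<lambda>a b c. 0, id) = x" for x
    by (cases x) (simp add: fun_eq_iff)
  ultimately show ?thesis
    using assms unfolding braid_relations_def word_eval_def magnus_group_def by auto
qed

definition magnus :: "nat \<Rightarrow> nat group_word set \<Rightarrow> magnus" where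
  "magnus n = presented_lift magnus_group magnus_generator"

lemma magnus_hom: "magnus n \<in> hom (braid_group n) magnus_group"
  unfolding magnus_def braid_group_def
  by (rule group.presented_lift_hom[OF group_magnus_group magnus_generator_closed])
    (rule magnus_generator_braid)

lemma magnus_braid_generator:
  "i \<in> {1..<n} \<Longrightarrow> magnus n (braid_generator n i) = magnus_generator i"
  unfolding magnus_def braid_generator_def
  by (rule group.presented_lift_generator[OF group_magnus_group magnus_generator_closed])
    (rule magnus_generator_braid)

section \<open>Generation and relations of the braid group\<close>

lemma (in group) word_eval_in_generate:
  "f \<in> S \<rightarrow> carrier G \<Longrightarrow> w \<in> group_words S \<Longrightarrow> word_eval G f w \<in> generate G (f ` S)"
proof (induction w)
  case (Cons a w)
  then show ?case
    by (cases a) (auto simp: word_eval_def group_words_def intro!: generate.eng intro: generate.intros)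
qed (simp add: word_eval_def generate.one)

lemma presented_group_generate:
  "carrier (presented_group S R) =
    generate (presented_group S R) ((\<lambda>x. word_rel S R `` {[(x, True)]}) ` S)"
    (is "_ = generate ?G (?f ` S)")
proof -
  interpret group ?G by (rule group_presented_group)
  have f: "?f \<in> S \<rightarrow> carrier ?G"
    by (auto intro!: presented_carrierI simp: group_words_def)
  have inv: "inv\<^bsub>?G\<^esub> (?f x) = word_rel S R `` {[(x, False)]}" if x: "x \<in> S" for x
  proof (rule inv_equality)
    have w: "[(x, b)] \<in> group_words S" for b using x by (simp add: group_words_def)
    show "word_rel S R `` {[(x, False)]} \<otimes>\<^bsub>?G\<^esub> ?f x = \<one>\<^bsub>?G\<^esub>"
      using word_cong.cancel[OF x, of R False] w
      by (simp add: presented_mult presented_one word_rel_class_eq)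
    show "?f x \<in> carrier ?G" "word_rel S R `` {[(x, False)]} \<in> carrier ?G"
      using w by (auto intro: presented_carrierI)
  qed
  have eval: "word_eval ?G ?f w = word_rel S R `` {w}" if "w \<in> group_words S" for w
    using that
  proof (induction w)
    case Nil
    show ?case by (simp add: word_eval_def presented_one)
  next
    case (Cons a w)
    obtain x b where a: "a = (x, b)" by force
    have w: "w \<in> group_words S" "[(x, b)] \<in> group_words S" and x: "x \<in> S"
      using Cons.prems by (auto simp: a group_words_def)
    have "word_rel S R `` {[(x, b)]} \<otimes>\<^bsub>?G\<^esub> word_rel S R `` {w} = word_rel S R `` {a # w}"
      using presented_mult[OF w(2,1), of R] by (simp add: a)
    then show ?case
      using Cons.IH[OF w(1)] by (cases b) (simp_all add: a word_eval_def inv[OF x])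
  qed
  have "A \<in> generate ?G (?f ` S)" if "A \<in> carrier ?G" for A
    using that by (elim presented_carrierE) (metis eval f word_eval_in_generate)
  moreover have "generate ?G (?f ` S) \<subseteq> carrier ?G"
    using f by (intro generate_incl) auto
  ultimately show ?thesis by blast
qed

lemma braid_group_generate: "carrier (braid_group n) = generate (braid_group n) (braid_generator n ` {1..<n})"
  using presented_group_generate[of "{1..<n}" "braid_relations n"]
  by (simp add: braid_group_def braid_generator_def[abs_def])

lemma braid_generator_closed: "i \<in> {1..<n} \<Longrightarrow> braid_generator n i \<in> carrier (braid_group n)"
  by (simp add: braid_group_generate generate.incl)

lemma braid_generator_commute:
  assumes "i \<in> {1..<n}" "j \<in> {1..<n}" "i + 2 \<le> j \<or> j + 2 \<le> i"
  shows "braid_generator n i \<otimes>\<^bsub>braid_group n\<^esub> braid_generator n j =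
    braid_generator n j \<otimes>\<^bsub>braid_group n\<^esub> braid_generator n i"
proof -
  have "([(i, True), (j, True)], [(j, True), (i, True)]) \<in> braid_relations n"
    using assms by (force simp: braid_relations_def)
  then have "word_cong {1..<n} (braid_relations n) [(i, True), (j, True)] [(j, True), (i, True)]"
    using assms by (intro word_cong.relator) (auto simp: group_words_def)
  then show ?thesis
    using assms by (simp add: braid_group_def braid_generator_def presented_mult group_words_def
        word_rel_class_eq)
qed

lemma braid_generator_braid:
  assumes "1 \<le> i" "i + 2 \<le> n"
  shows "braid_generator n i \<otimes>\<^bsub>braid_group n\<^esub> braid_generator n (i + 1) \<otimes>\<^bsub>braid_group n\<^esub>
      braid_generator n i =
    braid_generator n (i + 1) \<otimes>\<^bsub>braid_group n\<^esub> braid_generator n i \<otimes>\<^bsub>braid_group n\<^esub>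
      braid_generator n (i + 1)"
proof -
  have "([(i, True), (i + 1, True), (i, True)], [(i + 1, True), (i, True), (i + 1, True)])
      \<in> braid_relations n"
    using assms by (force simp: braid_relations_def)
  then have "word_cong {1..<n} (braid_relations n) [(i, True), (i + 1, True), (i, True)]
      [(i + 1, True), (i, True), (i + 1, True)]"
    using assms by (intro word_cong.relator) (auto simp: group_words_def)
  then show ?thesis
    using assms by (simp add: braid_group_def braid_generator_def presented_mult group_words_def
        word_rel_class_eq)
qed

section \<open>Invariants of a braid\<close>

locale braids =
  fixes n :: nat
begin

abbreviation B where "B \<equiv> braid_group n"
abbreviation \<sigma> where "\<sigma> \<equiv> braid_generator n"
abbreviation \<pi> where "\<pi> \<equiv> braid_perm n"
abbreviation P where "P \<equiv> pure_braids n"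

sublocale group B by (rule group_braid_group)

definition link :: "nat group_word set \<Rightarrow> nat \<Rightarrow> nat \<Rightarrow> int" where
  "link x = fst (magnus n x)"

definition triple :: "nat group_word set \<Rightarrow> nat \<Rightarrow> nat \<Rightarrow> nat \<Rightarrow> int" where
  "triple x = fst (snd (magnus n x))"

definition strand :: "nat group_word set \<Rightarrow> nat \<Rightarrow> nat" where
  "strand x = snd (snd (magnus n x))"

lemma magnus_mult:
  assumes "x \<in> carrier B" "y \<in> carrier B"
  shows "magnus n (x \<otimes>\<^bsub>B\<^esub> y) = magnus_mult (magnus n x) (magnus n y)"
  using hom_mult[OF magnus_hom assms] by (simp add: magnus_group_def)

lemma
  assumes "x \<in> carrier B" "y \<in> carrier B"
  shows link_mult: "link (x \<otimes>\<^bsub>B\<^esub> y) a b = link x a b + link y (strand x a) (strand x b)"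
    and triple_mult: "triple (x \<otimes>\<^bsub>B\<^esub> y) a b c =
      triple x a b c + triple y (strand x a) (strand x b) (strand x c) +
      link y (strand x a) (strand x b) * link x b c +
      link y (strand x a) (strand x c) * (link x a b - link x c b)"
    and strand_mult: "strand (x \<otimes>\<^bsub>B\<^esub> y) a = strand y (strand x a)"
  unfolding link_def triple_def strand_def magnus_mult[OF assms]
  by (cases "magnus n x"; cases "magnus n y"; simp)+

lemma
  shows link_one [simp]: "link \<one>\<^bsub>B\<^esub> a b = 0"
    and triple_one [simp]: "triple \<one>\<^bsub>B\<^esub> a b c = 0"
    and strand_one [simp]: "strand \<one>\<^bsub>B\<^esub> a = a"
proof -
  interpret group_hom B magnus_group "magnus n"
    by (intro group_hom.intro group_hom_axioms.intro group_braid_group group_magnus_group magnus_hom)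
  show "link \<one>\<^bsub>B\<^esub> a b = 0" "triple \<one>\<^bsub>B\<^esub> a b c = 0" "strand \<one>\<^bsub>B\<^esub> a = a"
    unfolding link_def triple_def strand_def hom_one by (simp_all add: magnus_group_def)
qed

lemma
  assumes "i \<in> {1..<n}"
  shows link_generator: "link (\<sigma> i) a b = of_bool (a = i \<and> b = i + 1)"
    and triple_generator: "triple (\<sigma> i) a b c = 0"
    and strand_generator: "strand (\<sigma> i) = transpose i (i + 1)"
  by (simp_all add: link_def triple_def strand_def magnus_braid_generator[OF assms]
      magnus_generator_def)

lemma perm_mult:
  "x \<in> carrier B \<Longrightarrow> y \<in> carrier B \<Longrightarrow> \<pi> (x \<otimes>\<^bsub>B\<^esub> y) = \<pi> x \<circ> \<pi> y"
  using hom_mult[OF braid_perm_hom] by (simp add: sym_group_mult)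

lemma perm_permutes: "x \<in> carrier B \<Longrightarrow> \<pi> x permutes {1..n}"
  using hom_in_carrier[OF braid_perm_hom] by (simp add: sym_group_carrier)

lemma perm_one [simp]: "\<pi> \<one>\<^bsub>B\<^esub> = id"
proof -
  interpret group_hom B "sym_group n" \<pi>
    by (intro group_hom.intro group_hom_axioms.intro group_braid_group sym_group_is_group braid_perm_hom)
  show ?thesis using hom_one by (simp add: sym_group_one)
qed

lemma generator_closed [simp]: "1 \<le> i \<Longrightarrow> i < n \<Longrightarrow> \<sigma> i \<in> carrier B"
  by (simp add: braid_generator_closed)

lemma braid_induct [consumes 1, case_names one generator mult inv]:
  assumes "x \<in> carrier B"
    and "Q \<one>\<^bsub>B\<^esub>"
    and "\<And>i. 1 \<le> i \<Longrightarrow> i < n \<Longrightarrow> Q (\<sigma> i)"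
    and "\<And>x y. x \<in> carrier B \<Longrightarrow> y \<in> carrier B \<Longrightarrow> Q x \<Longrightarrow> Q y \<Longrightarrow> Q (x \<otimes>\<^bsub>B\<^esub> y)"
    and "\<And>x. x \<in> carrier B \<Longrightarrow> Q x \<Longrightarrow> Q (inv\<^bsub>B\<^esub> x)"
  shows "Q x"
proof -
  have "x \<in> generate B (\<sigma> ` {1..<n})" using assms(1) by (simp add: braid_group_generate)
  then show ?thesis
  proof induction
    case (eng h1 h2)
    then show ?case using assms(4) by (simp add: braid_group_generate)
  qed (use assms in auto)
qed

lemma strand_perm:
  assumes "x \<in> carrier B"
  shows "strand x (\<pi> x a) = a" "\<pi> x (strand x a) = a"
proof -
  have "\<forall>a. strand x (\<pi> x a) = a \<and> \<pi> x (strand x a) = a"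
    using assms
  proof (induction rule: braid_induct)
    case (generator i)
    then show ?case by (simp add: strand_generator braid_perm_generator)
  next
    case (mult x y)
    then show ?case by (simp add: strand_mult perm_mult)
  next
    case (inv x)
    have i: "inv\<^bsub>B\<^esub> x \<in> carrier B" using inv by simp
    have 1: "strand (inv\<^bsub>B\<^esub> x) (strand x a) = a" "strand x (strand (inv\<^bsub>B\<^esub> x) a) = a"
      "\<pi> x (\<pi> (inv\<^bsub>B\<^esub> x) a) = a" "\<pi> (inv\<^bsub>B\<^esub> x) (\<pi> x a) = a" for a
      using strand_mult[OF inv(1) i] strand_mult[OF i inv(1)]
        fun_cong[OF perm_mult[OF inv(1) i]] fun_cong[OF perm_mult[OF i inv(1)]] inv(1) by simp_all
    with inv show ?case by metis
  qed simp
  then show "strand x (\<pi> x a) = a" "\<pi> x (strand x a) = a" by auto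
qed

lemma strand_eq_iff [simp]: "x \<in> carrier B \<Longrightarrow> strand x a = strand x b \<longleftrightarrow> a = b"
  by (metis strand_perm)

lemma perm_inv:
  assumes "x \<in> carrier B"
  shows "\<pi> (inv\<^bsub>B\<^esub> x) = strand x"
proof
  fix a
  have "\<pi> x (\<pi> (inv\<^bsub>B\<^esub> x) a) = a"
    using fun_cong[OF perm_mult[of x "inv\<^bsub>B\<^esub> x"]] assms by simp
  then show "\<pi> (inv\<^bsub>B\<^esub> x) a = strand x a" using strand_perm[OF assms] by metis
qed

lemma strand_inv: "x \<in> carrier B \<Longrightarrow> strand (inv\<^bsub>B\<^esub> x) = \<pi> x"
  using strand_mult[of x "inv\<^bsub>B\<^esub> x"] strand_perm by (metis ext inv_closed r_inv strand_one)

lemma link_inv: "x \<in> carrier B \<Longrightarrow> link (inv\<^bsub>B\<^esub> x) a b = - link x (\<pi> x a) (\<pi> x b)"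
  using link_mult[of "inv\<^bsub>B\<^esub> x" x a b] by (simp add: strand_inv)

lemma triple_inv:
  "x \<in> carrier B \<Longrightarrow> triple (inv\<^bsub>B\<^esub> x) a b c =
    - triple x (\<pi> x a) (\<pi> x b) (\<pi> x c) + link x (\<pi> x a) (\<pi> x b) * link x (\<pi> x b) (\<pi> x c) +
    link x (\<pi> x a) (\<pi> x c) * (link x (\<pi> x a) (\<pi> x b) - link x (\<pi> x c) (\<pi> x b))"
  using triple_mult[of "inv\<^bsub>B\<^esub> x" x a b c] by (simp add: strand_inv link_inv algebra_simps)

lemma perm_eq_iff [simp]: "x \<in> carrier B \<Longrightarrow> \<pi> x a = \<pi> x b \<longleftrightarrow> a = b"
  by (metis strand_perm)

text \<open>Artin's action fixes the ordered product of the free generators, and the coefficient of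
  \<open>X_a X_b\<close> in this identity gives the formula. On words: a letter that carries
  \<open>a\<close> from the left of \<open>b\<close> to its right raises \<open>link x a b\<close>
  by one and leaves \<open>link x b a\<close> alone.\<close>

lemma link_flip:
  assumes "x \<in> carrier B" "a \<noteq> b"
  shows "link x b a = link x a b - of_bool (a < b) + of_bool (strand x a < strand x b)"
  using assms
proof (induction arbitrary: a b rule: braid_induct)
  case (generator i)
  then show ?case by (auto simp: link_generator strand_generator transpose_def)
next
  case (mult x y)
  have "strand x a \<noteq> strand x b" using mult by simp
  from mult.IH(1)[OF mult.prems] mult.IH(2)[OF this] mult.hyps show ?case
    by (simp add: link_mult strand_mult)
next
  case (inv x)
  have "\<pi> x a \<noteq> \<pi> x b" using inv by simp
  from inv.IH[OF this] inv.hyps show ?case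
    by (simp add: link_inv strand_inv strand_perm)
qed simp

text \<open>The shuffle relation in degree two between the Magnus coefficients of an element of a
  free group.\<close>

lemma triple_shuffle:
  assumes "x \<in> carrier B" "b \<noteq> c"
  shows "triple x a b c + triple x a c b = link x a b * link x a c"
  using assms
proof (induction arbitrary: a b c rule: braid_induct)
  case (generator i)
  then show ?case by (auto simp: link_generator triple_generator)
next
  case (mult x y)
  have "strand x b \<noteq> strand x c" using mult by simp
  from mult.IH(1)[OF mult.prems, of a] mult.IH(2)[OF this, of "strand x a"] mult.hyps
  show ?case by (simp add: link_mult triple_mult algebra_simps)
next
  case (inv x)
  have "\<pi> x b \<noteq> \<pi> x c" using inv by simp
  from inv.IH[OF this, of "\<pi> x a"] inv.hyps
  show ?case by (simp add: link_inv triple_inv algebra_simps)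
qed simp

text \<open>The invariance of the ordered product of the free generators again, now in degree three
  and combined with \<open>triple_shuffle\<close>. On \<open>\<Gamma>2\<close> the right-hand side
  vanishes and antisymmetry remains.\<close>

lemma triple_flip:
  assumes "x \<in> carrier B" "a \<noteq> b" "b \<noteq> c" "a \<noteq> c"
  shows "triple x a b c + triple x b a c =
    link x a b * link x b c + link x a b * link x a c - link x b c * link x a c +
    link x a c * (of_bool (b < c) + of_bool (strand x a < strand x b) - 1) +
    link x b c * (of_bool (a < c) - of_bool (a < b))"
  using assms
proof (induction arbitrary: a b c rule: braid_induct)
  case (generator i)
  have "strand (\<sigma> i) a < strand (\<sigma> i) b \<longleftrightarrow>
      (if a = i \<and> b = i + 1 then False else if a = i + 1 \<and> b = i then True else a < b)"
    using generator by (auto simp: strand_generator transpose_def)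
  moreover consider "a = i" "b = i + 1" | "b = i" "c = i + 1" | "a = i" "c = i + 1" |
      "link (\<sigma> i) a b = 0" "link (\<sigma> i) b c = 0" "link (\<sigma> i) a c = 0"
    using generator by (auto simp: link_generator)
  ultimately show ?case
    using generator by cases (auto simp: link_generator triple_generator)
next
  case (mult x y)
  let ?a = "strand x a" and ?b = "strand x b" and ?c = "strand x c"
  have d: "?a \<noteq> ?b" "?b \<noteq> ?c" "?a \<noteq> ?c" using mult by simp_all
  \<comment> \<open>These reduce the linking numbers of each pair to one orientation; with the order
    bits as unknowns, a polynomial identity is left.\<close>
  note flips = link_flip[OF mult.hyps(1) mult.prems(1)]
    link_flip[OF mult.hyps(1) mult.prems(2)] link_flip[OF mult.hyps(1) mult.prems(3)]
    link_flip[OF mult.hyps(2) d(1)] link_flip[OF mult.hyps(2) d(2)]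
    link_flip[OF mult.hyps(2) d(3)]
  show ?case
    using mult.IH(1)[OF mult.prems] mult.IH(2)[OF d] flips
    unfolding link_mult[OF mult.hyps(1,2)] triple_mult[OF mult.hyps(1,2)] strand_mult[OF mult.hyps(1,2)]
    by Groebner_Basis.algebra
next
  case (inv x)
  let ?a = "\<pi> x a" and ?b = "\<pi> x b" and ?c = "\<pi> x c"
  have d: "?a \<noteq> ?b" "?b \<noteq> ?c" "?a \<noteq> ?c" using inv by simp_all
  note flips = link_flip[OF inv.hyps d(1)] link_flip[OF inv.hyps d(2)] link_flip[OF inv.hyps d(3)]
  show ?case
    using inv.IH[OF d] flips
    unfolding link_inv[OF inv.hyps] triple_inv[OF inv.hyps] strand_inv[OF inv.hyps]
      strand_perm[OF inv.hyps]
    by Groebner_Basis.algebra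
qed simp

text \<open>The cube sums \<open>triple x\<close> over the three rotations of
  \<open>a, b, c\<close>. By the symmetries each rotation contributes \<open>t\<close> up to linking
  numbers and order bits, so \<open>t\<close> drops out modulo 3.\<close>

lemma three_cycle_cube:
  assumes x: "x \<in> carrier B" and q: "strand x a = c" "strand x b = a" "strand x c = b"
    and d: "a \<noteq> b" "b \<noteq> c" "a \<noteq> c"
    and link: "link (x \<otimes>\<^bsub>B\<^esub> x \<otimes>\<^bsub>B\<^esub> x) a b = 0"
  shows "triple (x \<otimes>\<^bsub>B\<^esub> x \<otimes>\<^bsub>B\<^esub> x) a b c mod 3 = 2"
proof -
  define u where "u = link x a b"
  define v where "v = link x b c"
  define t where "t = triple x a b c"
  define \<alpha> \<beta> \<gamma> :: int where "\<alpha> = of_bool (a < b)" "\<beta> = of_bool (b < c)" "\<gamma> = of_bool (c < a)"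
  note defs = u_def v_def t_def \<alpha>_\<beta>_\<gamma>_def
  have comp: "of_bool (b < a) = 1 - \<alpha>" "of_bool (c < b) = 1 - \<beta>" "of_bool (a < c) = 1 - \<gamma>"
    using d by (auto simp: \<alpha>_\<beta>_\<gamma>_def)
  \<comment> \<open>The linking number of the cube at \<open>a, b\<close> is
    \<open>u + v + link x c a\<close>.\<close>
  have ca: "link x c a = - u - v"
    using link x q by (simp add: link_mult strand_mult u_def v_def)
  have ba: "link x b a = u - \<alpha> + \<gamma>" and cb: "link x c b = v - \<beta> + \<alpha>"
    and ac: "link x a c = - u - v - \<gamma> + \<beta>"
    using link_flip[OF x d(1)] link_flip[OF x d(2)] link_flip[OF x d(3)[symmetric]] ca q
    by (simp_all add: defs)
  have cab: "triple x c a b = link x a c * link x c b - link x c b * u + u * (1 - 2 * \<beta>) +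
      link x c b * (\<alpha> + \<gamma> - 1) + t"
    using triple_flip[OF x d(3) d(2)[symmetric] d(1)] triple_shuffle[OF x d(2), of a] comp q
    by (simp add: defs algebra_simps)
  have bca: "triple x b c a = (u - \<alpha> + \<gamma>) * v - u * v - u * link x a c + v * link x a c -
      link x a c * (\<beta> + \<gamma> - 1) - v * (1 - \<gamma> - \<alpha>) + t"
    using triple_flip[OF x d] triple_shuffle[OF x d(3)[symmetric], of b] ba comp q
    by (simp add: defs algebra_simps)
  have "triple (x \<otimes>\<^bsub>B\<^esub> x \<otimes>\<^bsub>B\<^esub> x) a b c =
      t + triple x c a b + triple x b c a + link x c a * v + link x c b * (u - link x c b) +
      v * (v + u) + link x b a * (u + link x c a - link x c b - link x b a)"
    using x q by (simp add: link_mult triple_mult strand_mult defs algebra_simps)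
  note * = this[unfolded cab bca ba cb ca ac]
  \<comment> \<open>The inequalities \<open>a < b\<close>, \<open>b < c\<close>,
    \<open>c < a\<close> neither all hold nor all fail. The residue comes from this: for
    \<open>u = v = t = 0\<close> the expression is -1 in each of the six cases, whereas three equal
    bits would give 0.\<close>
  consider "\<alpha> = 1" "\<beta> = 1" "\<gamma> = 0" | "\<alpha> = 1" "\<beta> = 0" "\<gamma> = 1" | "\<alpha> = 0" "\<beta> = 1" "\<gamma> = 1" |
    "\<alpha> = 1" "\<beta> = 0" "\<gamma> = 0" | "\<alpha> = 0" "\<beta> = 0" "\<gamma> = 1" | "\<alpha> = 0" "\<beta> = 1" "\<gamma> = 0"
    using d by (auto simp: \<alpha>_\<beta>_\<gamma>_def)
  then have "triple (x \<otimes>\<^bsub>B\<^esub> x \<otimes>\<^bsub>B\<^esub> x) a b c =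
      3 * (t - 1 - u * v - v * v + (2 * \<beta> - 1) * v) + 2"
    by cases (simp_all add: * algebra_simps)
  then show ?thesis by presburger
qed

end

section \<open>The pure braid group is the normal closure of the squares\<close>

context braids begin

abbreviation mul (infixl "\<cdot>" 70) where "x \<cdot> y \<equiv> x \<otimes>\<^bsub>B\<^esub> y"
abbreviation iv where "iv x \<equiv> inv\<^bsub>B\<^esub> x"

lemma cancel_left [simp]: "x \<in> carrier B \<Longrightarrow> y \<in> carrier B \<Longrightarrow> iv x \<cdot> (x \<cdot> y) = y"
  "x \<in> carrier B \<Longrightarrow> y \<in> carrier B \<Longrightarrow> x \<cdot> (iv x \<cdot> y) = y"
  by (simp_all add: m_assoc[symmetric])

lemma pure_iff: "x \<in> P \<longleftrightarrow> x \<in> carrier B \<and> \<pi> x = id"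
  by (auto simp: pure_braids_def kernel_def sym_group_one)

lemma pure_closed [simp]: "x \<in> P \<Longrightarrow> x \<in> carrier B" by (simp add: pure_iff)

lemma subgroup_pure: "subgroup P B"
  by (rule normal_imp_subgroup[OF pure_braids_normal])

lemma strand_pure [simp]: "x \<in> P \<Longrightarrow> strand x a = a"
  by (metis id_apply pure_iff strand_perm(2))

lemma gen_comm:
  assumes "1 \<le> i" "1 \<le> j" "i < n" "j < n" "i + 2 \<le> j \<or> j + 2 \<le> i"
  shows "\<sigma> i \<cdot> \<sigma> j = \<sigma> j \<cdot> \<sigma> i"
  using assms by (intro braid_generator_commute) auto

lemma gen_braid: "1 \<le> i \<Longrightarrow> i + 2 \<le> n \<Longrightarrow> \<sigma> i \<cdot> \<sigma> (i + 1) \<cdot> \<sigma> i = \<sigma> (i + 1) \<cdot> \<sigma> i \<cdot> \<sigma> (i + 1)"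
  by (rule braid_generator_braid)

lemma perm_generator: "1 \<le> i \<Longrightarrow> i < n \<Longrightarrow> \<pi> (\<sigma> i) = transpose i (i + 1)"
  by (simp add: braid_perm_generator)

definition square_closure :: "nat group_word set set" where
  "square_closure = generate B {b \<cdot> (\<sigma> i \<cdot> \<sigma> i) \<cdot> iv b | b i. b \<in> carrier B \<and> i \<in> {1..<n}}"

lemma square_closure_normal: "square_closure \<lhd> B"
  unfolding square_closure_def
proof (rule normal_generateI)
  fix h g assume "h \<in> {b \<cdot> (\<sigma> i \<cdot> \<sigma> i) \<cdot> iv b | b i. b \<in> carrier B \<and> i \<in> {1..<n}}" and g: "g \<in> carrier B"
  then obtain b i where bi: "b \<in> carrier B" "i \<in> {1..<n}" "h = b \<cdot> (\<sigma> i \<cdot> \<sigma> i) \<cdot> iv b" by blast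
  have "g \<cdot> h \<cdot> iv g = (g \<cdot> b) \<cdot> (\<sigma> i \<cdot> \<sigma> i) \<cdot> iv (g \<cdot> b)"
    using bi g by (simp add: inv_mult_group m_assoc)
  then show "g \<cdot> h \<cdot> iv g \<in> {b \<cdot> (\<sigma> i \<cdot> \<sigma> i) \<cdot> iv b | b i. b \<in> carrier B \<and> i \<in> {1..<n}}"
    using bi g by blast
qed auto

lemma square_pure: "i \<in> {1..<n} \<Longrightarrow> \<sigma> i \<cdot> \<sigma> i \<in> P"
  by (simp add: pure_iff perm_mult perm_generator)

lemma pure_conj: "b \<in> carrier B \<Longrightarrow> x \<in> P \<Longrightarrow> b \<cdot> x \<cdot> iv b \<in> P"
  by (rule normal.inv_op_closed2[OF pure_braids_normal])

lemma square_closure_pure: "square_closure \<subseteq> P"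
  unfolding square_closure_def
  by (rule generate_subgroup_incl[OF _ subgroup_pure]) (auto intro!: pure_conj square_pure)

lemma square_conj_in: "b \<in> carrier B \<Longrightarrow> 1 \<le> i \<Longrightarrow> i < n \<Longrightarrow> b \<cdot> (\<sigma> i \<cdot> \<sigma> i) \<cdot> iv b \<in> square_closure"
  unfolding square_closure_def by (auto intro!: generate.incl)

section \<open>Coset representatives of parabolic subgroups\<close>

definition parabolic :: "nat \<Rightarrow> nat group_word set set" where
  "parabolic m = generate B (\<sigma> ` {1..<m})"

text \<open>A product of \<open>k\<close> letters with indices falling from \<open>m\<close>, the
  usual representatives of the cosets of the symmetric group on \<open>m\<close> points in that on
  \<open>m + 1\<close> points.\<close>

primrec descent :: "nat \<Rightarrow> nat \<Rightarrow> nat group_word set" where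
  "descent m 0 = \<one>\<^bsub>B\<^esub>"
| "descent m (Suc k) = descent m k \<cdot> \<sigma> (m - k)"

lemma parabolic_subgroup: "m \<le> n \<Longrightarrow> subgroup (parabolic m) B"
  unfolding parabolic_def by (rule generate_is_subgroup) auto

lemma parabolic_closed: "m \<le> n \<Longrightarrow> x \<in> parabolic m \<Longrightarrow> x \<in> carrier B"
  using subgroup.subset[OF parabolic_subgroup] by blast

lemma descent_closed [simp]: "m < n \<Longrightarrow> k \<le> m \<Longrightarrow> descent m k \<in> carrier B"
  by (induction k) simp_all

lemma descent_commute:
  "m < n \<Longrightarrow> 1 \<le> i \<Longrightarrow> i + k < m \<Longrightarrow> descent m k \<cdot> \<sigma> i = \<sigma> i \<cdot> descent m k"
proof (induction k)
  case (Suc k)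
  have "\<sigma> (m - k) \<cdot> \<sigma> i = \<sigma> i \<cdot> \<sigma> (m - k)" using Suc.prems by (intro gen_comm) auto
  then have "descent m (Suc k) \<cdot> \<sigma> i = (descent m k \<cdot> \<sigma> i) \<cdot> \<sigma> (m - k)"
    using Suc.prems by (simp add: m_assoc)
  then show ?case using Suc by (simp add: m_assoc)
qed simp

text \<open>At the letters \<open>\<sigma> i \<cdot> \<sigma> (i - 1)\<close> of the descent the
  braid relation lowers the index of the passing generator by one; it commutes with all other
  letters it meets.\<close>

lemma descent_shift:
  "m < n \<Longrightarrow> i \<le> m \<Longrightarrow> m + 2 \<le> i + k \<Longrightarrow> k \<le> m \<Longrightarrow>
    descent m k \<cdot> \<sigma> i = \<sigma> (i - 1) \<cdot> descent m k"
proof (induction k)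
  case (Suc k)
  show ?case
  proof (cases "m + 2 \<le> i + k")
    case True
    have "\<sigma> (m - k) \<cdot> \<sigma> i = \<sigma> i \<cdot> \<sigma> (m - k)" using Suc.prems True by (intro gen_comm) auto
    then have "descent m (Suc k) \<cdot> \<sigma> i = (descent m k \<cdot> \<sigma> i) \<cdot> \<sigma> (m - k)"
      using Suc.prems by (simp add: m_assoc)
    then show ?thesis using Suc True by (simp add: m_assoc)
  next
    case False
    \<comment> \<open>Here \<open>i + k = m + 1\<close>, so \<open>descent m (Suc k)\<close>
      consists of \<open>descent m j\<close> followed by
      \<open>\<sigma> i \<cdot> \<sigma> (i - 1)\<close>.\<close>
    define j where "j = m - i"
    define s where "s = i - 1"
    have k: "k = Suc j" "m - j = s + 1" "m - Suc j = s" "i = s + 1" "1 \<le> s" "s + 2 \<le> n" "s + j < m"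
      using False Suc.prems by (auto simp: j_def s_def)
    have "descent m (Suc k) \<cdot> \<sigma> i = descent m j \<cdot> (\<sigma> (s + 1) \<cdot> \<sigma> s \<cdot> \<sigma> (s + 1))"
      using k Suc.prems by (simp add: m_assoc)
    also have "\<dots> = descent m j \<cdot> (\<sigma> s \<cdot> \<sigma> (s + 1) \<cdot> \<sigma> s)"
      using k by (simp only: gen_braid)
    also have "\<dots> = (descent m j \<cdot> \<sigma> s) \<cdot> (\<sigma> (s + 1) \<cdot> \<sigma> s)"
      using k Suc.prems by (simp add: m_assoc)
    also have "\<dots> = \<sigma> (i - 1) \<cdot> descent m (Suc k)"
      using k Suc.prems by (simp add: descent_commute m_assoc)
    finally show ?thesis .
  qed
qed simp

text \<open>Killing the squares should turn braids into permutations, so this copies the coset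
  decomposition of a symmetric group, with \<open>square_closure\<close> absorbing the
  error.\<close>

definition descent_cells :: "nat \<Rightarrow> nat group_word set set" where
  "descent_cells m = {u \<cdot> h \<cdot> descent m k | u h k. u \<in> square_closure \<and> h \<in> parabolic m \<and> k \<le> m}"

lemma descent_cellsI:
  "u \<in> square_closure \<Longrightarrow> h \<in> parabolic m \<Longrightarrow> k \<le> m \<Longrightarrow> u \<cdot> h \<cdot> descent m k \<in> descent_cells m"
  unfolding descent_cells_def by blast

lemma square_closure_closed [simp]: "x \<in> square_closure \<Longrightarrow> x \<in> carrier B"
  using square_closure_pure by auto

lemma descent_cells_square:
  assumes m: "m < n" and y: "y \<in> descent_cells m" and v: "v \<in> square_closure"
  shows "y \<cdot> v \<in> descent_cells m"
proof -
  interpret N: normal square_closure B by (rule square_closure_normal)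
  obtain u h k where *: "u \<in> square_closure" "h \<in> parabolic m" "k \<le> m" "y = u \<cdot> h \<cdot> descent m k"
    using y by (auto simp: descent_cells_def)
  let ?c = "h \<cdot> descent m k"
  have h: "h \<in> carrier B" using parabolic_closed[of m] * m by simp
  have "y \<cdot> v = (u \<cdot> (?c \<cdot> v \<cdot> iv ?c)) \<cdot> h \<cdot> descent m k"
    using * h m v by (simp add: m_assoc inv_mult_group)
  moreover have "u \<cdot> (?c \<cdot> v \<cdot> iv ?c) \<in> square_closure"
    using * h m v by (intro N.m_closed N.inv_op_closed2) simp_all
  ultimately show ?thesis using * by (simp only: descent_cellsI)
qed

text \<open>The new letter lengthens the descent, repeats its last letter, or passes through it to
  join \<open>h\<close>. Only a repetition creates a square, and normality moves that square to the
  front.\<close>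

lemma descent_cells_generator:
  assumes m: "m < n" and y: "y \<in> descent_cells m" and i: "1 \<le> i" "i \<le> m"
  shows "y \<cdot> \<sigma> i \<in> descent_cells m"
proof -
  interpret N: normal square_closure B by (rule square_closure_normal)
  obtain u h k where *: "u \<in> square_closure" "h \<in> parabolic m" "k \<le> m" "y = u \<cdot> h \<cdot> descent m k"
    using y by (auto simp: descent_cells_def)
  have c: "u \<in> carrier B" "h \<in> carrier B" "descent m k \<in> carrier B" "\<sigma> i \<in> carrier B"
    using * parabolic_closed[of m] m i by simp_all
  have para: "h \<cdot> \<sigma> j \<in> parabolic m" if "1 \<le> j" "j < m" for j
    using that *(2) unfolding parabolic_def by (intro generate.eng) (auto intro: generate.incl)
  consider "i = m - k" | "k \<noteq> 0" "i = m + 1 - k" | "i + k < m" | "m + 2 \<le> i + k" using i *(3) by linarith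
  then show ?thesis
  proof cases
    case 1
    then have "y \<cdot> \<sigma> i = u \<cdot> h \<cdot> descent m (Suc k)" "Suc k \<le> m" using * c i by (simp_all add: m_assoc)
    then show ?thesis using * by (simp only: descent_cellsI)
  next
    case 2
    then obtain k' where k': "k = Suc k'" by (cases k) auto
    then have d: "descent m k = descent m k' \<cdot> \<sigma> i" and d': "descent m k' \<in> carrier B"
      using 2 * m by (simp_all add: Suc_diff_le)
    let ?c = "h \<cdot> descent m k'"
    have "y \<cdot> \<sigma> i = (u \<cdot> (?c \<cdot> (\<sigma> i \<cdot> \<sigma> i) \<cdot> iv ?c)) \<cdot> h \<cdot> descent m k'"
      using c d' by (simp add: *(4) d m_assoc inv_mult_group)
    moreover have "u \<cdot> (?c \<cdot> (\<sigma> i \<cdot> \<sigma> i) \<cdot> iv ?c) \<in> square_closure"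
      using * c d' i m by (intro N.m_closed square_conj_in) simp_all
    moreover have "k' \<le> m" using * k' by simp
    ultimately show ?thesis using * by (simp only: descent_cellsI)
  next
    case 3
    then have "y \<cdot> \<sigma> i = u \<cdot> (h \<cdot> \<sigma> i) \<cdot> descent m k"
      using c * m i by (simp add: m_assoc descent_commute)
    moreover have "h \<cdot> \<sigma> i \<in> parabolic m" using 3 i by (intro para) auto
    ultimately show ?thesis using * by (simp only: descent_cellsI)
  next
    case 4
    have s: "\<sigma> (i - 1) \<in> carrier B" using 4 * m i by simp
    have "y \<cdot> \<sigma> i = u \<cdot> (h \<cdot> \<sigma> (i - 1)) \<cdot> descent m k"
      using c s * 4 i m descent_shift[of m i k] by (simp add: m_assoc)
    moreover have "h \<cdot> \<sigma> (i - 1) \<in> parabolic m" using 4 * i by (intro para) auto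
    ultimately show ?thesis using * by (simp only: descent_cellsI)
  qed
qed

lemma parabolic_Suc:
  assumes m: "m < n"
  shows "parabolic (Suc m) \<subseteq> descent_cells m"
proof -
  have cells: "descent_cells m \<subseteq> carrier B"
    using m parabolic_closed[of m] by (auto simp: descent_cells_def)
  have "\<forall>y\<in>descent_cells m. y \<cdot> x \<in> descent_cells m" if "x \<in> parabolic (Suc m)" for x
    using that unfolding parabolic_def
  proof induction
    case one
    then show ?case using cells by auto
  next
    case (incl h)
    then show ?case using descent_cells_generator[OF m] by auto
  next
    case (inv h)
    then obtain i where i: "h = \<sigma> i" "1 \<le> i" "i \<le> m" by auto
    show ?case
    proof
      fix y assume y: "y \<in> descent_cells m"
      \<comment> \<open>An inverse generator is the generator times the inverse of its square;
        conjugation by one gives the square the shape that \<open>square_conj_in\<close>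
        expects.\<close>
      let ?v = "\<one>\<^bsub>B\<^esub> \<cdot> (\<sigma> i \<cdot> \<sigma> i) \<cdot> iv \<one>\<^bsub>B\<^esub>"
      have "iv ?v \<in> square_closure"
        using i m by (intro subgroup.m_inv_closed[OF normal_imp_subgroup[OF square_closure_normal]]
            square_conj_in) auto
      from descent_cells_square[OF m descent_cells_generator[OF m y i(2,3)] this]
      show "y \<cdot> iv h \<in> descent_cells m"
        using i m cells y by (auto simp: m_assoc inv_mult_group)
    qed
  next
    case (eng h1 h2)
    have "h1 \<in> carrier B" "h2 \<in> carrier B"
      using eng(1,2) parabolic_closed[of "Suc m"] m by (auto simp: parabolic_def)
    then have "y \<cdot> (h1 \<cdot> h2) = y \<cdot> h1 \<cdot> h2" if "y \<in> descent_cells m" for y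
      using that cells by (auto simp: m_assoc)
    then show ?case using eng by simp
  qed
  moreover have "\<one>\<^bsub>B\<^esub> \<cdot> \<one>\<^bsub>B\<^esub> \<cdot> descent m 0 \<in> descent_cells m"
    by (rule descent_cellsI) (simp_all add: parabolic_def generate.one square_closure_def)
  then have "\<one>\<^bsub>B\<^esub> \<in> descent_cells m" by simp
  ultimately have "\<one>\<^bsub>B\<^esub> \<cdot> x \<in> descent_cells m" if "x \<in> parabolic (Suc m)" for x
    using that by blast
  then show ?thesis using parabolic_closed[of "Suc m"] m by auto
qed

lemma perm_descent: "m < n \<Longrightarrow> k \<le> m \<Longrightarrow> \<pi> (descent m k) (m + 1 - k) = m + 1"
proof (induction k)
  case (Suc k)
  then show ?case by (simp add: perm_mult perm_generator Suc_diff_Suc Suc_diff_le)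
qed simp

lemma perm_parabolic:
  assumes m: "m \<le> n" and x: "x \<in> parabolic m" and j: "m < j"
  shows "\<pi> x j = j"
  using x unfolding parabolic_def
proof induction
  case (inv h)
  then show ?case using m j by (auto simp: perm_inv strand_generator transpose_def)
next
  case (eng h1 h2)
  then have "h1 \<in> carrier B" "h2 \<in> carrier B"
    using parabolic_closed[OF m] by (auto simp: parabolic_def)
  with eng show ?case by (simp add: perm_mult)
qed (use m j in \<open>auto simp: perm_generator transpose_def\<close>)

text \<open>Downward induction on \<open>m\<close>: among the cells, only the one with
  \<open>k = 0\<close> contains braids whose permutation fixes \<open>m + 1\<close>. The case
  \<open>m = 0\<close> identifies \<open>P\<close>, and the case \<open>m = n - 2\<close> serves
  \<open>twist_unique\<close>.\<close>

lemma stabilizer_decomp: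
  assumes x: "x \<in> carrier B" and "m \<le> n" and "\<And>j. m < j \<Longrightarrow> j \<le> n \<Longrightarrow> \<pi> x j = j"
  obtains u h where "u \<in> square_closure" "h \<in> parabolic m" "x = u \<cdot> h"
proof -
  interpret N: normal square_closure B by (rule square_closure_normal)
  have "\<exists>u h. u \<in> square_closure \<and> h \<in> parabolic m \<and> x = u \<cdot> h"
    using assms(2,3)
  proof (induction m rule: inc_induct)
    case base
    have "x \<in> parabolic n" using x by (simp add: parabolic_def braid_group_generate)
    then have "\<one>\<^bsub>B\<^esub> \<in> square_closure \<and> x \<in> parabolic n \<and> x = \<one>\<^bsub>B\<^esub> \<cdot> x" using x by simp
    then show ?case by blast
  next
    case (step m)
    have "\<exists>u h. u \<in> square_closure \<and> h \<in> parabolic (Suc m) \<and> x = u \<cdot> h"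
      by (rule step.IH) (simp add: step.prems)
    then obtain u h where uh: "u \<in> square_closure" "h \<in> parabolic (Suc m)" "x = u \<cdot> h"
      by blast
    have m: "m < n" by (rule step.hyps)
    have "h \<in> descent_cells m" using parabolic_Suc[OF m] uh(2) by blast
    then obtain u' h' k where *: "u' \<in> square_closure" "h' \<in> parabolic m" "k \<le> m"
        "h = u' \<cdot> h' \<cdot> descent m k"
      by (auto simp: descent_cells_def)
    have c: "u \<in> carrier B" "u' \<in> carrier B" "h' \<in> carrier B" "descent m k \<in> carrier B"
      using uh(1) *(1-3) parabolic_closed[of m h'] m by simp_all
    have "\<pi> u = id" "\<pi> u' = id" using uh(1) *(1) square_closure_pure pure_iff by blast+
    then have "\<pi> x (m + 1 - k) = m + 1"
      using c perm_descent[OF m *(3)] perm_parabolic[of m h' "m + 1"] m *(2)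
      by (simp add: uh(3) *(4) perm_mult)
    moreover have "\<pi> x (m + 1) = m + 1" using step.prems m by simp
    ultimately have "m + 1 - k = m + 1" using perm_eq_iff[OF x, of "m + 1 - k" "m + 1"] by simp
    then have "k = 0" by simp
    then have "x = (u \<cdot> u') \<cdot> h'" using c by (simp add: uh(3) *(4) m_assoc)
    moreover have "u \<cdot> u' \<in> square_closure" using uh * by simp
    ultimately show ?case using * by blast
  qed
  then show ?thesis using that by blast
qed

lemma pure_eq_square_closure: "P = square_closure"
proof
  show "P \<subseteq> square_closure"
  proof
    fix x assume x: "x \<in> P"
    obtain u h where "u \<in> square_closure" "h \<in> parabolic 0" "x = u \<cdot> h"
      by (rule stabilizer_decomp[of x 0]) (use x in \<open>auto simp: pure_iff\<close>)
    then show "x \<in> square_closure"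
      using generate_empty by (simp add: parabolic_def)
  qed
qed (rule square_closure_pure)

end

section \<open>Lower central quotients of the pure braid group\<close>

lemma permutes_extend:
  assumes S: "finite S" and A: "A \<subseteq> S" "inj_on f A" "f ` A \<subseteq> S"
  obtains p where "p permutes S" "\<And>x. x \<in> A \<Longrightarrow> p x = f x"
proof -
  have "card (S - A) = card (S - f ` A)"
    using assms finite_subset[OF A(1) S] by (simp add: card_Diff_subset card_image)
  then obtain g where g: "bij_betw g (S - A) (S - f ` A)"
    using S by (metis finite_Diff finite_same_card_bij)
  define p where "p x = (if x \<in> A then f x else if x \<in> S then g x else x)" for x
  have "bij_betw p A (f ` A)"
    using A by (subst bij_betw_cong[of _ _ f]) (auto simp: p_def bij_betw_def)
  moreover have "bij_betw p (S - A) (S - f ` A)"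
    using g by (subst bij_betw_cong[of _ _ g]) (auto simp: p_def)
  ultimately have "bij_betw p (A \<union> (S - A)) (f ` A \<union> (S - f ` A))"
    by (rule bij_betw_combine) auto
  moreover have "A \<union> (S - A) = S" "f ` A \<union> (S - f ` A) = S" using A by auto
  ultimately have "p permutes S"
    using A by (intro bij_imp_permutes) (auto simp: p_def)
  then show ?thesis by (rule that) (simp add: p_def)
qed

context braids begin

section \<open>Braids with a prescribed permutation\<close>

lemma transpose_in_image:
  assumes "1 \<le> a"
  shows "a + Suc d \<le> n \<Longrightarrow> \<exists>x\<in>carrier B. \<pi> x = transpose a (a + Suc d)"
proof (induction d)
  case 0
  then show ?case using assms by (intro bexI[of _ "\<sigma> a"]) (simp_all add: perm_generator)
next
  case (Suc d)
  then obtain x where x: "x \<in> carrier B" "\<pi> x = transpose a (a + Suc d)" by auto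
  let ?s = "\<sigma> (a + Suc d)"
  have s: "?s \<in> carrier B" using Suc assms by simp
  moreover have "\<pi> (?s \<cdot> x \<cdot> ?s) = transpose a (a + Suc (Suc d))"
    using x s Suc.prems assms by (auto simp: perm_mult perm_generator fun_eq_iff transpose_def)
  ultimately show ?case using x by blast
qed

lemma perm_surj:
  assumes "p permutes {1..n}"
  shows "\<exists>x\<in>carrier B. \<pi> x = p"
  using assms finite_atLeastAtMost
proof (induction p rule: permutes_induct)
  case id
  show ?case by (rule bexI[of _ "\<one>\<^bsub>B\<^esub>"]) simp_all
next
  case (swap a b p)
  have *: "\<exists>y\<in>carrier B. \<pi> y = transpose a b" if "a < b" "1 \<le> a" "b \<le> n" for a b
    using transpose_in_image[of a "b - a - 1"] that by simp
  have "\<exists>y\<in>carrier B. \<pi> y = transpose a b"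
    using *[of a b] *[of b a] swap by (cases "a < b") (auto simp: transpose_commute)
  then obtain y where "y \<in> carrier B" "\<pi> y = transpose a b" by blast
  moreover obtain x where "x \<in> carrier B" "\<pi> x = p" using swap.IH by blast
  ultimately show ?case by (intro bexI[of _ "y \<cdot> x"]) (simp_all add: perm_mult)
qed

lemma perm_prescribe:
  assumes "A \<subseteq> {1..n}" "inj_on f A" "f ` A \<subseteq> {1..n}"
  obtains x where "x \<in> carrier B" "\<And>i. i \<in> A \<Longrightarrow> \<pi> x i = f i"
  using permutes_extend[OF _ assms] perm_surj by (metis finite_atLeastAtMost)

definition cm where "cm x y = x \<cdot> y \<cdot> iv x \<cdot> iv y"

lemma cm_closed [simp]: "x \<in> carrier B \<Longrightarrow> y \<in> carrier B \<Longrightarrow> cm x y \<in> carrier B"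
  by (simp add: cm_def)

lemma cm_inv: "x \<in> carrier B \<Longrightarrow> y \<in> carrier B \<Longrightarrow> iv (cm x y) = cm y x"
  by (simp add: cm_def inv_mult_group m_assoc)

lemma cm_commute: "x \<in> carrier B \<Longrightarrow> y \<in> carrier B \<Longrightarrow> x \<cdot> y = y \<cdot> x \<Longrightarrow> cm x y = \<one>\<^bsub>B\<^esub>"
  by (simp add: cm_def) (simp add: m_assoc)

abbreviation lcs where "lcs k \<equiv> lower_central (pure_braid_group n) k"

lemma lcs_normal: "lcs k \<lhd> B" by (rule lower_central_pure_braid_normal)

lemma lcs_subgroup: "subgroup (lcs k) B" by (rule normal_imp_subgroup[OF lcs_normal])

lemma lcs_pure: "lcs k \<subseteq> P"
  using lower_central_normal[OF pure_braids_normal] by (simp add: pure_braid_group_def)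

lemma lcs_one: "lcs (Suc 0) = P" by (simp add: pure_braid_group_def)

text \<open>The series is formed in \<open>P\<close> as a group of its own. Inverses and generated
  subgroups agree with those of \<open>B\<close>, so all later computations can stay in
  \<open>B\<close>.\<close>

lemma lcs_Suc:
  assumes "k \<noteq> 0"
  shows "lcs (Suc k) = generate B {cm x y | x y. x \<in> lcs k \<and> y \<in> P}"
proof -
  obtain j where k: "k = Suc j" using assms by (cases k) auto
  have inv: "inv\<^bsub>pure_braid_group n\<^esub> x = iv x" if "x \<in> P" for x
    using that by (simp add: pure_braid_group_def m_inv_consistent[OF subgroup_pure])
  have "(\<Union>h\<in>lcs k. \<Union>k\<in>P. {h \<cdot> k \<cdot> inv\<^bsub>pure_braid_group n\<^esub> h \<cdot> inv\<^bsub>pure_braid_group n\<^esub> k}) =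
      (\<Union>h\<in>lcs k. \<Union>k\<in>P. {cm h k})"
    using lcs_pure[of k] by (intro SUP_cong refl) (auto simp: inv cm_def)
  also have "\<dots> = {cm x y | x y. x \<in> lcs k \<and> y \<in> P}" (is "_ = ?C") by auto
  finally have "lcs (Suc k) = generate (pure_braid_group n) {cm x y | x y. x \<in> lcs k \<and> y \<in> P}"
    by (simp add: k commutator_subgroup_def) (simp add: pure_braid_group_def)
  also have "\<dots> = generate B {cm x y | x y. x \<in> lcs k \<and> y \<in> P}"
  proof -
    have "cm x y \<in> P" if "x \<in> lcs k" "y \<in> P" for x y
      using that lcs_pure[of k] unfolding cm_def
      by (intro subgroup.m_closed[OF subgroup_pure] subgroup.m_inv_closed[OF subgroup_pure]) auto
    then show ?thesis
      by (subst pure_braid_group_def) (intro generate_consistent subgroup_pure, auto)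
  qed
  finally show ?thesis .
qed

lemma cm_lcs: "k \<noteq> 0 \<Longrightarrow> x \<in> lcs k \<Longrightarrow> y \<in> P \<Longrightarrow> cm x y \<in> lcs (Suc k)"
  by (auto simp: lcs_Suc intro: generate.incl)

lemma lcs_Suc_least:
  "k \<noteq> 0 \<Longrightarrow> subgroup H B \<Longrightarrow> (\<And>x y. x \<in> lcs k \<Longrightarrow> y \<in> P \<Longrightarrow> cm x y \<in> H) \<Longrightarrow> lcs (Suc k) \<subseteq> H"
  unfolding lcs_Suc by (rule generate_subgroup_incl) auto

lemma lcs_antimono: "k \<noteq> 0 \<Longrightarrow> lcs (Suc k) \<subseteq> lcs k"
proof (rule lcs_Suc_least[OF _ lcs_subgroup])
  fix x y assume "x \<in> lcs k" "y \<in> P"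
  moreover from this have "x \<in> carrier B" "y \<in> carrier B" using lcs_pure[of k] by auto
  moreover have "cm x y = x \<cdot> (y \<cdot> iv x \<cdot> iv y)" using calculation by (simp add: cm_def m_assoc)
  ultimately show "cm x y \<in> lcs k"
    using subgroup.m_closed[OF lcs_subgroup] subgroup.m_inv_closed[OF lcs_subgroup]
      normal.inv_op_closed2[OF lcs_normal] by metis
qed

abbreviation "\<Gamma>2 \<equiv> lcs 2"
abbreviation "\<Gamma>3 \<equiv> lcs 3"

lemma \<Gamma>2_pure: "x \<in> \<Gamma>2 \<Longrightarrow> x \<in> P" and \<Gamma>3_\<Gamma>2: "x \<in> \<Gamma>3 \<Longrightarrow> x \<in> \<Gamma>2"
  using lcs_pure[of 2] lcs_antimono[of 2] by (auto simp: eval_nat_numeral)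

lemma cm_\<Gamma>2: "x \<in> P \<Longrightarrow> y \<in> P \<Longrightarrow> cm x y \<in> \<Gamma>2" and cm_\<Gamma>3: "x \<in> \<Gamma>2 \<Longrightarrow> y \<in> P \<Longrightarrow> cm x y \<in> \<Gamma>3"
  using cm_lcs[of 1 x y] cm_lcs[of 2 x y] by (simp_all add: lcs_one eval_nat_numeral del: lower_central.simps)

lemma cm_pure: "x \<in> P \<Longrightarrow> y \<in> P \<Longrightarrow> cm x y \<in> P"
  using cm_\<Gamma>2 \<Gamma>2_pure by blast

lemma pure_mult [simp]: "x \<in> P \<Longrightarrow> y \<in> P \<Longrightarrow> x \<cdot> y \<in> P"
  and pure_inv [simp]: "x \<in> P \<Longrightarrow> iv x \<in> P"
  using subgroup.m_closed[OF subgroup_pure] subgroup.m_inv_closed[OF subgroup_pure] by auto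

lemma link_pure_mult: "x \<in> P \<Longrightarrow> y \<in> P \<Longrightarrow> link (x \<cdot> y) a b = link x a b + link y a b"
  by (simp add: link_mult)

lemma link_pure_inv: "x \<in> P \<Longrightarrow> link (iv x) a b = - link x a b"
  by (simp add: link_inv pure_iff)

lemma triple_pure_mult: "x \<in> P \<Longrightarrow> y \<in> P \<Longrightarrow> triple (x \<cdot> y) a b c = triple x a b c + triple y a b c +
    link y a b * link x b c + link y a c * (link x a b - link x c b)"
  by (simp add: triple_mult)

lemma link_conj: "b \<in> carrier B \<Longrightarrow> x \<in> P \<Longrightarrow> link (b \<cdot> x \<cdot> iv b) c d = link x (strand b c) (strand b d)"
  using link_mult[of "b \<cdot> x \<cdot> iv b" b c d] pure_conj[of b x] by (simp add: m_assoc link_mult)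

lemma link_pure_sym: "x \<in> P \<Longrightarrow> link x a b = link x b a"
  using link_flip[of x a b] by (cases "a = b") (simp_all)

lemma link_\<Gamma>2: "x \<in> \<Gamma>2 \<Longrightarrow> link x a b = 0"
proof -
  have "subgroup {x \<in> P. \<forall>a b. link x a b = 0} B"
    using subgroup.one_closed[OF subgroup_pure]
    by (intro subgroupI) (auto simp: link_pure_mult link_pure_inv)
  then have "lcs (Suc 1) \<subseteq> {x \<in> P. \<forall>a b. link x a b = 0}"
  proof (rule lcs_Suc_least[rotated])
    fix x y assume "x \<in> lcs 1" "y \<in> P"
    then have xy: "x \<in> P" "y \<in> P" using lcs_one by simp_all
    then show "cm x y \<in> {x \<in> P. \<forall>a b. link x a b = 0}"
      using cm_pure[OF xy] by (simp add: cm_def link_pure_mult link_pure_inv)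
  qed simp
  then show "x \<in> \<Gamma>2 \<Longrightarrow> link x a b = 0" by (auto simp: numeral_2_eq_2)
qed

text \<open>The commutator lies in \<open>\<Gamma>2\<close>, where linking numbers vanish, so its
  triple invariant is the difference of those of \<open>x \<cdot> y\<close> and
  \<open>y \<cdot> x\<close>.\<close>

lemma triple_cm:
  assumes "x \<in> P" "y \<in> P"
  shows "triple (cm x y) a b c =
    link y a b * link x b c - link x a b * link y b c +
    link y a c * (link x a b - link x c b) - link x a c * (link y a b - link y c b)"
proof -
  have "cm x y \<cdot> (y \<cdot> x) = x \<cdot> y" using assms by (simp add: cm_def m_assoc)
  moreover have "triple (cm x y \<cdot> (y \<cdot> x)) a b c = triple (cm x y) a b c + triple (y \<cdot> x) a b c"
    using assms by (simp add: triple_pure_mult link_\<Gamma>2 cm_\<Gamma>2 cm_pure)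
  ultimately show ?thesis using assms by (simp add: triple_pure_mult)
qed

lemma triple_\<Gamma>2_mult: "x \<in> \<Gamma>2 \<Longrightarrow> y \<in> P \<Longrightarrow> triple (x \<cdot> y) a b c = triple x a b c + triple y a b c"
  by (simp add: triple_pure_mult link_\<Gamma>2 \<Gamma>2_pure)

lemma triple_\<Gamma>2_inv: "x \<in> \<Gamma>2 \<Longrightarrow> triple (iv x) a b c = - triple x a b c"
  using triple_\<Gamma>2_mult[of x "iv x" a b c] by (simp add: \<Gamma>2_pure)

lemma \<Gamma>2_mult [simp]: "x \<in> \<Gamma>2 \<Longrightarrow> y \<in> \<Gamma>2 \<Longrightarrow> x \<cdot> y \<in> \<Gamma>2"
  and \<Gamma>2_inv [simp]: "x \<in> \<Gamma>2 \<Longrightarrow> iv x \<in> \<Gamma>2"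
  and \<Gamma>2_conj: "b \<in> carrier B \<Longrightarrow> x \<in> \<Gamma>2 \<Longrightarrow> b \<cdot> x \<cdot> iv b \<in> \<Gamma>2"
  using subgroup.m_closed[OF lcs_subgroup] subgroup.m_inv_closed[OF lcs_subgroup]
    normal.inv_op_closed2[OF lcs_normal] by blast+

lemma triple_\<Gamma>3: "x \<in> \<Gamma>3 \<Longrightarrow> triple x a b c = 0"
proof -
  have "subgroup {x \<in> \<Gamma>2. \<forall>a b c. triple x a b c = 0} B"
    using subgroup.one_closed[OF lcs_subgroup, of 2]
    by (intro subgroupI) (auto simp: triple_\<Gamma>2_mult triple_\<Gamma>2_inv \<Gamma>2_pure)
  then have "lcs (Suc 2) \<subseteq> {x \<in> \<Gamma>2. \<forall>a b c. triple x a b c = 0}"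
    by (rule lcs_Suc_least[rotated]) (auto simp: cm_\<Gamma>2 \<Gamma>2_pure triple_cm link_\<Gamma>2)
  then show "x \<in> \<Gamma>3 \<Longrightarrow> triple x a b c = 0" by (auto simp: numeral_3_eq_3 numeral_2_eq_2)
qed

lemma triple_conj: "b \<in> carrier B \<Longrightarrow> x \<in> \<Gamma>2 \<Longrightarrow>
    triple (b \<cdot> x \<cdot> iv b) c d e = triple x (strand b c) (strand b d) (strand b e)"
  using triple_mult[of "b \<cdot> x \<cdot> iv b" b c d e] \<Gamma>2_conj[of b x] \<Gamma>2_pure[of x]
    \<Gamma>2_pure[of "b \<cdot> x \<cdot> iv b"]
  by (simp add: m_assoc triple_mult link_\<Gamma>2)

end

section \<open>The abelianization of the pure braid group\<close>

text \<open>A criterion for the functionals \<open>f i\<close> to separate \<open>M\<close> modulo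
  \<open>N\<close>. Once a generating set of \<open>M\<close> satisfies the last clause,
  \<open>H\<close> is all of \<open>M\<close>, and the clause before it computes the common kernel.
  Stating it with a subgroup keeps the quotient group out of the applications.\<close>

lemma (in group) abelian_span:
  fixes f :: "'i \<Rightarrow> 'a \<Rightarrow> int"
  assumes N: "N \<lhd> G" and M: "subgroup M G" and NM: "N \<subseteq> M"
    and comm: "\<And>x y. x \<in> M \<Longrightarrow> y \<in> M \<Longrightarrow> x \<otimes> y \<otimes> inv x \<otimes> inv y \<in> N"
    and I: "finite I" and a: "\<And>i. i \<in> I \<Longrightarrow> a i \<in> M"
    and add: "\<And>i x y. i \<in> I \<Longrightarrow> x \<in> M \<Longrightarrow> y \<in> M \<Longrightarrow> f i (x \<otimes> y) = f i x + f i y"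
    and vanish: "\<And>i x. i \<in> I \<Longrightarrow> x \<in> N \<Longrightarrow> f i x = 0"
  shows "\<exists>H. subgroup H G \<and> N \<subseteq> H \<and> H \<subseteq> M \<and>
    (\<forall>x\<in>H. (\<forall>i\<in>I. f i x = 0) \<longrightarrow> x \<in> N) \<and>
    (\<forall>x\<in>M. \<forall>i\<in>I. x \<otimes> inv (a i) \<in> N \<longrightarrow> (\<forall>j\<in>I. f j x = of_bool (j = i)) \<longrightarrow> x \<in> H)"
proof -
  interpret N: normal N G by (rule N)
  define c where "c x = N #> x" for x
  define Q where "Q = (G Mod N)\<lparr>carrier := c ` M\<rparr>"
  have Mc: "x \<in> carrier G" if "x \<in> M" for x using that subgroup.subset[OF M] by blast
  have mult: "c x \<otimes>\<^bsub>Q\<^esub> c y = c (x \<otimes> y)" if "x \<in> M" "y \<in> M" for x y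
    using that Mc by (simp add: Q_def c_def FactGroup_def N.rcos_sum)
  have one: "\<one>\<^bsub>Q\<^esub> = c \<one>" by (simp add: Q_def c_def FactGroup_def coset_mult_one[OF N.subset])
  have c_eq: "c x = c y \<longleftrightarrow> x \<otimes> inv y \<in> N" if "x \<in> M" "y \<in> M" for x y
    using that Mc unfolding c_def by (metis N.rcos_module N.subgroup_axioms is_group rcos_self repr_independence)
  have carr: "carrier Q = c ` M" by (simp add: Q_def)
  interpret Q: comm_group Q
  proof (rule group.group_comm_groupI)
    have "group_hom G (G Mod N) c"
      unfolding c_def by (intro group_hom.intro group_hom_axioms.intro N.r_coset_hom_Mod N.factorgroup_is_group is_group)
    then show "group Q" unfolding Q_def
      using group.subgroup_imp_group[OF N.factorgroup_is_group group_hom.subgroup_img_is_subgroup[OF _ M]] by blast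
  next
    fix u v assume "u \<in> carrier Q" "v \<in> carrier Q"
    then obtain x y where xy: "x \<in> M" "y \<in> M" "u = c x" "v = c y" by (auto simp: carr)
    have "c (x \<otimes> y) = c (y \<otimes> x)"
      using xy comm[of x y] Mc by (subst c_eq) (auto intro: subgroup.m_closed[OF M] simp: inv_mult_group m_assoc)
    then show "u \<otimes>\<^bsub>Q\<^esub> v = v \<otimes>\<^bsub>Q\<^esub> u" using xy by (simp add: mult)
  qed
  have ca: "c (a i) \<in> carrier Q" if "i \<in> I" for i using that a by (simp add: carr)
  define \<psi> where "\<psi> x = (\<Otimes>\<^bsub>Q\<^esub>i\<in>I. c (a i) [^]\<^bsub>Q\<^esub> f i x)" for x
  have \<psi>_closed: "\<psi> x \<in> carrier Q" for x
    unfolding \<psi>_def using ca by (intro Q.finprod_closed) auto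
  have \<psi>_mult: "\<psi> (x \<otimes> y) = \<psi> x \<otimes>\<^bsub>Q\<^esub> \<psi> y" if "x \<in> M" "y \<in> M" for x y
  proof -
    have "\<psi> (x \<otimes> y) = (\<Otimes>\<^bsub>Q\<^esub>i\<in>I. c (a i) [^]\<^bsub>Q\<^esub> f i x \<otimes>\<^bsub>Q\<^esub> c (a i) [^]\<^bsub>Q\<^esub> f i y)"
      unfolding \<psi>_def using that ca by (intro Q.finprod_cong') (auto simp: add Q.int_pow_mult)
    also have "\<dots> = \<psi> x \<otimes>\<^bsub>Q\<^esub> \<psi> y"
      unfolding \<psi>_def using ca by (intro Q.finprod_multf) auto
    finally show ?thesis .
  qed
  have \<psi>_zero: "\<psi> x = \<one>\<^bsub>Q\<^esub>" if "\<And>i. i \<in> I \<Longrightarrow> f i x = 0" for x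
    unfolding \<psi>_def using that by (intro Q.finprod_one_eqI) simp
  \<comment> \<open>\<open>\<psi> x\<close> is the product of the classes of the \<open>a i\<close>
    with exponents \<open>f i x\<close>; \<open>H\<close> is the equalizer of two homomorphisms on
    \<open>M\<close>.\<close>
  define H where "H = {x \<in> M. c x = \<psi> x}"
  have c_one: "c x = \<one>\<^bsub>Q\<^esub> \<longleftrightarrow> x \<in> N" if "x \<in> M" for x
    using that Mc c_eq[of x \<one>] subgroup.one_closed[OF M] by (simp add: one)
  show ?thesis
  proof (intro exI[of _ H] conjI ballI impI)
    have oneH: "\<one> \<in> H"
      using subgroup.one_closed[OF M] vanish N.one_closed by (simp add: H_def one[symmetric] \<psi>_zero)
    have invH: "inv x \<in> H" if "x \<in> H" for x
    proof -
      have x: "x \<in> M" "c x = \<psi> x" "inv x \<in> M" using that subgroup.m_inv_closed[OF M] by (auto simp: H_def)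
      have "c (inv x) \<otimes>\<^bsub>Q\<^esub> \<psi> x = \<psi> (inv x) \<otimes>\<^bsub>Q\<^esub> \<psi> x"
        using x(1,3) oneH Mc[OF x(1)]
        by (simp only: \<psi>_mult[symmetric]) (simp add: x(2)[symmetric] mult H_def)
      then show ?thesis using x \<psi>_closed by (simp add: H_def carr)
    qed
    show "subgroup H G"
    proof (rule subgroupI)
      show "H \<subseteq> carrier G" using Mc by (auto simp: H_def)
      show "H \<noteq> {}" using oneH by blast
      show "x \<otimes> y \<in> H" if "x \<in> H" "y \<in> H" for x y
        using that subgroup.m_closed[OF M] by (auto simp: H_def \<psi>_mult mult[symmetric])
    qed (rule invH)
    show "N \<subseteq> H"
    proof
      fix x assume "x \<in> N"
      moreover from this have "x \<in> M" using NM by blast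
      ultimately show "x \<in> H" using vanish c_one[of x] by (simp add: H_def \<psi>_zero)
    qed
    show "H \<subseteq> M" by (auto simp: H_def)
    show "x \<in> N" if "x \<in> H" "\<forall>i\<in>I. f i x = 0" for x
      using that by (auto simp: H_def \<psi>_zero c_one)
    show "x \<in> H" if x: "x \<in> M" "i \<in> I" "x \<otimes> inv (a i) \<in> N"
      and \<delta>: "\<forall>j\<in>I. f j x = of_bool (j = i)" for x i
    proof -
      have "\<psi> x = (\<Otimes>\<^bsub>Q\<^esub>j\<in>I. if i = j then c (a j) else \<one>\<^bsub>Q\<^esub>)"
        unfolding \<psi>_def using ca \<delta> by (intro Q.finprod_cong') auto
      also have "\<dots> = c (a i)"
        using x I ca by (intro Q.finprod_singleton) auto
      also have "\<dots> = c x" using x(1,2,3) a c_eq[of x "a i"] by simp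
      finally show ?thesis using x by (simp add: H_def)
    qed
  qed
qed

context braids begin

text \<open>A full turn of the two strands of \<open>T\<close> around each other. It is a relation
  because different conjugates may involve the same pair; \<open>twist_unique\<close> shows that
  they agree modulo \<open>\<Gamma>2\<close>.\<close>

definition twist :: "nat group_word set \<Rightarrow> nat set \<Rightarrow> bool" where
  "twist x T \<longleftrightarrow> (\<exists>b\<in>carrier B. \<exists>i\<in>{1..<n}. x = b \<cdot> (\<sigma> i \<cdot> \<sigma> i) \<cdot> iv b \<and> T = \<pi> b ` {i, i + 1})"

lemma twist_pure: "twist x T \<Longrightarrow> x \<in> P"
  by (auto simp: twist_def intro!: pure_conj square_pure)

lemma twist_square: "i \<in> {1..<n} \<Longrightarrow> twist (\<sigma> i \<cdot> \<sigma> i) {i, i + 1}"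
  unfolding twist_def by (rule bexI[of _ "\<one>\<^bsub>B\<^esub>"]) auto

lemma twist_conj: "twist x T \<Longrightarrow> b \<in> carrier B \<Longrightarrow> twist (b \<cdot> x \<cdot> iv b) (\<pi> b ` T)"
proof -
  assume "twist x T" and b: "b \<in> carrier B"
  then obtain c i where *: "c \<in> carrier B" "i \<in> {1..<n}" "x = c \<cdot> (\<sigma> i \<cdot> \<sigma> i) \<cdot> iv c" "T = \<pi> c ` {i, i + 1}"
    by (auto simp: twist_def)
  have "b \<cdot> x \<cdot> iv b = (b \<cdot> c) \<cdot> (\<sigma> i \<cdot> \<sigma> i) \<cdot> iv (b \<cdot> c)"
    using * b by (simp add: inv_mult_group m_assoc)
  moreover have "\<pi> b ` T = \<pi> (b \<cdot> c) ` {i, i + 1}" using * b by (simp add: perm_mult)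
  ultimately show ?thesis unfolding twist_def using * b m_closed by blast
qed

lemma twist_link:
  assumes "twist x T"
  shows "link x a b = of_bool ({a, b} = T)"
proof -
  obtain c i where *: "c \<in> carrier B" "i \<in> {1..<n}" "x = c \<cdot> (\<sigma> i \<cdot> \<sigma> i) \<cdot> iv c" "T = \<pi> c ` {i, i + 1}"
    using assms by (auto simp: twist_def)
  have sq: "link (\<sigma> i \<cdot> \<sigma> i) p q = of_bool ({p, q} = {i, i + 1})" for p q
    using *(2) by (auto simp: link_mult link_generator strand_generator transpose_def doubleton_eq_iff)
  have "link x a b = of_bool ({strand c a, strand c b} = {i, i + 1})"
    using * by (simp only: sq link_conj square_pure)
  moreover have "{strand c a, strand c b} = {i, i + 1} \<longleftrightarrow> {a, b} = T"
  proof -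
    have "{a, b} = \<pi> c ` {strand c a, strand c b}" using * by (simp add: strand_perm)
    moreover have "inj (\<pi> c)" using *(1) by (simp add: inj_on_def)
    ultimately show ?thesis by (simp only: *(4) inj_image_eq_iff)
  qed
  ultimately show ?thesis by simp
qed

text \<open>All generators are conjugate by the braid relation. The last one is singled out because
  \<open>stabilizer_decomp\<close> describes the braids that fix the last strands.\<close>

lemma twist_last:
  assumes "twist x T"
  obtains b where "b \<in> carrier B" "x = b \<cdot> (\<sigma> (n - 1) \<cdot> \<sigma> (n - 1)) \<cdot> iv b" "T = \<pi> b ` {n - 1, n}"
proof -
  obtain c i where *: "c \<in> carrier B" "i \<in> {1..<n}" "x = c \<cdot> (\<sigma> i \<cdot> \<sigma> i) \<cdot> iv c" "T = \<pi> c ` {i, i + 1}"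
    using assms by (auto simp: twist_def)
  have i: "i \<le> n - 1" "1 \<le> i" using *(2) by auto
  have "\<exists>e\<in>carrier B. \<sigma> i \<cdot> e = e \<cdot> \<sigma> (n - 1) \<and> \<pi> e ` {n - 1, n} = {i, i + 1}"
    using i
  proof (induction i rule: inc_induct)
    case base
    then show ?case by (intro bexI[of _ "\<one>\<^bsub>B\<^esub>"]) auto
  next
    case (step i)
    then obtain e where e: "e \<in> carrier B" "\<sigma> (i + 1) \<cdot> e = e \<cdot> \<sigma> (n - 1)" "\<pi> e ` {n - 1, n} = {i + 1, i + 2}"
      by auto
    have s: "\<sigma> i \<in> carrier B" "\<sigma> (i + 1) \<in> carrier B" using step by auto
    let ?g = "\<sigma> i \<cdot> \<sigma> (i + 1)"
    have "?g \<cdot> \<sigma> i = \<sigma> (i + 1) \<cdot> ?g" using gen_braid[of i] step s by (simp add: m_assoc)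
    then have "\<sigma> i \<cdot> iv ?g = iv ?g \<cdot> \<sigma> (i + 1)"
      using s by (metis inv_closed inv_solve_left inv_solve_right m_assoc m_closed)
    then have "\<sigma> i \<cdot> (iv ?g \<cdot> e) = iv ?g \<cdot> (\<sigma> (i + 1) \<cdot> e)"
      using s e by (metis inv_closed m_assoc m_closed)
    then have "\<sigma> i \<cdot> (iv ?g \<cdot> e) = (iv ?g \<cdot> e) \<cdot> \<sigma> (n - 1)"
      using s e step by (simp add: m_assoc)
    moreover have "\<pi> (iv ?g \<cdot> e) ` {n - 1, n} = {i, i + 1}"
    proof -
      have "\<pi> (iv ?g \<cdot> e) ` {n - 1, n} = \<pi> (iv ?g) ` {i + 1, i + 2}"
        using s e by (simp only: perm_mult inv_closed m_closed image_comp[symmetric])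
      also have "\<dots> = {i, i + 1}"
        using s step by (simp add: perm_inv strand_mult strand_generator transpose_def)
      finally show ?thesis .
    qed
    ultimately show ?case using s e by (intro bexI[of _ "iv ?g \<cdot> e"]) simp_all
  qed
  then obtain e where e: "e \<in> carrier B" "\<sigma> i \<cdot> e = e \<cdot> \<sigma> (n - 1)" "\<pi> e ` {n - 1, n} = {i, i + 1}" by blast
  have s: "\<sigma> i \<in> carrier B" "\<sigma> (n - 1) \<in> carrier B" using i *(2) by auto
  have "\<sigma> i = \<sigma> i \<cdot> e \<cdot> iv e" using e(1) s by (simp add: m_assoc)
  also have "\<dots> = e \<cdot> \<sigma> (n - 1) \<cdot> iv e" by (simp only: e(2))
  finally have "\<sigma> i = e \<cdot> \<sigma> (n - 1) \<cdot> iv e" .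
  then have "x = (c \<cdot> e) \<cdot> (\<sigma> (n - 1) \<cdot> \<sigma> (n - 1)) \<cdot> iv (c \<cdot> e)"
    using *(1,3) s e by (simp add: inv_mult_group m_assoc)
  moreover have "T = \<pi> (c \<cdot> e) ` {n - 1, n}" 
    using * e by (simp only: perm_mult image_comp[symmetric])
  ultimately show ?thesis using that * e by blast
qed

lemma commute_left:
  "x \<cdot> y = y \<cdot> x \<Longrightarrow> x \<in> carrier B \<Longrightarrow> y \<in> carrier B \<Longrightarrow> z \<in> carrier B \<Longrightarrow>
    x \<cdot> (y \<cdot> z) = y \<cdot> (x \<cdot> z)"
  by (simp add: m_assoc[symmetric])

text \<open>Both twists are conjugates of the same square, by braids that differ by
  \<open>?c\<close>. Up to a factor commuting with the square, \<open>?c\<close> is a pure braid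
  \<open>u\<close>, so the quotient of the twists is conjugate to a commutator in
  \<open>P\<close>.\<close>

lemma twist_unique:
  assumes x: "twist x T" and y: "twist y T"
  shows "x \<cdot> iv y \<in> \<Gamma>2"
proof -
  let ?s = "\<sigma> (n - 1)"
  have n: "2 \<le> n" using x by (auto simp: twist_def)
  then have s: "?s \<in> carrier B" "?s \<cdot> ?s \<in> P" using square_pure[of "n - 1"] by auto
  obtain b where b: "b \<in> carrier B" "x = b \<cdot> (?s \<cdot> ?s) \<cdot> iv b" "T = \<pi> b ` {n - 1, n}"
    by (rule twist_last[OF x])
  obtain b' where b': "b' \<in> carrier B" "y = b' \<cdot> (?s \<cdot> ?s) \<cdot> iv b'" "T = \<pi> b' ` {n - 1, n}"
    by (rule twist_last[OF y])
  let ?c = "iv b' \<cdot> b"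
  have c: "?c \<in> carrier B" using b b' by simp
  have "\<pi> ?c ` {n - 1, n} = {n - 1, n}"
  proof -
    have "\<pi> ?c ` {n - 1, n} = strand b' ` (\<pi> b ` {n - 1, n})"
      using b b' by (simp only: perm_mult inv_closed image_comp[symmetric] perm_inv)
    also have "\<dots> = strand b' ` (\<pi> b' ` {n - 1, n})" using b(3) b'(3) by simp
    finally show ?thesis using b'(1) by (simp add: strand_perm)
  qed
  then have "\<pi> ?c (n - 1) = n - 1 \<and> \<pi> ?c n = n \<or> \<pi> ?c (n - 1) = n \<and> \<pi> ?c n = n - 1"
    by (auto simp: doubleton_eq_iff)
  \<comment> \<open>If \<open>?c\<close> exchanges the last two strands, a factor \<open>?s\<close>
    corrects this without changing the conjugate of \<open>?s \<cdot> ?s\<close>.\<close>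
  then obtain d where d: "d \<in> carrier B" "d = ?c \<or> d = ?c \<cdot> ?s" "\<pi> d (n - 1) = n - 1" "\<pi> d n = n"
  proof (elim disjE conjE)
    assume "\<pi> ?c (n - 1) = n" "\<pi> ?c n = n - 1"
    then show ?thesis using c n s by (intro that[of "?c \<cdot> ?s"]) (simp_all add: perm_mult[OF c] perm_generator)
  qed (use c that in blast)
  have "\<pi> d j = j" if "n - 2 < j" "j \<le> n" for j
  proof -
    have "j = n - 1 \<or> j = n" using that by auto
    then show ?thesis using d by auto
  qed
  then obtain u h where uh: "u \<in> square_closure" "h \<in> parabolic (n - 2)" "d = u \<cdot> h"
    using stabilizer_decomp[of d "n - 2"] d(1) by auto
  have hs: "h \<in> carrier B \<and> h \<cdot> ?s = ?s \<cdot> h"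
    using uh(2) unfolding parabolic_def
  proof induction
    case (incl h)
    then obtain i where i: "h = \<sigma> i" "1 \<le> i" "i < n - 2" by auto
    then have "\<sigma> i \<cdot> ?s = ?s \<cdot> \<sigma> i" by (intro gen_comm) auto
    with i show ?case by simp
  next
    case (inv h)
    then obtain i where i: "h = \<sigma> i" "1 \<le> i" "i < n - 2" by auto
    then have "\<sigma> i \<cdot> ?s = ?s \<cdot> \<sigma> i" by (intro gen_comm) auto
    then have "iv (\<sigma> i) \<cdot> (\<sigma> i \<cdot> ?s) \<cdot> iv (\<sigma> i) = iv (\<sigma> i) \<cdot> (?s \<cdot> \<sigma> i) \<cdot> iv (\<sigma> i)" by (simp only:)
    then show ?case using i s(1) by (simp add: m_assoc)
  next
    case (eng h1 h2)
    then show ?case using s(1) by (simp add: m_assoc commute_left[of h1 ?s h2] del: One_nat_def)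
  qed (use s in simp)
  have u: "u \<in> P" using uh(1) square_closure_pure by blast
  have "?c \<cdot> (?s \<cdot> ?s) \<cdot> iv ?c = d \<cdot> (?s \<cdot> ?s) \<cdot> iv d"
    using d(2) c s by (auto simp: m_assoc inv_mult_group simp del: inv_mult_group[of "iv b'" b])
  also have "\<dots> = u \<cdot> (?s \<cdot> ?s) \<cdot> iv u"
    using hs s u by (simp add: uh(3) m_assoc inv_mult_group commute_left[of h ?s] del: One_nat_def)
  finally have conj: "?c \<cdot> (?s \<cdot> ?s) \<cdot> iv ?c = u \<cdot> (?s \<cdot> ?s) \<cdot> iv u" .
  have "x \<cdot> iv y = b' \<cdot> (?c \<cdot> (?s \<cdot> ?s) \<cdot> iv ?c \<cdot> iv (?s \<cdot> ?s)) \<cdot> iv b'"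
    using b b' s by (simp add: m_assoc inv_mult_group)
  also have "\<dots> = b' \<cdot> cm u (?s \<cdot> ?s) \<cdot> iv b'" by (simp only: conj cm_def)
  finally have "x \<cdot> iv y = b' \<cdot> cm u (?s \<cdot> ?s) \<cdot> iv b'" .
  then show ?thesis using \<Gamma>2_conj[OF b'(1) cm_\<Gamma>2[OF u s(2)]] by simp
qed

lemma twist_exists:
  assumes "T \<subseteq> {1..n}" "card T = 2"
  shows "\<exists>x. twist x T"
proof -
  obtain a b where ab: "T = {a, b}" "a \<noteq> b" using assms by (auto simp: card_2_iff)
  then have n: "2 \<le> n" using assms card_mono[of "{1..n}" T] by simp
  obtain x where "x \<in> carrier B" "\<And>i. i \<in> {1, 2} \<Longrightarrow> \<pi> x i = (if i = 1 then a else b)"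
    using perm_prescribe[of "{1, 2}" "\<lambda>i. if i = 1 then a else b"] ab assms n by (auto simp: inj_on_def)
  then have "twist (x \<cdot> (\<sigma> 1 \<cdot> \<sigma> 1) \<cdot> iv x) T"
    using n ab unfolding twist_def by (intro bexI[of _ x] bexI[of _ 1]) auto
  then show ?thesis by blast
qed

lemma twist_subset: "twist x T \<Longrightarrow> T \<subseteq> {1..n} \<and> card T = 2"
proof -
  assume "twist x T"
  then obtain c i where *: "c \<in> carrier B" "i \<in> {1..<n}" "T = \<pi> c ` {i, i + 1}" by (auto simp: twist_def)
  then have "card T = 2" by (simp add: card_insert_if)
  moreover have "\<pi> c j \<in> {1..n}" if "j \<in> {1..n}" for j
    using that permutes_in_image[OF perm_permutes[OF *(1)]] by blast
  then have "T \<subseteq> {1..n}" using *(2,3) by auto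
  ultimately show ?thesis by blast
qed

lemma pure_least:
  assumes H: "subgroup H B" and X: "\<And>x T. twist x T \<Longrightarrow> x \<in> H"
  shows "P \<subseteq> H"
  unfolding pure_eq_square_closure square_closure_def
proof (rule generate_subgroup_incl[OF _ H])
  show "{b \<cdot> (\<sigma> i \<cdot> \<sigma> i) \<cdot> iv b |b i. b \<in> carrier B \<and> i \<in> {1..<n}} \<subseteq> H"
    using X unfolding twist_def by blast
qed

text \<open>\<open>abelian_span\<close> with one twist per pair of strands: every twist is congruent
  to the chosen one by \<open>twist_unique\<close>, and by \<open>twist_link\<close> its linking
  numbers form a unit vector. \<open>Min\<close> and \<open>Max\<close> merely order the
  pair.\<close>

lemma link_kernel:
  assumes x: "x \<in> P" and link: "\<And>a b. a \<in> {1..n} \<Longrightarrow> b \<in> {1..n} \<Longrightarrow> link x a b = 0"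
  shows "x \<in> \<Gamma>2"
proof -
  define I where "I = {T. T \<subseteq> {1..n} \<and> card T = 2}"
  define t where "t T = (SOME x. twist x T)" for T
  have t: "twist (t T) T" if "T \<in> I" for T
    using that twist_exists[of T] unfolding t_def I_def by (auto intro: someI_ex)
  have comm: "x \<cdot> y \<cdot> iv x \<cdot> iv y \<in> \<Gamma>2" if "x \<in> P" "y \<in> P" for x y
    using cm_\<Gamma>2[OF that] by (simp only: cm_def)
  have I: "finite I" by (simp add: I_def)
  have tP: "t T \<in> P" if "T \<in> I" for T using twist_pure[OF t[OF that]] .
  have "\<exists>H. subgroup H B \<and> \<Gamma>2 \<subseteq> H \<and> H \<subseteq> P \<and>
      (\<forall>x\<in>H. (\<forall>T\<in>I. link x (Min T) (Max T) = 0) \<longrightarrow> x \<in> \<Gamma>2) \<and>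
      (\<forall>x\<in>P. \<forall>T\<in>I. x \<cdot> iv (t T) \<in> \<Gamma>2 \<longrightarrow>
        (\<forall>U\<in>I. link x (Min U) (Max U) = of_bool (U = T)) \<longrightarrow> x \<in> H)"
    by (rule abelian_span[OF lcs_normal subgroup_pure lcs_pure comm I])
      (simp_all add: tP link_pure_mult link_\<Gamma>2)
  then obtain H where H: "subgroup H B" "\<Gamma>2 \<subseteq> H" "H \<subseteq> P"
    and H1: "\<forall>x\<in>H. (\<forall>T\<in>I. link x (Min T) (Max T) = 0) \<longrightarrow> x \<in> \<Gamma>2"
    and H2: "\<forall>x\<in>P. \<forall>T\<in>I. x \<cdot> iv (t T) \<in> \<Gamma>2 \<longrightarrow>
      (\<forall>U\<in>I. link x (Min U) (Max U) = of_bool (U = T)) \<longrightarrow> x \<in> H"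
    by (elim exE conjE)
  have minmax: "{Min T, Max T} = T" if "T \<in> I" for T
    using that by (auto simp: I_def card_2_iff min_def max_def split: if_splits)
  have "y \<in> H" if y: "twist y T" for y T
  proof (rule H2[rule_format])
    show T: "T \<in> I" using twist_subset[OF y] by (simp add: I_def)
    show "y \<cdot> iv (t T) \<in> \<Gamma>2" using twist_unique[OF y t[OF T]] .
    show "y \<in> P" using twist_pure[OF y] .
    show "link y (Min U) (Max U) = of_bool (U = T)" if "U \<in> I" for U
      by (simp add: twist_link[OF y] minmax[OF that])
  qed
  then have "x \<in> H" using pure_least[OF H(1)] x by blast
  then show ?thesis
  proof (rule H1[rule_format])
    fix T assume T: "T \<in> I"
    have "{Min T, Max T} \<subseteq> {1..n}" using T unfolding minmax[OF T] by (simp add: I_def)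
    then show "link x (Min T) (Max T) = 0" using link by simp
  qed
qed

end

section \<open>The second lower central quotient\<close>

context braids begin

lemma cm_conj: "b \<in> carrier B \<Longrightarrow> x \<in> carrier B \<Longrightarrow> y \<in> carrier B \<Longrightarrow>
    cm (b \<cdot> x \<cdot> iv b) (b \<cdot> y \<cdot> iv b) = b \<cdot> cm x y \<cdot> iv b"
  by (simp add: cm_def m_assoc inv_mult_group)

text \<open>Conjugation by a pure braid changes an element of \<open>\<Gamma>2\<close> by an element
  of \<open>\<Gamma>3\<close> only.\<close>

lemma normalized_by_pure:
  assumes H: "subgroup H B" "\<Gamma>3 \<subseteq> H" "H \<subseteq> \<Gamma>2" and "x \<in> P" "h \<in> H"
  shows "x \<cdot> h \<cdot> iv x \<in> H"
proof -
  have h: "h \<in> \<Gamma>2" "h \<in> P" using assms \<Gamma>2_pure by auto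
  have "iv (cm h x) \<in> H"
    using cm_\<Gamma>3[OF h(1) assms(4)] H by (blast intro: subgroup.m_inv_closed)
  then have "cm x h \<cdot> h \<in> H"
    using assms h by (simp add: cm_inv subgroup.m_closed[OF H(1)])
  then show ?thesis using assms(4) h by (simp add: cm_def m_assoc)
qed

text \<open>Closure under products rests on \<open>cm (x \<cdot> z) y = (x \<cdot> cm z y \<cdot> iv
  x) \<cdot> cm x y\<close>. It lets statements about commutators be checked on generators of
  \<open>P\<close>.\<close>

lemma centralizer_mod_subgroup:
  assumes H: "subgroup H B" "\<Gamma>3 \<subseteq> H" "H \<subseteq> \<Gamma>2" and y: "y \<in> P"
  shows "subgroup {x \<in> P. cm x y \<in> H} B"
proof (rule subgroupI)
  have "cm \<one>\<^bsub>B\<^esub> y = \<one>\<^bsub>B\<^esub>" using y by (simp add: cm_commute)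
  then show "{x \<in> P. cm x y \<in> H} \<noteq> {}"
    using subgroup.one_closed[OF H(1)] subgroup.one_closed[OF subgroup_pure] by auto
next
  fix x assume "x \<in> {x \<in> P. cm x y \<in> H}"
  then have x: "x \<in> P" "cm x y \<in> H" by auto
  have "cm y x \<in> H" using subgroup.m_inv_closed[OF H(1) x(2)] x y by (simp add: cm_inv)
  then have "iv x \<cdot> cm y x \<cdot> iv (iv x) \<in> H" using x by (intro normalized_by_pure[OF H]) simp_all
  moreover have "iv x \<cdot> cm y x \<cdot> iv (iv x) = cm (iv x) y" using x y by (simp add: cm_def m_assoc)
  ultimately show "iv x \<in> {x \<in> P. cm x y \<in> H}" using x by simp
next
  fix x z assume "x \<in> {x \<in> P. cm x y \<in> H}" "z \<in> {x \<in> P. cm x y \<in> H}"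
  then have x: "x \<in> P" "cm x y \<in> H" and z: "z \<in> P" "cm z y \<in> H" by auto
  have "(x \<cdot> cm z y \<cdot> iv x) \<cdot> cm x y \<in> H"
    using x z by (intro subgroup.m_closed[OF H(1)] normalized_by_pure[OF H])
  moreover have "(x \<cdot> cm z y \<cdot> iv x) \<cdot> cm x y = cm (x \<cdot> z) y"
    using x z y by (simp add: cm_def m_assoc inv_mult_group)
  ultimately show "x \<cdot> z \<in> {x \<in> P. cm x y \<in> H}" using x z by simp
qed auto

lemma cm_sym:
  "subgroup H B \<Longrightarrow> x \<in> P \<Longrightarrow> y \<in> P \<Longrightarrow> cm x y \<in> H \<Longrightarrow> cm y x \<in> H"
  using subgroup.m_inv_closed[of H B "cm x y"] by (simp add: cm_inv)

lemma cm_cong_left: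
  assumes H: "subgroup H B" "\<Gamma>3 \<subseteq> H" "H \<subseteq> \<Gamma>2"
    and "x \<in> P" "x' \<in> P" "y \<in> P" "x \<cdot> iv x' \<in> \<Gamma>2" "cm x' y \<in> H"
  shows "cm x y \<in> H"
proof -
  let ?S = "{x \<in> P. cm x y \<in> H}"
  have "x \<cdot> iv x' \<in> ?S" using cm_\<Gamma>3[of "x \<cdot> iv x'" y] assms by auto
  moreover have "x' \<in> ?S" using assms by simp
  ultimately have "x \<cdot> iv x' \<cdot> x' \<in> ?S"
    using subgroup.m_closed[OF centralizer_mod_subgroup[OF H assms(6)]] by blast
  then show ?thesis using assms by (simp add: m_assoc)
qed

lemma cm_twist_cong:
  assumes H: "subgroup H B" "\<Gamma>3 \<subseteq> H" "H \<subseteq> \<Gamma>2"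
    and x: "twist x T" "twist x' T" and y: "twist y U" "twist y' U" and "cm x' y' \<in> H"
  shows "cm x y \<in> H"
proof -
  note p = x[THEN twist_pure] y[THEN twist_pure]
  have "cm x y' \<in> H"
    by (rule cm_cong_left[OF H p(1,2,4) twist_unique[OF x] assms(8)])
  then have "cm y' x \<in> H" by (rule cm_sym[OF H(1) p(1,4)])
  then have "cm y x \<in> H"
    by (rule cm_cong_left[OF H p(3,4,1) twist_unique[OF y]])
  then show ?thesis by (rule cm_sym[OF H(1) p(3,1)])
qed

text \<open>\<open>pure_least\<close> is applied to a centralizer modulo \<open>H\<close> twice,
  once for each argument of the commutator.\<close>

lemma \<Gamma>2_least:
  assumes H: "subgroup H B" "\<Gamma>3 \<subseteq> H" "H \<subseteq> \<Gamma>2"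
    and twists: "\<And>x y T U. twist x T \<Longrightarrow> twist y U \<Longrightarrow> cm x y \<in> H"
  shows "\<Gamma>2 \<subseteq> H"
proof -
  have 1: "cm x y \<in> H" if "x \<in> P" "twist y U" for x y U
    using pure_least[OF centralizer_mod_subgroup[OF H twist_pure[OF that(2)]]] that twists twist_pure
    by blast
  have "cm x y \<in> H" if "x \<in> P" "y \<in> P" for x y
  proof -
    have "P \<subseteq> {z \<in> P. cm z x \<in> H}"
      using 1[OF that(1)] cm_sym[OF H(1) that(1)] twist_pure
      by (intro pure_least[OF centralizer_mod_subgroup[OF H that(1)]]) blast
    then show ?thesis using cm_sym[OF H(1) that(2,1)] that(2) by blast
  qed
  then have "lcs (Suc 1) \<subseteq> H"
    using lcs_one by (intro lcs_Suc_least[OF _ H(1)]) simp_all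
  then show ?thesis by (simp add: numeral_2_eq_2)
qed

text \<open>Modulo \<open>H\<close> any twists on the two pairs will do. A braid carrying 1, 2, 3, 4
  to \<open>a, b, c, d\<close> provides conjugates of the squares of \<open>\<sigma> 1\<close> and
  \<open>\<sigma> 3\<close>, which commute.\<close>

lemma cm_twist_disjoint:
  assumes H: "subgroup H B" "\<Gamma>3 \<subseteq> H" "H \<subseteq> \<Gamma>2"
    and x: "twist x {a, b}" and y: "twist y {c, d}" and d: "{a, b} \<inter> {c, d} = {}"
  shows "cm x y \<in> H"
proof -
  have ab: "{a, b, c, d} \<subseteq> {1..n}" "a \<noteq> b" "c \<noteq> d"
    using twist_subset[OF x] twist_subset[OF y] by (auto simp: card_insert_if split: if_splits)
  then have "card {a, b, c, d} = 4" using d by (auto simp: card_insert_if)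
  then have n: "4 \<le> n" using card_mono[OF _ ab(1)] by simp
  define f where "f i = (if i = 1 then a else if i = 2 then b else if i = 3 then c else d)" for i :: nat
  have "inj_on f {1, 2, 3, 4}" using ab d by (auto simp: inj_on_def f_def)
  moreover have "f ` {1, 2, 3, 4} \<subseteq> {1..n}" using ab by (auto simp: f_def)
  ultimately obtain g where g: "g \<in> carrier B" "\<And>i. i \<in> {1, 2, 3, 4} \<Longrightarrow> \<pi> g i = f i"
    using perm_prescribe[of "{1, 2, 3, 4}" f] n by auto
  have s: "\<sigma> 1 \<cdot> \<sigma> 1 \<in> carrier B" "\<sigma> 3 \<cdot> \<sigma> 3 \<in> carrier B" using n by simp_all
  have "\<pi> g ` {1, 1 + 1} = {a, b}" "\<pi> g ` {3, 3 + 1} = {c, d}" using g by (auto simp: f_def)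
  then have tw: "twist (g \<cdot> (\<sigma> 1 \<cdot> \<sigma> 1) \<cdot> iv g) {a, b}" "twist (g \<cdot> (\<sigma> 3 \<cdot> \<sigma> 3) \<cdot> iv g) {c, d}"
    using twist_conj[OF twist_square g(1), of 1] twist_conj[OF twist_square g(1), of 3] n by auto
  have "\<sigma> 1 \<cdot> \<sigma> 3 = \<sigma> 3 \<cdot> \<sigma> 1" using n by (intro gen_comm) auto
  then have "\<sigma> 1 \<cdot> \<sigma> 1 \<cdot> (\<sigma> 3 \<cdot> \<sigma> 3) = \<sigma> 3 \<cdot> \<sigma> 3 \<cdot> (\<sigma> 1 \<cdot> \<sigma> 1)"
    using n by (simp add: m_assoc commute_left[of "\<sigma> 1" "\<sigma> 3"] del: One_nat_def)
  then have "cm (g \<cdot> (\<sigma> 1 \<cdot> \<sigma> 1) \<cdot> iv g) (g \<cdot> (\<sigma> 3 \<cdot> \<sigma> 3) \<cdot> iv g) = \<one>\<^bsub>B\<^esub>"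
    using g s by (simp only: cm_conj cm_commute) simp
  then show ?thesis
    using cm_twist_cong[OF H x tw(1) y tw(2)] subgroup.one_closed[OF H(1)] by simp
qed

text \<open>The full twist on three strands commutes with the full twist on two of them.\<close>

lemma cm_twist_triangle:
  assumes H: "subgroup H B" "\<Gamma>3 \<subseteq> H" "H \<subseteq> \<Gamma>2"
    and x: "twist x {a, b}" and y: "twist y {b, c}" and z: "twist z {a, c}"
    and "cm y x \<in> H"
  shows "cm z x \<in> H"
proof -
  have ab: "{a, b, c} \<subseteq> {1..n}" "a \<noteq> b" "b \<noteq> c" "a \<noteq> c"
    using twist_subset[OF x] twist_subset[OF y] twist_subset[OF z]
    by (auto simp: card_insert_if split: if_splits)
  then have "card {a, b, c} = 3" by (auto simp: card_insert_if)
  then have n: "3 \<le> n" using card_mono[OF _ ab(1)] by simp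
  define f where "f i = (if i = 1 then a else if i = 2 then b else c)" for i :: nat
  have "inj_on f {1, 2, 3}" using ab by (auto simp: inj_on_def f_def)
  moreover have "f ` {1, 2, 3} \<subseteq> {1..n}" using ab by (auto simp: f_def)
  ultimately obtain g where g: "g \<in> carrier B" "\<And>i. i \<in> {1, 2, 3} \<Longrightarrow> \<pi> g i = f i"
    using perm_prescribe[of "{1, 2, 3}" f] n by auto
  define r where "r = \<sigma> 1"
  define s where "s = \<sigma> 2"
  have rs: "r \<in> carrier B" "s \<in> carrier B" using n by (simp_all add: r_def s_def)
  have br: "r \<cdot> s \<cdot> r = s \<cdot> r \<cdot> s" using gen_braid[of 1] n by (simp add: r_def s_def numeral_2_eq_2)
  let ?x = "r \<cdot> r" and ?y = "s \<cdot> s" and ?z = "s \<cdot> (r \<cdot> r) \<cdot> iv s"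
  have "r \<cdot> (s \<cdot> r \<cdot> r \<cdot> s) = (r \<cdot> s \<cdot> r) \<cdot> r \<cdot> s" using rs by (simp add: m_assoc)
  also have "\<dots> = s \<cdot> r \<cdot> s \<cdot> r \<cdot> s" by (simp only: br)
  also have "\<dots> = s \<cdot> r \<cdot> (s \<cdot> r \<cdot> s)" using rs by (simp add: m_assoc)
  also have "\<dots> = s \<cdot> r \<cdot> (r \<cdot> s \<cdot> r)" by (simp only: br)
  also have "\<dots> = (s \<cdot> r \<cdot> r \<cdot> s) \<cdot> r" using rs by (simp add: m_assoc)
  finally have comm: "r \<cdot> (s \<cdot> r \<cdot> r \<cdot> s) = (s \<cdot> r \<cdot> r \<cdot> s) \<cdot> r" .
  \<comment> \<open>This is the full twist on the three strands with \<open>?x\<close> divided out,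
    so it commutes with \<open>?x\<close>.\<close>
  have zy: "?z \<cdot> ?y = s \<cdot> r \<cdot> r \<cdot> s" using rs by (simp add: m_assoc)
  have "?x \<cdot> (?z \<cdot> ?y) = r \<cdot> (r \<cdot> (s \<cdot> r \<cdot> r \<cdot> s))" using rs by (simp add: m_assoc)
  also have "\<dots> = (s \<cdot> r \<cdot> r \<cdot> s) \<cdot> r \<cdot> r" using rs comm by (simp add: comm m_assoc[symmetric])
  finally have "(?z \<cdot> ?y) \<cdot> ?x = ?x \<cdot> (?z \<cdot> ?y)" using rs by (simp add: zy m_assoc)
  then have one: "cm (g \<cdot> (?z \<cdot> ?y) \<cdot> iv g) (g \<cdot> ?x \<cdot> iv g) = \<one>\<^bsub>B\<^esub>"
    using rs g(1) by (subst cm_conj) (simp_all add: cm_commute)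
  have twx: "twist (g \<cdot> ?x \<cdot> iv g) {a, b}" and twy: "twist (g \<cdot> ?y \<cdot> iv g) {b, c}"
  proof -
    have "\<pi> g ` {1, 1 + 1} = {a, b}" "\<pi> g ` {2, 2 + 1} = {b, c}" using g(2) by (auto simp: f_def)
    then show "twist (g \<cdot> ?x \<cdot> iv g) {a, b}" "twist (g \<cdot> ?y \<cdot> iv g) {b, c}"
      using twist_conj[OF twist_square g(1), of 1] twist_conj[OF twist_square g(1), of 2] n
      by (auto simp: r_def s_def)
  qed
  have twz: "twist (g \<cdot> ?z \<cdot> iv g) {a, c}"
  proof -
    have "\<pi> s ` {1, 2} = {1, 3}" using n by (simp add: s_def perm_generator transpose_def)
    then have "twist ?z {1, 3}"
      using twist_conj[OF twist_square rs(2), of 1] n by (simp add: r_def numeral_2_eq_2)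
    from twist_conj[OF this g(1)] show ?thesis using g(2) by (simp add: f_def)
  qed
  let ?x' = "g \<cdot> ?x \<cdot> iv g" and ?y' = "g \<cdot> ?y \<cdot> iv g" and ?z' = "g \<cdot> ?z \<cdot> iv g"
  note p = twx[THEN twist_pure] twy[THEN twist_pure] twz[THEN twist_pure]
  note S = centralizer_mod_subgroup[OF H p(1)]
  have zy': "g \<cdot> (?z \<cdot> ?y) \<cdot> iv g = ?z' \<cdot> ?y'" using rs g(1) by (simp add: m_assoc)
  have "?z' \<cdot> ?y' \<in> {w \<in> P. cm w ?x' \<in> H}"
    using one subgroup.one_closed[OF H(1)] p by (simp add: zy')
  moreover have "?y' \<in> {w \<in> P. cm w ?x' \<in> H}"
    using cm_twist_cong[OF H twy y twx x assms(7)] p by simp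
  ultimately have "?z' \<cdot> ?y' \<cdot> iv ?y' \<in> {w \<in> P. cm w ?x' \<in> H}"
    using subgroup.m_closed[OF S] subgroup.m_inv_closed[OF S] by blast
  moreover have "?z' \<cdot> ?y' \<cdot> iv ?y' = ?z'" using p by (simp add: m_assoc)
  ultimately have "cm ?z' ?x' \<in> H" by simp
  then show ?thesis by (rule cm_twist_cong[OF H z twz x twx])
qed

text \<open>\<open>abelian_span\<close> with one commutator per increasing triple. Up to inversion,
  twists on a triple have three commutators, one for each strand that two of its pairs can share;
  \<open>cm_twist_triangle\<close> carries membership in \<open>H\<close> from one to the
  others.\<close>

lemma triple_kernel:
  assumes x: "x \<in> \<Gamma>2" and triple: "\<And>a b c. {a, b, c} \<subseteq> {1..n} \<Longrightarrow> a \<noteq> b \<Longrightarrow> b \<noteq> c \<Longrightarrow> a \<noteq> c \<Longrightarrow> triple x a b c = 0"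
  shows "x \<in> \<Gamma>3"
proof -
  define I where "I = {(a, b, c). a \<in> {1..n} \<and> b \<in> {1..n} \<and> c \<in> {1..n} \<and> a < b \<and> b < c}"
  define t where "t T = (SOME x. twist x T)" for T
  have t: "twist (t {a, b}) {a, b}" if "a \<in> {1..n}" "b \<in> {1..n}" "a \<noteq> b" for a b
    unfolding t_def by (rule someI_ex, rule twist_exists) (use that in auto)
  \<comment> \<open>This order of the arguments makes the triple invariant at \<open>a, b, c\<close>
    equal to 1 and not -1.\<close>
  define u where "u = (\<lambda>(a, b, c). cm (t {b, c}) (t {a, b}))"
  define f where "f = (\<lambda>(a, b, c) x. triple x a b c)"
  have comm: "x \<cdot> y \<cdot> iv x \<cdot> iv y \<in> \<Gamma>3" if "x \<in> \<Gamma>2" "y \<in> \<Gamma>2" for x y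
    using cm_\<Gamma>3[OF that(1) \<Gamma>2_pure[OF that(2)]] by (simp only: cm_def)
  have "finite ({1..n} \<times> {1..n} \<times> {1..n})" by simp
  then have I: "finite I" by (rule finite_subset[rotated]) (auto simp: I_def)
  have u: "u i \<in> \<Gamma>2" if "i \<in> I" for i
    using that t twist_pure by (auto simp: u_def I_def intro!: cm_\<Gamma>2)
  have \<Gamma>32: "\<Gamma>3 \<subseteq> \<Gamma>2" using \<Gamma>3_\<Gamma>2 by blast
  have "\<exists>H. subgroup H B \<and> \<Gamma>3 \<subseteq> H \<and> H \<subseteq> \<Gamma>2 \<and>
      (\<forall>x\<in>H. (\<forall>i\<in>I. f i x = 0) \<longrightarrow> x \<in> \<Gamma>3) \<and>
      (\<forall>x\<in>\<Gamma>2. \<forall>i\<in>I. x \<cdot> iv (u i) \<in> \<Gamma>3 \<longrightarrow> (\<forall>j\<in>I. f j x = of_bool (j = i)) \<longrightarrow> x \<in> H)"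
    by (rule abelian_span[OF lcs_normal lcs_subgroup \<Gamma>32 comm I])
      (auto simp: u f_def triple_\<Gamma>2_mult triple_\<Gamma>3 \<Gamma>2_pure)
  then obtain H where H: "subgroup H B" "\<Gamma>3 \<subseteq> H" "H \<subseteq> \<Gamma>2"
    and H1: "\<forall>x\<in>H. (\<forall>i\<in>I. f i x = 0) \<longrightarrow> x \<in> \<Gamma>3"
    and H2: "\<forall>x\<in>\<Gamma>2. \<forall>i\<in>I. x \<cdot> iv (u i) \<in> \<Gamma>3 \<longrightarrow>
      (\<forall>j\<in>I. f j x = of_bool (j = i)) \<longrightarrow> x \<in> H"
    by (elim exE conjE)
  \<comment> \<open>The middle index is the strand shared by both pairs. \<open>flip\<close>
    exchanges the outer indices and \<open>swap\<close> the first two, so together they reach every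
    order.\<close>
  define E where "E a b c \<longleftrightarrow> (\<forall>x y. twist x {a, b} \<longrightarrow> twist y {b, c} \<longrightarrow> cm x y \<in> H)" for a b c
  have base: "E a b c" if "a < b" "b < c" for a b c
    unfolding E_def
  proof (intro allI impI)
    fix x y assume x: "twist x {a, b}" and y: "twist y {b, c}"
    then have i: "(a, b, c) \<in> I" using twist_subset[OF x] twist_subset[OF y] that by (simp add: I_def)
    then have ta: "twist (t {a, b}) {a, b}" and tb: "twist (t {b, c}) {b, c}" using t by (auto simp: I_def)
    have "u (a, b, c) \<in> H"
    proof (rule H2[rule_format, OF u[OF i] i])
      show "u (a, b, c) \<cdot> iv (u (a, b, c)) \<in> \<Gamma>3"
        using u[OF i] \<Gamma>2_pure[of "u (a, b, c)"] subgroup.one_closed[OF lcs_subgroup] by simp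
    next
      fix j assume "j \<in> I"
      then obtain d e g where j: "j = (d, e, g)" "d < e" "e < g" by (auto simp: I_def)
      have "f j (u (a, b, c)) =
          of_bool ({d, e} = {a, b}) * of_bool ({e, g} = {b, c}) -
          of_bool ({d, e} = {b, c}) * of_bool ({e, g} = {a, b}) +
          of_bool ({d, g} = {a, b}) * (of_bool ({d, e} = {b, c}) - of_bool ({g, e} = {b, c})) -
          of_bool ({d, g} = {b, c}) * (of_bool ({d, e} = {a, b}) - of_bool ({g, e} = {a, b}))"
        using twist_pure[OF ta] twist_pure[OF tb]
        by (simp add: f_def u_def j triple_cm twist_link[OF ta] twist_link[OF tb])
      also have "\<dots> = of_bool (j = (a, b, c))"
        using that j by (auto simp: doubleton_eq_iff)
      finally show "f j (u (a, b, c)) = of_bool (j = (a, b, c))" .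
    qed
    then have "cm (t {b, c}) (t {a, b}) \<in> H" by (simp add: u_def)
    then have "cm y x \<in> H" by (rule cm_twist_cong[OF H y tb x ta])
    then show "cm x y \<in> H" by (rule cm_sym[OF H(1) twist_pure[OF y] twist_pure[OF x]])
  qed
  have flip: "E c b a" if "E a b c" for a b c
    using that cm_sym[OF H(1)] twist_pure unfolding E_def by (metis insert_commute)
  have swap: "E b a c" if E: "E a b c" "{a, b, c} \<subseteq> {1..n}" "b \<noteq> c" for a b c
    unfolding E_def
  proof (intro allI impI)
    fix x z assume "twist x {b, a}" and z: "twist z {a, c}"
    then have x: "twist x {a, b}" by (simp add: insert_commute)
    have y: "twist (t {b, c}) {b, c}" using that by (intro t) auto
    have "cm (t {b, c}) x \<in> H"
      using E(1) x y cm_sym[OF H(1)] twist_pure unfolding E_def by blast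
    then have "cm z x \<in> H" by (rule cm_twist_triangle[OF H x y z])
    then show "cm x z \<in> H" by (rule cm_sym[OF H(1) twist_pure[OF z] twist_pure[OF x]])
  qed
  have all: "E a b c" if d: "{a, b, c} \<subseteq> {1..n}" "a \<noteq> b" "b \<noteq> c" "a \<noteq> c" for a b c
  proof -
    consider "a < b" "b < c" | "a < c" "c < b" | "b < a" "a < c" | "b < c" "c < a" | "c < a" "a < b" |
      "c < b" "b < a" using d(2-4) linorder_less_linear[of a b] linorder_less_linear[of b c]
        linorder_less_linear[of a c] by blast
    then show ?thesis
    proof cases
      case 1 then show ?thesis by (rule base)
    next
      case 2
      show ?thesis by (rule flip[OF swap[OF flip[OF base[OF 2]]]]) (use d in auto)
    next
      case 3
      show ?thesis by (rule swap[OF base[OF 3]]) (use d in auto)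
    next
      case 4
      show ?thesis by (rule flip[OF swap[OF base[OF 4]]]) (use d in auto)
    next
      case 5
      show ?thesis by (rule swap[OF flip[OF base[OF 5]]]) (use d in auto)
    next
      case 6
      show ?thesis by (rule flip[OF base[OF 6]])
    qed
  qed
  have "cm x y \<in> H" if x: "twist x T" and y: "twist y U" for x y T U
  proof -
    obtain a b where T: "T = {a, b}" "a \<noteq> b" "{a, b} \<subseteq> {1..n}" using twist_subset[OF x] by (auto simp: card_2_iff)
    obtain c d where U: "U = {c, d}" "c \<noteq> d" "{c, d} \<subseteq> {1..n}" using twist_subset[OF y] by (auto simp: card_2_iff)
    have adj: "cm x y \<in> H" if "T = {p, q}" "U = {q, r}" "p \<noteq> q" "q \<noteq> r" "p \<noteq> r" "{p, q, r} \<subseteq> {1..n}" for p q r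
    proof -
      have "E p q r" using that(3-6) by (intro all)
      then show ?thesis using x y unfolding that(1,2) E_def by blast
    qed
    consider "T = U" | "{a, b} \<inter> {c, d} = {}" | "a = c" "b \<noteq> d" | "a = d" "b \<noteq> c" |
        "b = c" "a \<noteq> d" | "b = d" "a \<noteq> c"
      unfolding T(1) U(1) using T(2) U(2) by auto
    then show ?thesis
    proof cases
      case 1
      have "cm y y = \<one>\<^bsub>B\<^esub>" using twist_pure[OF y] by (simp add: cm_commute)
      then have "cm y y \<in> H" using subgroup.one_closed[OF H(1)] by simp
      then show ?thesis using 1 cm_twist_cong[OF H x _ y y] y by simp
    next
      case 2
      show ?thesis by (rule cm_twist_disjoint[OF H x[unfolded T(1)] y[unfolded U(1)] 2])
    next
      case 3 then show ?thesis using T U by (intro adj[of b a d]) auto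
    next
      case 4 then show ?thesis using T U by (intro adj[of b a c]) auto
    next
      case 5 then show ?thesis using T U by (intro adj[of a b d]) auto
    next
      case 6 then show ?thesis using T U by (intro adj[of a b c]) auto
    qed
  qed
  then have "\<Gamma>2 \<subseteq> H" by (rule \<Gamma>2_least[OF H])
  then have "x \<in> H" using x by blast
  then show ?thesis
    by (rule H1[rule_format]) (use triple in \<open>auto simp: I_def f_def\<close>)
qed

end

section \<open>Torsion and adjustment of invariants\<close>

context braids begin

lemma torsion_free_2:
  assumes x: "x \<in> carrier B" and xx: "x \<cdot> x \<in> \<Gamma>2"
  shows "x \<in> \<Gamma>2"
proof -
  have \<pi>: "\<pi> x (\<pi> x a) = a" for a
    using \<Gamma>2_pure[OF xx] x by (auto simp: pure_iff perm_mult fun_eq_iff)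
  have "\<pi> x a = a" for a
  proof (rule ccontr)
    assume a: "\<pi> x a \<noteq> a"
    have s: "strand x a = \<pi> x a" "strand x (\<pi> x a) = a" using strand_perm[OF x] \<pi> by metis+
    have "link x a (\<pi> x a) + link x (\<pi> x a) a = 0"
      using link_\<Gamma>2[OF xx, of a "\<pi> x a"] x s by (simp add: link_mult)
    then have "2 * link x a (\<pi> x a) = of_bool (a < \<pi> x a) - of_bool (\<pi> x a < a)"
      using link_flip[OF x, of a "\<pi> x a"] a s by simp
    then show False using a by (cases "a < \<pi> x a") (auto, presburger+)
  qed
  then have p: "x \<in> P" using x by (auto simp: pure_iff)
  have "link x a b = 0" for a b
    using link_\<Gamma>2[OF xx, of a b] p by (simp add: link_pure_mult)
  then show ?thesis using link_kernel[OF p] by blast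
qed

lemma torsion_free_2':
  assumes "x \<in> carrier B" and xx: "x \<cdot> x \<in> \<Gamma>3"
  shows "x \<in> \<Gamma>3"
proof -
  have x: "x \<in> \<Gamma>2" using torsion_free_2[OF assms(1)] \<Gamma>3_\<Gamma>2[OF xx] by blast
  have "triple x a b c = 0" for a b c
    using triple_\<Gamma>3[OF xx, of a b c] x \<Gamma>2_pure[OF x] by (simp add: triple_\<Gamma>2_mult)
  then show ?thesis using triple_kernel[OF x] by blast
qed

lemma torsion_free_3:
  assumes x: "x \<in> carrier B" and xxx: "x \<cdot> x \<cdot> x \<in> \<Gamma>3"
  shows "x \<in> \<Gamma>3"
proof -
  have xxx2: "x \<cdot> x \<cdot> x \<in> \<Gamma>2" using \<Gamma>3_\<Gamma>2[OF xxx] .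
  have \<pi>: "\<pi> x (\<pi> x (\<pi> x a)) = a" for a
    using \<Gamma>2_pure[OF xxx2] x by (auto simp: pure_iff perm_mult fun_eq_iff)
  have "\<pi> x a = a" for a
  proof (rule ccontr)
    assume a: "\<pi> x a \<noteq> a"
    define b where "b = \<pi> x a"
    define c where "c = \<pi> x b"
    have ca: "\<pi> x c = a" using \<pi> by (simp add: b_def c_def)
    have s: "strand x a = c" "strand x b = a" "strand x c = b"
      using strand_perm(1)[OF x] ca b_def c_def by metis+
    have d: "a \<noteq> b" "b \<noteq> c" "a \<noteq> c" using a x ca by (auto simp: b_def c_def)
    have "triple (x \<cdot> x \<cdot> x) a b c mod 3 = 2"
      by (rule three_cycle_cube[OF x s d link_\<Gamma>2[OF xxx2]])
    then show False using triple_\<Gamma>3[OF xxx] by simp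
  qed
  then have p: "x \<in> P" using x by (auto simp: pure_iff)
  have "link x a b = 0" for a b
    using link_\<Gamma>2[OF xxx2, of a b] p by (simp add: link_pure_mult)
  then have x2: "x \<in> \<Gamma>2" using link_kernel[OF p] by blast
  have "triple x a b c = 0" for a b c
    using triple_\<Gamma>3[OF xxx, of a b c] x2 p by (simp add: triple_\<Gamma>2_mult)
  then show ?thesis using triple_kernel[OF x2] by blast
qed

section \<open>Correcting the invariants on one set of strands\<close>

lemma link_int_pow:
  assumes "x \<in> P"
  shows "x [^]\<^bsub>B\<^esub> (k::int) \<in> P \<and> link (x [^]\<^bsub>B\<^esub> k) a b = k * link x a b"
proof -
  have nat: "x [^]\<^bsub>B\<^esub> (m::nat) \<in> P \<and> link (x [^]\<^bsub>B\<^esub> m) a b = int m * link x a b" for m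
  proof (induction m)
    case 0
    then show ?case using subgroup.one_closed[OF subgroup_pure] by simp
  qed (use assms in \<open>auto simp: link_pure_mult algebra_simps\<close>)
  then show ?thesis
    using assms
    by (cases k rule: int_cases2) (auto simp: int_pow_int int_pow_neg link_pure_inv)
qed

lemma triple_int_pow:
  assumes "x \<in> \<Gamma>2"
  shows "x [^]\<^bsub>B\<^esub> (k::int) \<in> \<Gamma>2 \<and> triple (x [^]\<^bsub>B\<^esub> k) a b c = k * triple x a b c"
proof -
  have nat: "x [^]\<^bsub>B\<^esub> (m::nat) \<in> \<Gamma>2 \<and> triple (x [^]\<^bsub>B\<^esub> m) a b c = int m * triple x a b c" for m
  proof (induction m)
    case 0
    then show ?case using subgroup.one_closed[OF lcs_subgroup] by simp
  qed (use assms \<Gamma>2_pure in \<open>auto simp: triple_\<Gamma>2_mult algebra_simps\<close>)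
  then show ?thesis
    using assms \<Gamma>2_pure[OF assms]
    by (cases k rule: int_cases2) (auto simp: int_pow_int int_pow_neg triple_\<Gamma>2_inv)
qed

lemma triple_\<Gamma>2_antisym:
  assumes "x \<in> \<Gamma>2" "a \<noteq> b" "b \<noteq> c" "a \<noteq> c"
  shows "triple x a c b = - triple x a b c" "triple x b a c = - triple x a b c"
  using triple_shuffle[of x b c a] triple_flip[of x a b c] assms \<Gamma>2_pure[OF assms(1)]
  by (simp_all add: link_\<Gamma>2)

text \<open>With \<open>triple_null\<close>, the family \<open>K\<close> of
  \<open>complement_step\<close>. It is indexed by sets because reordering the strands preserves the
  linking number of a pure braid and, on \<open>\<Gamma>2\<close>, the triple invariant up to
  sign.\<close>

definition link_null :: "nat set \<Rightarrow> nat group_word set set" where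
  "link_null T = {x \<in> P. \<forall>a\<in>T. \<forall>b\<in>T. link x a b = 0}"

definition triple_null :: "nat set \<Rightarrow> nat group_word set set" where
  "triple_null T = {x \<in> \<Gamma>2. \<forall>a\<in>T. \<forall>b\<in>T. \<forall>c\<in>T. a \<noteq> b \<longrightarrow> b \<noteq> c \<longrightarrow> a \<noteq> c \<longrightarrow> triple x a b c = 0}"

lemma link_null_subgroup: "subgroup (link_null T) B"
  using subgroup.one_closed[OF subgroup_pure]
  by (intro subgroupI) (auto simp: link_null_def link_pure_mult link_pure_inv)

lemma triple_null_subgroup: "subgroup (triple_null T) B"
  using subgroup.one_closed[OF lcs_subgroup, of 2] \<Gamma>2_pure
  by (intro subgroupI) (auto simp: triple_null_def triple_\<Gamma>2_mult triple_\<Gamma>2_inv)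

lemma link_null_conj:
  assumes "b \<in> carrier B" "x \<in> link_null T"
  shows "b \<cdot> x \<cdot> iv b \<in> link_null (\<pi> b ` T)"
  using assms by (auto simp: link_null_def link_conj pure_conj strand_perm)

lemma triple_null_conj:
  assumes "b \<in> carrier B" "x \<in> triple_null T"
  shows "b \<cdot> x \<cdot> iv b \<in> triple_null (\<pi> b ` T)"
  using assms by (auto simp: triple_null_def triple_conj \<Gamma>2_conj strand_perm)

lemma link_diag: "x \<in> carrier B \<Longrightarrow> link x a a = 0"
  by (induction arbitrary: a rule: braid_induct) (auto simp: link_generator link_mult link_inv)

text \<open>A power of a twist on \<open>T\<close> cancels the linking number there, and by
  \<open>twist_link\<close> it links no other pair.\<close>

lemma link_null_adjust:
  assumes T: "T \<subseteq> {1..n}" "card T = 2" and x: "x \<in> P"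
  shows "\<exists>u\<in>P. u \<cdot> x \<in> link_null T \<and> (\<forall>U. card U = 2 \<longrightarrow> U \<noteq> T \<longrightarrow> u \<in> link_null U)"
proof -
  obtain a b where ab: "T = {a, b}" "a \<noteq> b" using T by (auto simp: card_2_iff)
  obtain t where t: "twist t T" using twist_exists[OF T] by blast
  define u where "u = t [^]\<^bsub>B\<^esub> (- link x a b)"
  have u: "u \<in> P" and lu: "link u c d = - link x a b * of_bool ({c, d} = T)" for c d
    using link_int_pow[OF twist_pure[OF t], of "- link x a b"] by (simp_all add: u_def twist_link[OF t])
  have ux: "link (u \<cdot> x) c d = link x c d - link x a b * of_bool ({c, d} = T)" for c d
    using u x by (simp add: link_pure_mult lu)
  have "link x b a = link x a b" "link x a a = 0" "link x b b = 0"
    using link_pure_sym[OF x] link_diag[of x] x by simp_all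
  then have "u \<cdot> x \<in> link_null T"
    using u x ab(2) by (auto simp: link_null_def ux ab(1) insert_commute)
  moreover have "u \<in> link_null U" if U: "card U = 2" "U \<noteq> T" for U
  proof -
    have "{c, d} \<noteq> T" if "c \<in> U" "d \<in> U" for c d
    proof
      assume "{c, d} = T"
      then have "T \<subseteq> U" "card T = card U" using that U T by auto
      moreover have "finite U" using U by (simp add: card_ge_0_finite)
      ultimately show False using U card_subset_eq by blast
    qed
    then show ?thesis using u by (auto simp: link_null_def lu)
  qed
  ultimately show ?thesis using u by blast
qed

text \<open>A commutator of twists on two pairs inside \<open>T\<close> has a nonzero triple
  invariant on \<open>T\<close> only, and there it is a unit.\<close>

lemma triple_null_adjust:
  assumes T: "T \<subseteq> {1..n}" "card T = 3" and x: "x \<in> \<Gamma>2"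
  shows "\<exists>u\<in>\<Gamma>2. u \<cdot> x \<in> triple_null T \<and> (\<forall>U. card U = 3 \<longrightarrow> U \<noteq> T \<longrightarrow> u \<in> triple_null U)"
proof -
  obtain a b c where abc: "T = {a, b, c}" "a \<noteq> b" "b \<noteq> c" "a \<noteq> c" using T by (auto simp: card_3_iff)
  obtain s t where s: "twist s {a, b}" and t: "twist t {b, c}"
    using twist_exists[of "{a, b}"] twist_exists[of "{b, c}"] T(1) abc by auto
  note P = twist_pure[OF s] twist_pure[OF t]
  \<comment> \<open>\<open>cm s t\<close> takes the value -1 at \<open>a, b, c\<close>, hence the
    positive exponent.\<close>
  define u where "u = cm s t [^]\<^bsub>B\<^esub> triple x a b c"
  have cm: "cm s t \<in> \<Gamma>2" using cm_\<Gamma>2[OF P] .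
  have u: "u \<in> \<Gamma>2" and tu: "triple u d e f = triple x a b c * triple (cm s t) d e f" for d e f
    using triple_int_pow[OF cm] by (simp_all add: u_def)
  have uT: "triple u a b c = - triple x a b c"
    using abc(2-4) by (simp add: tu triple_cm[OF P] twist_link[OF s] twist_link[OF t] doubleton_eq_iff)
  have ux: "u \<cdot> x \<in> \<Gamma>2" "triple (u \<cdot> x) a b c = 0"
    using u x \<Gamma>2_pure[OF x] uT by (simp_all add: triple_\<Gamma>2_mult)
  have "u \<cdot> x \<in> triple_null T"
  proof -
    note as = triple_\<Gamma>2_antisym[OF ux(1)]
    have "triple (u \<cdot> x) a c b = 0" "triple (u \<cdot> x) b a c = 0"
      using as[OF abc(2-4)] ux(2) by simp_all
    moreover from this have "triple (u \<cdot> x) b c a = 0" "triple (u \<cdot> x) c a b = 0"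
      using as[of b a c] as[of a c b] abc by simp_all
    moreover from this have "triple (u \<cdot> x) c b a = 0"
      using as[of b c a] abc by simp
    ultimately show ?thesis using ux by (auto simp: triple_null_def abc(1))
  qed
  moreover have "u \<in> triple_null U" if U: "card U = 3" "U \<noteq> T" for U
    unfolding triple_null_def
  proof (intro CollectI conjI ballI impI u)
    fix d e f assume d: "d \<in> U" "e \<in> U" "f \<in> U" "d \<noteq> e" "e \<noteq> f" "d \<noteq> f"
    have "card {d, e, f} = 3" using d by simp
    moreover have "finite U" using U(1) by (simp add: card_ge_0_finite)
    ultimately have "{d, e, f} = U" using d U(1) by (intro card_subset_eq) auto
    then have ne: "{d, e, f} \<noteq> {a, b, c}" using U(2) abc by simp
    \<comment> \<open>In every product in \<open>triple_cm\<close> the two pairs cover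
      \<open>{d, e, f}\<close>. If both factors were 1, this set would be
      \<open>{a, b, c}\<close>.\<close>
    have 0: "of_bool ({p, q} = {a, b}) * of_bool ({r, v} = {b, c}) = (0::int)"
      "of_bool ({r, v} = {b, c}) * of_bool ({p, q} = {a, b}) = (0::int)"
      if "{p, q} \<union> {r, v} = {d, e, f}" for p q r v
    proof -
      have "\<not> ({p, q} = {a, b} \<and> {r, v} = {b, c})"
      proof
        assume "{p, q} = {a, b} \<and> {r, v} = {b, c}"
        then have "{d, e, f} = {a, b} \<union> {b, c}" using that by simp
        then show False using ne by (simp add: insert_commute)
      qed
      then show "of_bool ({p, q} = {a, b}) * of_bool ({r, v} = {b, c}) = (0::int)"
        "of_bool ({r, v} = {b, c}) * of_bool ({p, q} = {a, b}) = (0::int)"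
        by auto
    qed
    have un: "{e, f} \<union> {d, e} = {d, e, f}" "{d, e} \<union> {e, f} = {d, e, f}" "{d, e} \<union> {d, f} = {d, e, f}"
      "{f, e} \<union> {d, f} = {d, e, f}" "{d, f} \<union> {d, e} = {d, e, f}" "{d, f} \<union> {f, e} = {d, e, f}"
      by auto
    have "triple (cm s t) d e f = 0"
      unfolding triple_cm[OF P] twist_link[OF s] twist_link[OF t] right_diff_distrib
        un[THEN 0(1)] un[THEN 0(2)] by simp
    then show "triple u d e f = 0" by (simp add: tu)
  qed
  ultimately show ?thesis using u by blast
qed

end

section \<open>Embedding finite groups\<close>

text \<open>Sylow's theorem with exponent 1 gives a subgroup of order \<open>p\<close>.\<close>

lemma (in group) cauchy:
  assumes "finite (carrier G)" "prime p" "p dvd order G"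
  shows "\<exists>x\<in>carrier G. x \<noteq> \<one> \<and> x [^] p = \<one>"
proof -
  obtain m where "order G = p ^ 1 * m" using assms(3) by auto
  from sylow_thm[OF assms(2) is_group this assms(1)]
  obtain H where H: "subgroup H G" "card H = p" by auto
  have "card (H - {\<one>}) = p - 1" "p > 1"
    using H subgroup.one_closed[OF H(1)] prime_gt_1_nat[OF assms(2)] by (simp_all add: card_Diff_singleton)
  then have "H - {\<one>} \<noteq> {}" by (metis card.empty diff_is_0_eq not_le)
  then obtain x where x: "x \<in> H" "x \<noteq> \<one>" by blast
  interpret H: group "G\<lparr>carrier := H\<rparr>" by (rule subgroup_imp_group[OF H(1)])
  have "x [^]\<^bsub>G\<lparr>carrier := H\<rparr>\<^esub> p = \<one>"
    using H.pow_order_eq_1[of x] x H(2) by (simp add: order_def)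
  then have "x [^] p = \<one>" by (simp add: nat_pow_consistent[symmetric])
  then show ?thesis using x subgroup.subset[OF H(1)] by blast
qed

lemma (in group) pow_coprime_eq_one:
  assumes x: "x \<in> carrier G" and "x [^] (m::nat) = \<one>" "coprime m (order G)"
  shows "x = \<one>"
proof -
  have "ord x dvd m" "ord x dvd order G"
    using assms pow_eq_id[OF x] pow_order_eq_1[OF x] by auto
  then have "ord x = 1" using assms(3) coprime_common_divisor by fastforce
  then show ?thesis using ord_eq_1[OF x] by simp
qed

text \<open>After a choice of orbit representatives, freeness makes the group element that carries
  the representative to \<open>T\<close> unique, and uniqueness forces equivariance.\<close>

lemma (in group) equivariant_map:
  assumes closed: "\<And>g T. g \<in> carrier G \<Longrightarrow> T \<in> I \<Longrightarrow> act g T \<in> I"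
    and mult: "\<And>g h T. g \<in> carrier G \<Longrightarrow> h \<in> carrier G \<Longrightarrow> T \<in> I \<Longrightarrow> act (g \<otimes> h) T = act g (act h T)"
    and one: "\<And>T. T \<in> I \<Longrightarrow> act \<one> T = T"
    and free: "\<And>g T. g \<in> carrier G \<Longrightarrow> T \<in> I \<Longrightarrow> act g T = T \<Longrightarrow> g = \<one>"
  obtains f where "\<And>T. T \<in> I \<Longrightarrow> f T \<in> carrier G"
    "\<And>g T. g \<in> carrier G \<Longrightarrow> T \<in> I \<Longrightarrow> f (act g T) = g \<otimes> f T"
proof -
  define orbit where "orbit T = (\<lambda>g. act g T) ` carrier G" for T
  have inv_act: "act (inv g) (act g T) = T" if "g \<in> carrier G" "T \<in> I" for g T
    using that mult[of "inv g" g T] one by simp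
  have orbit_act: "orbit (act g T) = orbit T" if g: "g \<in> carrier G" and T: "T \<in> I" for g T
  proof
    show "orbit (act g T) \<subseteq> orbit T"
    proof
      fix U assume "U \<in> orbit (act g T)"
      then obtain h where h: "h \<in> carrier G" "U = act h (act g T)" by (auto simp: orbit_def)
      then have "U = act (h \<otimes> g) T" using g T by (simp add: mult)
      then show "U \<in> orbit T" using g h by (auto simp: orbit_def)
    qed
    show "orbit T \<subseteq> orbit (act g T)"
    proof
      fix U assume "U \<in> orbit T"
      then obtain h where h: "h \<in> carrier G" "U = act h T" by (auto simp: orbit_def)
      have "act (h \<otimes> inv g) (act g T) = act h (act (inv g) (act g T))"
        using g T h closed by (intro mult) simp_all
      then have "U = act (h \<otimes> inv g) (act g T)" using h inv_act[OF g T] by simp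
      then show "U \<in> orbit (act g T)" using g h by (auto simp: orbit_def)
    qed
  qed
  define r where "r T = (SOME U. U \<in> orbit T)" for T
  have r: "r T \<in> orbit T" if "T \<in> I" for T
  proof -
    have "T \<in> orbit T" using that one[OF that] unfolding orbit_def by (metis image_eqI one_closed)
    then show ?thesis unfolding r_def by (rule someI)
  qed
  have "\<exists>g\<in>carrier G. T = act g (r T)" if T: "T \<in> I" for T
  proof -
    obtain h where h: "h \<in> carrier G" "r T = act h T" using r[OF T] by (auto simp: orbit_def)
    then show ?thesis using inv_act[OF h(1) T] by (intro bexI[of _ "inv h"]) simp_all
  qed
  then obtain f where f: "\<And>T. T \<in> I \<Longrightarrow> f T \<in> carrier G \<and> T = act (f T) (r T)" by metis
  have rI: "r T \<in> I" if "T \<in> I" for T using r[OF that] that closed by (auto simp: orbit_def)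
  have "f (act g T) = g \<otimes> f T" if g: "g \<in> carrier G" and T: "T \<in> I" for g T
  proof -
    let ?h = "inv (f (act g T)) \<otimes> (g \<otimes> f T)"
    have gT: "act g T \<in> I" by (rule closed[OF g T])
    have c: "f T \<in> carrier G" "f (act g T) \<in> carrier G" using f T gT by auto
    have rr: "r (act g T) = r T" using orbit_act[OF g T] by (simp add: r_def)
    have A: "act (g \<otimes> f T) (r T) = act (f (act g T)) (r T)"
    proof -
      have "act (g \<otimes> f T) (r T) = act g (act (f T) (r T))"
        by (rule mult[OF g c(1) rI[OF T]])
      then show ?thesis using f[OF T] f[OF gT] rr by simp
    qed
    have "act ?h (r T) = act (inv (f (act g T))) (act (g \<otimes> f T) (r T))"
      using c g rI[OF T] by (intro mult) simp_all
    then have "act ?h (r T) = r T" using A inv_act[OF c(2) rI[OF T]] by simp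
    then have "?h = \<one>" using c g by (intro free[OF _ rI[OF T]]) simp_all
    then have "f (act g T) \<otimes> ?h = f (act g T)" using c by simp
    moreover have "f (act g T) \<otimes> ?h = g \<otimes> f T" using c g by (simp add: m_assoc[symmetric])
    ultimately show ?thesis by simp
  qed
  then show thesis using that f by blast
qed

text \<open>The indices are treated one at a time: the correction for one index lies in
  \<open>K j\<close> for every other \<open>j\<close>, so it preserves what has been
  achieved.\<close>

lemma (in group) finite_correction:
  assumes P: "subgroup P G" and I: "finite I" and q: "\<And>i. i \<in> I \<Longrightarrow> q i \<in> P"
    and K: "\<And>i. i \<in> I \<Longrightarrow> subgroup (K i) G"
    and adjust: "\<And>i x. i \<in> I \<Longrightarrow> x \<in> P \<Longrightarrow>
      \<exists>u\<in>P. u \<otimes> x \<in> K i \<and> (\<forall>j\<in>I. j \<noteq> i \<longrightarrow> u \<in> K j)"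
  shows "\<exists>p\<in>P. \<forall>i\<in>I. p \<otimes> q i \<in> K i"
proof -
  have Pc: "x \<in> carrier G" if "x \<in> P" for x using that subgroup.subset[OF P] by blast
  have "\<exists>p\<in>P. \<forall>i\<in>J. p \<otimes> q i \<in> K i" if "finite J" "J \<subseteq> I" for J
    using that
  proof induction
    case empty
    then show ?case using subgroup.one_closed[OF P] by blast
  next
    case (insert j J)
    then obtain p where p: "p \<in> P" "\<forall>i\<in>J. p \<otimes> q i \<in> K i" by auto
    have j: "j \<in> I" using insert by simp
    have "p \<otimes> q j \<in> P" using subgroup.m_closed[OF P p(1) q[OF j]] .
    then obtain u where u: "u \<in> P" "u \<otimes> (p \<otimes> q j) \<in> K j" "\<forall>i\<in>I. i \<noteq> j \<longrightarrow> u \<in> K i"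
      using adjust[OF j] by blast
    have assoc: "u \<otimes> p \<otimes> q i = u \<otimes> (p \<otimes> q i)" if "i \<in> I" for i
      using u p q[OF that] Pc by (simp add: m_assoc)
    have "u \<otimes> p \<otimes> q i \<in> K i" if "i \<in> insert j J" for i
    proof (cases "i = j")
      case True
      then show ?thesis using u(2) assoc[OF j] by simp
    next
      case False
      then have i: "i \<in> J" "i \<in> I" using that insert by auto
      have "u \<otimes> (p \<otimes> q i) \<in> K i"
        using subgroup.m_closed[OF K[OF i(2)], of u "p \<otimes> q i"] u(3) p(2) i False by simp
      then show ?thesis using assoc[OF i(2)] by simp
    qed
    then show ?case using subgroup.m_closed[OF P u(1) p(1)] by blast
  qed
  then show ?thesis using I by blast
qed

section \<open>Complements for a free action on strands\<close>

locale braid_action = braids n + G: group G for n and G (structure) +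
  fixes \<rho> :: "'a \<Rightarrow> nat \<Rightarrow> nat"
  assumes \<rho>_permutes: "g \<in> carrier G \<Longrightarrow> \<rho> g permutes {1..n}"
    and \<rho>_mult: "g \<in> carrier G \<Longrightarrow> h \<in> carrier G \<Longrightarrow> \<rho> (g \<otimes> h) = \<rho> g \<circ> \<rho> h"
    and \<rho>_inj: "inj_on \<rho> (carrier G)"
begin

definition lifts :: "nat group_word set set" where
  "lifts = {x \<in> carrier B. \<exists>g\<in>carrier G. \<pi> x = \<rho> g}"

lemma \<rho>_one: "\<rho> \<one> = id"
proof -
  have "\<rho> \<one> (\<rho> \<one> a) = \<rho> \<one> a" for a using fun_cong[OF \<rho>_mult[of \<one> \<one>], of a] by simp
  moreover have "inj (\<rho> \<one>)" by (rule permutes_inj[OF \<rho>_permutes]) simp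
  ultimately show ?thesis by (simp add: fun_eq_iff inj_eq)
qed

lemma div_pure:
  assumes "x \<in> carrier B" "y \<in> carrier B" "\<pi> x = \<pi> y"
  shows "x \<cdot> iv y \<in> P"
proof -
  have "\<pi> (x \<cdot> iv y) a = a" for a
    using assms strand_perm(2)[OF assms(2), of a] by (simp add: perm_mult perm_inv)
  then show ?thesis using assms by (simp add: pure_iff fun_eq_iff)
qed

definition k_subsets :: "nat \<Rightarrow> nat set set" where
  "k_subsets m = {T. T \<subseteq> {1..n} \<and> card T = m}"

lemma k_subsets_image:
  assumes g: "g \<in> carrier G" and T: "T \<in> k_subsets m"
  shows "\<rho> g ` T \<in> k_subsets m"
proof -
  have "card (\<rho> g ` T) = card T" by (rule card_image[OF permutes_inj_on[OF \<rho>_permutes[OF g]]])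
  moreover have "\<rho> g ` T \<subseteq> \<rho> g ` {1..n}" using T by (intro image_mono) (simp add: k_subsets_def)
  ultimately show ?thesis
    using T permutes_image[OF \<rho>_permutes[OF g]] by (simp add: k_subsets_def)
qed

text \<open>
  Since the action on the index set is free, an equivariant map from it to the group exists; the
  subgroup below consists of the elements whose deviation from equivariance of a lift of this map
  vanishes at every index.
\<close>

lemma complement_step:
  assumes S: "subgroup S B" "S \<subseteq> lifts" "Q \<subseteq> S" "S \<inter> P \<subseteq> Q" and Q: "Q \<lhd> B" "Q \<subseteq> P"
    and surj: "\<And>g. g \<in> carrier G \<Longrightarrow> \<exists>x\<in>S. \<pi> x = \<rho> g"
    and free: "\<And>g T. g \<in> carrier G \<Longrightarrow> T \<in> k_subsets m \<Longrightarrow> \<rho> g ` T = T \<Longrightarrow> g = \<one>"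
    and K: "\<And>T. subgroup (K T) B"
    and K_conj: "\<And>b x T. b \<in> carrier B \<Longrightarrow> x \<in> K T \<Longrightarrow> b \<cdot> x \<cdot> iv b \<in> K (\<pi> b ` T)"
    and adjust: "\<And>T x. T \<in> k_subsets m \<Longrightarrow> x \<in> Q \<Longrightarrow>
      \<exists>u\<in>Q. u \<cdot> x \<in> K T \<and> (\<forall>U\<in>k_subsets m. U \<noteq> T \<longrightarrow> u \<in> K U)"
  shows "\<exists>S'. subgroup S' B \<and> S' \<subseteq> lifts \<and> (\<forall>g\<in>carrier G. \<exists>x\<in>S'. \<pi> x = \<rho> g) \<and>
    S' \<inter> P = {x \<in> Q. \<forall>T\<in>k_subsets m. x \<in> K T}"
proof -
  let ?I = "k_subsets m"
  obtain f where f: "\<And>T. T \<in> ?I \<Longrightarrow> f T \<in> carrier G"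
    "\<And>g T. g \<in> carrier G \<Longrightarrow> T \<in> ?I \<Longrightarrow> f (\<rho> g ` T) = g \<otimes> f T"
    by (rule G.equivariant_map[of ?I "\<lambda>g T. \<rho> g ` T"])
      (auto simp: k_subsets_image \<rho>_mult image_comp \<rho>_one free)
  obtain s where s: "\<And>g. g \<in> carrier G \<Longrightarrow> s g \<in> S \<and> \<pi> (s g) = \<rho> g" using surj by metis
  have Sc: "x \<in> carrier B" if "x \<in> S" for x using that S(2) by (auto simp: lifts_def)
  define F where "F T = s (f T)" for T
  have F: "F T \<in> S" "F T \<in> carrier B" if "T \<in> ?I" for T using s f(1)[OF that] Sc by (auto simp: F_def)
  define d where "d x T = x \<cdot> F T \<cdot> iv (F (\<pi> x ` T))" for x T
  have I_closed: "\<pi> x ` T \<in> ?I" if "x \<in> S" "T \<in> ?I" for x T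
    using that S(2) k_subsets_image by (auto simp: lifts_def)
  have d_in: "d x T \<in> Q" if x: "x \<in> S" and T: "T \<in> ?I" for x T
  proof -
    obtain g where g: "g \<in> carrier G" "\<pi> x = \<rho> g" using x S(2) by (auto simp: lifts_def)
    have "f (\<pi> x ` T) = g \<otimes> f T" using f(2)[OF g(1) T] g(2) by simp
    then have "\<pi> (x \<cdot> F T) = \<pi> (F (\<pi> x ` T))"
      using g f(1)[OF T] Sc[OF x] F(2)[OF T] s[of "f T"] s[of "g \<otimes> f T"]
      by (simp add: F_def perm_mult \<rho>_mult)
    then have "d x T \<in> P" unfolding d_def
      using Sc[OF x] F(2)[OF T] F(2)[OF I_closed[OF x T]] by (intro div_pure) simp_all
    moreover have "d x T \<in> S" unfolding d_def
      using x F(1)[OF T] F(1)[OF I_closed[OF x T]]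
      by (intro subgroup.m_closed[OF S(1)] subgroup.m_inv_closed[OF S(1)])
    ultimately show ?thesis using S(4) by blast
  qed
  \<comment> \<open>The crossed homomorphism identity; with \<open>K_conj\<close> it makes the
    conditions defining \<open>S'\<close> compatible with products.\<close>
  have d_mult: "d (x \<cdot> y) T = (x \<cdot> d y T \<cdot> iv x) \<cdot> d x (\<pi> y ` T)"
    if x: "x \<in> S" and y: "y \<in> S" and T: "T \<in> ?I" for x y T
    using Sc[OF x] Sc[OF y] F(2)[OF T] F(2)[OF I_closed[OF y T]]
      F(2)[OF I_closed[OF x I_closed[OF y T]]]
    by (simp add: d_def perm_mult image_comp m_assoc)
  define S' where "S' = {x \<in> S. \<forall>T\<in>?I. d x T \<in> K (\<pi> x ` T)}"
  have "subgroup S' B"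
  proof (rule subgroupI)
    show "S' \<subseteq> carrier B" using Sc by (auto simp: S'_def)
    have "\<one>\<^bsub>B\<^esub> \<in> S'"
      using subgroup.one_closed[OF S(1)] subgroup.one_closed[OF K] F(2) by (simp add: S'_def d_def)
    then show "S' \<noteq> {}" by blast
  next
    fix x assume "x \<in> S'"
    then have x: "x \<in> S" "\<And>T. T \<in> ?I \<Longrightarrow> d x T \<in> K (\<pi> x ` T)" by (auto simp: S'_def)
    have ix: "iv x \<in> S" using subgroup.m_inv_closed[OF S(1) x(1)] .
    have "d (iv x) T \<in> K (\<pi> (iv x) ` T)" if T: "T \<in> ?I" for T
    proof -
      let ?U = "\<pi> (iv x) ` T"
      have U: "?U \<in> ?I" by (rule I_closed[OF ix T])
      have xU: "\<pi> x ` ?U = T"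
        using strand_perm(2)[OF Sc[OF x(1)]] Sc[OF x(1)] by (simp add: perm_inv image_comp comp_def)
      have "iv x \<cdot> iv (d x ?U) \<cdot> iv (iv x) \<in> K (\<pi> (iv x) ` T)"
        using x(2)[OF U] Sc[OF ix] xU by (intro K_conj subgroup.m_inv_closed[OF K]) simp_all
      moreover have "iv x \<cdot> iv (d x ?U) \<cdot> iv (iv x) = d (iv x) T"
        using Sc[OF x(1)] F(2)[OF T] F(2)[OF U] by (simp add: d_def xU inv_mult_group m_assoc)
      ultimately show ?thesis by simp
    qed
    then show "iv x \<in> S'" using ix by (simp add: S'_def)
  next
    fix x y assume "x \<in> S'" "y \<in> S'"
    then have x: "x \<in> S" "\<And>T. T \<in> ?I \<Longrightarrow> d x T \<in> K (\<pi> x ` T)"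
      and y: "y \<in> S" "\<And>T. T \<in> ?I \<Longrightarrow> d y T \<in> K (\<pi> y ` T)" by (auto simp: S'_def)
    have "d (x \<cdot> y) T \<in> K (\<pi> (x \<cdot> y) ` T)" if T: "T \<in> ?I" for T
    proof -
      have "\<pi> (x \<cdot> y) ` T = \<pi> x ` \<pi> y ` T" using Sc x y by (simp add: perm_mult image_comp)
      then show ?thesis
        unfolding d_mult[OF x(1) y(1) T]
        using K_conj[OF Sc[OF x(1)] y(2)[OF T]] x(2)[OF I_closed[OF y(1) T]]
        by (simp add: subgroup.m_closed[OF K])
    qed
    then show "x \<cdot> y \<in> S'" using subgroup.m_closed[OF S(1) x(1) y(1)] by (simp add: S'_def)
  qed
  moreover have "S' \<subseteq> lifts" using S(2) by (auto simp: S'_def)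
  moreover have "\<exists>x\<in>S'. \<pi> x = \<rho> g" if g: "g \<in> carrier G" for g
  proof -
    obtain x where x: "x \<in> S" "\<pi> x = \<rho> g" using surj[OF g] by blast
    have ix: "iv x \<in> S" using subgroup.m_inv_closed[OF S(1) x(1)] .
    have fin: "finite ?I" by (rule finite_subset[of _ "Pow {1..n}"]) (auto simp: k_subsets_def)
    \<comment> \<open>A pure factor \<open>p\<close> on the left of \<open>x\<close> multiplies all
      deviations of \<open>x\<close> by \<open>p\<close>. Their conditions are indexed by images
      under \<open>\<pi> x\<close>, hence the shift by \<open>iv x\<close>.\<close>
    have "\<exists>p\<in>Q. \<forall>T\<in>?I. p \<cdot> d x (\<pi> (iv x) ` T) \<in> K T"
      using d_in[OF x(1) I_closed[OF ix]]
      by (intro finite_correction normal_imp_subgroup[OF Q(1)] fin K adjust)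
    then obtain p where p: "p \<in> Q" "\<And>T. T \<in> ?I \<Longrightarrow> p \<cdot> d x (\<pi> (iv x) ` T) \<in> K T" by blast
    have pS: "p \<in> S" "p \<in> P" "p \<in> carrier B" using p(1) S(3) Q(2) by auto
    have \<pi>px: "\<pi> (p \<cdot> x) = \<pi> x" using pS Sc[OF x(1)] by (simp add: perm_mult pure_iff)
    have "d (p \<cdot> x) T \<in> K (\<pi> (p \<cdot> x) ` T)" if T: "T \<in> ?I" for T
    proof -
      have "\<pi> (iv x) ` (\<pi> x ` T) = T"
        using strand_perm(1)[OF Sc[OF x(1)]] Sc[OF x(1)] by (simp add: perm_inv image_comp comp_def)
      then have "p \<cdot> d x T \<in> K (\<pi> x ` T)" using p(2)[OF I_closed[OF x(1) T]] by simp
      moreover have "p \<cdot> d x T = d (p \<cdot> x) T"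
        using pS Sc[OF x(1)] F(2)[OF T] F(2)[OF I_closed[OF x(1) T]] by (simp add: d_def \<pi>px m_assoc)
      ultimately show ?thesis by (simp add: \<pi>px)
    qed
    then have "p \<cdot> x \<in> S'" using subgroup.m_closed[OF S(1) pS(1) x(1)] by (simp add: S'_def)
    then show ?thesis using \<pi>px x(2) by auto
  qed
  moreover have "S' \<inter> P = {x \<in> Q. \<forall>T\<in>?I. x \<in> K T}"
  proof -
    \<comment> \<open>A pure braid fixes every \<open>T\<close>, so its deviation is the braid
      itself.\<close>
    have "d x T = x" "\<pi> x ` T = T" if "x \<in> P" "T \<in> ?I" for x T
      using that F(2)[OF that(2)] by (auto simp: d_def pure_iff m_assoc)
    then show ?thesis using S(3,4) Q(2) by (auto simp: S'_def)
  qed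
  ultimately show ?thesis by blast
qed

text \<open>Lifts chosen in \<open>S\<close> multiply correctly up to \<open>S \<inter> P\<close>,
  hence modulo \<open>lcs k\<close>. As \<open>lcs k\<close> is pure, the class of a lift still
  determines its permutation, and \<open>\<rho>\<close> is injective.\<close>

lemma embeds_if_complement:
  assumes S: "subgroup S B" "S \<subseteq> lifts" "S \<inter> P \<subseteq> lcs k"
    and surj: "\<And>g. g \<in> carrier G \<Longrightarrow> \<exists>x\<in>S. \<pi> x = \<rho> g"
  shows "embeds_in G (B Mod lcs k)"
proof -
  obtain s where s: "\<And>g. g \<in> carrier G \<Longrightarrow> s g \<in> S \<and> \<pi> (s g) = \<rho> g" using surj by metis
  have sc: "s g \<in> carrier B" if "g \<in> carrier G" for g using s[OF that] S(2) by (auto simp: lifts_def)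
  interpret N: normal "lcs k" B by (rule lcs_normal)
  define \<phi> where "\<phi> g = lcs k #>\<^bsub>B\<^esub> s g" for g
  have eq: "lcs k #>\<^bsub>B\<^esub> x = lcs k #>\<^bsub>B\<^esub> y \<longleftrightarrow> x \<cdot> iv y \<in> lcs k" if "x \<in> carrier B" "y \<in> carrier B" for x y
    using that by (metis N.rcos_module N.subgroup_axioms is_group rcos_self repr_independence)
  have "\<phi> \<in> hom G (B Mod lcs k)"
  proof (rule homI)
    fix g assume "g \<in> carrier G"
    then show "\<phi> g \<in> carrier (B Mod lcs k)"
      using sc by (auto simp: \<phi>_def FactGroup_def intro!: rcosetsI N.subset)
  next
    fix g h assume g: "g \<in> carrier G" and h: "h \<in> carrier G"
    have gh: "g \<otimes> h \<in> carrier G" using g h by simp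
    have "s (g \<otimes> h) \<cdot> iv (s g \<cdot> s h) \<in> P"
      using s[OF gh] s[OF g] s[OF h] sc[OF gh] sc[OF g] sc[OF h] g h
      by (intro div_pure) (simp_all add: perm_mult \<rho>_mult)
    moreover have "s (g \<otimes> h) \<cdot> iv (s g \<cdot> s h) \<in> S"
      using s[OF gh] s[OF g] s[OF h]
      by (intro subgroup.m_closed[OF S(1)] subgroup.m_inv_closed[OF S(1)]) auto
    ultimately show "\<phi> (g \<otimes> h) = \<phi> g \<otimes>\<^bsub>B Mod lcs k\<^esub> \<phi> h"
      using S(3) sc[OF gh] sc[OF g] sc[OF h]
      by (simp add: \<phi>_def FactGroup_def N.rcos_sum) (subst eq, auto)
  qed
  moreover have "inj_on \<phi> (carrier G)"
  proof (rule inj_onI)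
    fix g h assume g: "g \<in> carrier G" and h: "h \<in> carrier G" and "\<phi> g = \<phi> h"
    then have "s g \<cdot> iv (s h) \<in> P" using eq[OF sc[OF g] sc[OF h]] lcs_pure[of k] by (auto simp: \<phi>_def)
    moreover have "s g = (s g \<cdot> iv (s h)) \<cdot> s h" using sc[OF g] sc[OF h] by (simp add: m_assoc)
    ultimately have "\<pi> (s g) = \<pi> (s h)" using sc[OF h] perm_mult by (metis id_comp pure_iff)
    then show "g = h" using s[OF g] s[OF h] \<rho>_inj g h by (auto dest: inj_onD)
  qed
  ultimately show ?thesis unfolding embeds_in_def mon_def by blast
qed

text \<open>\<open>complement_step\<close> starting from all lifts, with \<open>P\<close> in the
  role of \<open>Q\<close> and linking numbers as the invariant.\<close>

lemma complement_2:
  assumes free: "\<And>g T. g \<in> carrier G \<Longrightarrow> T \<in> k_subsets 2 \<Longrightarrow> \<rho> g ` T = T \<Longrightarrow> g = \<one>"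
  shows "\<exists>S. subgroup S B \<and> S \<subseteq> lifts \<and> (\<forall>g\<in>carrier G. \<exists>x\<in>S. \<pi> x = \<rho> g) \<and> S \<inter> P = \<Gamma>2"
proof -
  have lifts: "subgroup lifts B"
  proof (rule subgroupI)
    have "\<one>\<^bsub>B\<^esub> \<in> carrier B" "\<pi> \<one>\<^bsub>B\<^esub> = \<rho> \<one>" by (simp_all add: \<rho>_one)
    then show "lifts \<noteq> {}" unfolding lifts_def using G.one_closed by blast
  next
    fix x assume "x \<in> lifts"
    then obtain g where g: "x \<in> carrier B" "g \<in> carrier G" "\<pi> x = \<rho> g" by (auto simp: lifts_def)
    have "\<pi> (iv x) a = \<rho> (inv g) a" for a
    proof -
      have "\<rho> g (\<rho> (inv g) a) = a" using \<rho>_mult[of g "inv g"] g(2) \<rho>_one by (simp add: fun_eq_iff)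
      then show ?thesis using g strand_perm(1)[OF g(1), of "\<rho> (inv g) a"] by (simp add: perm_inv)
    qed
    then have "\<pi> (iv x) = \<rho> (inv g)" by (rule ext)
    moreover have "iv x \<in> carrier B" "inv g \<in> carrier G" using g by simp_all
    ultimately show "iv x \<in> lifts" unfolding lifts_def by blast
  next
    fix x y assume "x \<in> lifts" "y \<in> lifts"
    then obtain g h where "x \<in> carrier B" "y \<in> carrier B" "g \<in> carrier G" "h \<in> carrier G"
      "\<pi> x = \<rho> g" "\<pi> y = \<rho> h" by (auto simp: lifts_def)
    then have "x \<cdot> y \<in> carrier B" "g \<otimes> h \<in> carrier G" "\<pi> (x \<cdot> y) = \<rho> (g \<otimes> h)"
      by (simp_all add: perm_mult \<rho>_mult)
    then show "x \<cdot> y \<in> lifts" unfolding lifts_def by blast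
  qed (auto simp: lifts_def)
  have "P \<subseteq> lifts"
  proof
    fix x assume "x \<in> P"
    then have "x \<in> carrier B" "\<pi> x = \<rho> \<one>" by (simp_all add: pure_iff \<rho>_one)
    then show "x \<in> lifts" unfolding lifts_def using G.one_closed by blast
  qed
  then have "\<exists>S. subgroup S B \<and> S \<subseteq> lifts \<and> (\<forall>g\<in>carrier G. \<exists>x\<in>S. \<pi> x = \<rho> g) \<and>
      S \<inter> P = {x \<in> P. \<forall>T\<in>k_subsets 2. x \<in> link_null T}"
  proof (rule complement_step[OF lifts order.refl])
    show "\<exists>x\<in>lifts. \<pi> x = \<rho> g" if g: "g \<in> carrier G" for g
      using perm_surj[OF \<rho>_permutes[OF g]] g by (auto simp: lifts_def)
    show "\<exists>u\<in>P. u \<cdot> x \<in> link_null T \<and> (\<forall>U\<in>k_subsets 2. U \<noteq> T \<longrightarrow> u \<in> link_null U)"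
      if "T \<in> k_subsets 2" "x \<in> P" for T x
      using link_null_adjust[of T x] that by (auto simp: k_subsets_def)
  qed (simp_all add: pure_braids_normal link_null_subgroup link_null_conj free)
  moreover have "{x \<in> P. \<forall>T\<in>k_subsets 2. x \<in> link_null T} = \<Gamma>2"
  proof (intro equalityI subsetI)
    fix x assume "x \<in> {x \<in> P. \<forall>T\<in>k_subsets 2. x \<in> link_null T}"
    then have x: "x \<in> P" "\<And>T. T \<in> k_subsets 2 \<Longrightarrow> x \<in> link_null T" by auto
    have "link x a b = 0" if "a \<in> {1..n}" "b \<in> {1..n}" for a b
    proof (cases "a = b")
      case True
      then show ?thesis using link_diag x(1) by simp
    next
      case False
      then have "x \<in> link_null {a, b}" using that by (intro x(2)) (simp add: k_subsets_def)
      then show ?thesis by (simp add: link_null_def)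
    qed
    then show "x \<in> \<Gamma>2" by (rule link_kernel[OF x(1)])
  qed (simp add: link_null_def link_\<Gamma>2 \<Gamma>2_pure)
  ultimately show ?thesis by simp
qed

text \<open>A second \<open>complement_step\<close>, inside the subgroup from
  \<open>complement_2\<close>, with \<open>\<Gamma>2\<close> in the role of \<open>Q\<close> and
  triple invariants.\<close>

lemma complement_3:
  assumes free2: "\<And>g T. g \<in> carrier G \<Longrightarrow> T \<in> k_subsets 2 \<Longrightarrow> \<rho> g ` T = T \<Longrightarrow> g = \<one>"
    and free3: "\<And>g T. g \<in> carrier G \<Longrightarrow> T \<in> k_subsets 3 \<Longrightarrow> \<rho> g ` T = T \<Longrightarrow> g = \<one>"
  shows "\<exists>S. subgroup S B \<and> S \<subseteq> lifts \<and> (\<forall>g\<in>carrier G. \<exists>x\<in>S. \<pi> x = \<rho> g) \<and> S \<inter> P = \<Gamma>3"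
proof -
  have "\<exists>S. subgroup S B \<and> S \<subseteq> lifts \<and> (\<forall>g\<in>carrier G. \<exists>x\<in>S. \<pi> x = \<rho> g) \<and> S \<inter> P = \<Gamma>2"
    by (rule complement_2) (rule free2)
  then obtain S where S: "subgroup S B" "S \<subseteq> lifts" "\<forall>g\<in>carrier G. \<exists>x\<in>S. \<pi> x = \<rho> g" "S \<inter> P = \<Gamma>2"
    by (elim exE conjE)
  have "\<Gamma>2 \<subseteq> S" "S \<inter> P \<subseteq> \<Gamma>2" using S(4) by blast+
  then have "\<exists>S. subgroup S B \<and> S \<subseteq> lifts \<and> (\<forall>g\<in>carrier G. \<exists>x\<in>S. \<pi> x = \<rho> g) \<and>
      S \<inter> P = {x \<in> \<Gamma>2. \<forall>T\<in>k_subsets 3. x \<in> triple_null T}"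
  proof (rule complement_step[OF S(1,2)])
    show "\<Gamma>2 \<subseteq> P" by (rule lcs_pure)
    show "\<exists>x\<in>S. \<pi> x = \<rho> g" if g: "g \<in> carrier G" for g using S(3) g by blast
    show "\<exists>u\<in>\<Gamma>2. u \<cdot> x \<in> triple_null T \<and> (\<forall>U\<in>k_subsets 3. U \<noteq> T \<longrightarrow> u \<in> triple_null U)"
      if "T \<in> k_subsets 3" "x \<in> \<Gamma>2" for T x
      using triple_null_adjust[of T x] that by (auto simp: k_subsets_def)
  qed (simp_all add: lcs_normal triple_null_subgroup triple_null_conj free3)
  moreover have "{x \<in> \<Gamma>2. \<forall>T\<in>k_subsets 3. x \<in> triple_null T} = \<Gamma>3"
  proof (intro equalityI subsetI)
    fix x assume "x \<in> {x \<in> \<Gamma>2. \<forall>T\<in>k_subsets 3. x \<in> triple_null T}"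
    then have x: "x \<in> \<Gamma>2" "\<And>T. T \<in> k_subsets 3 \<Longrightarrow> x \<in> triple_null T" by auto
    have "triple x a b c = 0" if "{a, b, c} \<subseteq> {1..n}" "a \<noteq> b" "b \<noteq> c" "a \<noteq> c" for a b c
    proof -
      have "x \<in> triple_null {a, b, c}" using that by (intro x(2)) (simp add: k_subsets_def)
      then show ?thesis using that by (simp add: triple_null_def)
    qed
    then show "x \<in> \<Gamma>3" by (rule triple_kernel[OF x(1)])
  qed (simp add: triple_null_def triple_\<Gamma>3 \<Gamma>3_\<Gamma>2)
  ultimately show ?thesis by simp
qed

end

section \<open>The left regular action and the theorem\<close>

lemma (in group) left_regular_permutes:
  assumes e: "bij_betw e A (carrier G)" and g: "g \<in> carrier G"
  shows "(\<lambda>i. if i \<in> A then inv_into A e (g \<otimes> e i) else i) permutes A"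
proof (rule bij_imp_permutes)
  have "bij_betw (\<lambda>x. g \<otimes> x) (carrier G) (carrier G)"
    using g by (intro bij_betwI[of _ _ _ "\<lambda>x. inv g \<otimes> x"]) (auto simp: m_assoc[symmetric])
  then have "bij_betw (inv_into A e \<circ> ((\<lambda>x. g \<otimes> x) \<circ> e)) A A"
    using e bij_betw_inv_into[OF e] by (intro bij_betw_trans)
  then show "bij_betw (\<lambda>i. if i \<in> A then inv_into A e (g \<otimes> e i) else i) A A"
    by (rule bij_betw_cong[THEN iffD1, rotated]) simp
qed simp

lemma (in braids) torsion_free:
  assumes k: "k \<in> {2, 3}" and p: "2 \<le> p" "p \<le> k"
    and x: "x \<in> carrier B" "x [^]\<^bsub>B\<^esub> p \<in> lcs k"
  shows "x \<in> lcs k"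
proof -
  have pow: "x [^]\<^bsub>B\<^esub> (2::nat) = x \<cdot> x" "x [^]\<^bsub>B\<^esub> (3::nat) = x \<cdot> x \<cdot> x"
    using x(1) by (simp_all add: numeral_2_eq_2 numeral_3_eq_3)
  consider "p = 2" "k = 2" | "p = 2" "k = 3" | "p = 3" "k = 3" using k p by force
  then show ?thesis
  proof cases
    case 1
    then show ?thesis using torsion_free_2[OF x(1)] x(2) by (simp only: pow)
  next
    case 2
    then show ?thesis using torsion_free_2'[OF x(1)] x(2) by (simp only: pow)
  next
    case 3
    then show ?thesis using torsion_free_3[OF x(1)] x(2) by (simp only: pow)
  qed
qed

text \<open>A common prime factor \<open>p\<close> is at most \<open>k\<close>. A representative in
  \<open>B\<close> of the image of an element of order \<open>p\<close> has its \<open>p\<close>-th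
  power in \<open>lcs k\<close>, so it lies in \<open>lcs k\<close> by \<open>torsion_free\<close>,
  against injectivity.\<close>

lemma (in braids) coprime_if_embeds:
  assumes "group G" and fin: "finite (carrier G)" and k: "k \<in> {2, 3}"
    and emb: "embeds_in G (B Mod lcs k)"
  shows "gcd (order G) (fact k) = 1"
proof (rule ccontr)
  interpret G: group G by (rule assms(1))
  interpret N: normal "lcs k" B by (rule lcs_normal)
  obtain f where f: "f \<in> hom G (B Mod lcs k)" "inj_on f (carrier G)"
    using emb by (auto simp: embeds_in_def mon_def)
  interpret f: group_hom G "B Mod lcs k" f
    by (intro group_hom.intro group_hom_axioms.intro G.is_group N.factorgroup_is_group f(1))
  interpret r: group_hom B "B Mod lcs k" "\<lambda>x. lcs k #>\<^bsub>B\<^esub> x"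
    by (intro group_hom.intro group_hom_axioms.intro is_group N.factorgroup_is_group N.r_coset_hom_Mod)
  assume "gcd (order G) (fact k) \<noteq> 1"
  then obtain p where p: "prime p" "p dvd gcd (order G) (fact k)" using prime_factor_nat by blast
  then have "p dvd order G" by simp
  then obtain x where x: "x \<in> carrier G" "x \<noteq> \<one>\<^bsub>G\<^esub>" "x [^]\<^bsub>G\<^esub> p = \<one>\<^bsub>G\<^esub>"
    using G.cauchy[OF fin p(1)] by blast
  have pk: "p \<le> k" "2 \<le> p"
    using p prime_ge_2_nat[OF p(1)] by (simp_all add: prime_dvd_fact_iff)
  obtain y where y: "y \<in> carrier B" "f x = lcs k #>\<^bsub>B\<^esub> y"
    using f.hom_closed[OF x(1)] by (auto simp: FactGroup_def RCOSETS_def)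
  have one: "\<one>\<^bsub>B Mod lcs k\<^esub> = lcs k" by (simp add: FactGroup_def)
  have "f x [^]\<^bsub>B Mod lcs k\<^esub> p = f (x [^]\<^bsub>G\<^esub> p)" by (rule f.hom_nat_pow[symmetric, OF x(1)])
  then have "(lcs k #>\<^bsub>B\<^esub> y) [^]\<^bsub>B Mod lcs k\<^esub> p = lcs k"
    using x(3) y(2) one f.hom_one by simp
  then have "lcs k #>\<^bsub>B\<^esub> (y [^]\<^bsub>B\<^esub> p) = lcs k"
    using r.hom_nat_pow[OF y(1), of p] by simp
  then have "y [^]\<^bsub>B\<^esub> p \<in> lcs k" using coset_join1[OF _ nat_pow_closed[OF y(1)] lcs_subgroup] by blast
  then have "y \<in> lcs k" using torsion_free[OF k pk(2,1) y(1)] by blast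
  then have "f x = f \<one>\<^bsub>G\<^esub>" using coset_join2[OF y(1) lcs_subgroup] y(2) one f.hom_one by simp
  then show False using inj_onD[OF f(2)] x by blast
qed

theorem theorem2:
  fixes G :: "('a, 'b) monoid_scheme" and k :: nat
  assumes "group G" and "finite (carrier G)" and "k \<in> {2, 3}"
  shows "embeds_in G (braid_group (order G) Mod lower_central (pure_braid_group (order G)) k)
    \<longleftrightarrow> gcd (order G) (fact k) = 1"
proof -
  interpret G: group G by (rule assms(1))
  define n where "n = order G"
  interpret braids n .
  have n: "n = card (carrier G)" by (simp add: n_def order_def)
  have "embeds_in G (B Mod lcs k) \<longleftrightarrow> gcd n (fact k) = 1"
  proof
    assume "embeds_in G (B Mod lcs k)"
    then show "gcd n (fact k) = 1"
      using coprime_if_embeds[OF assms] by (simp add: n_def)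
  next
    assume gcd: "gcd n (fact k) = 1"
    have cop: "coprime m (order G)" if "m \<in> {2, 3}" "m \<le> k" for m
    proof -
      have "m dvd fact k" using that by (intro dvd_fact) auto
      then show ?thesis
        using gcd by (metis coprime_commute coprime_divisors coprime_iff_gcd_eq_1 dvd_refl n_def)
    qed
    obtain e where e: "bij_betw e {1..n} (carrier G)"
      using ex_bij_betw_nat_finite_1[OF assms(2)] n by auto
    define \<rho> where "\<rho> g i = (if i \<in> {1..n} then inv_into {1..n} e (g \<otimes>\<^bsub>G\<^esub> e i) else i)" for g i
    have e_in: "e i \<in> carrier G" if "i \<in> {1..n}" for i using e that by (auto simp: bij_betw_def)
    have e_\<rho>: "e (\<rho> g i) = g \<otimes>\<^bsub>G\<^esub> e i" if "g \<in> carrier G" "i \<in> {1..n}" for g i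
      using that e e_in[OF that(2)] by (simp add: \<rho>_def bij_betw_inv_into_right)
    have \<rho>_perm: "\<rho> g permutes {1..n}" if "g \<in> carrier G" for g
      using G.left_regular_permutes[OF e that] unfolding \<rho>_def by simp
    have \<rho>_in: "\<rho> g i \<in> {1..n}" if "g \<in> carrier G" "i \<in> {1..n}" for g i
      using permutes_in_image[OF \<rho>_perm[OF that(1)]] that(2) by blast
    have e_inj: "i = j" if "e i = e j" "i \<in> {1..n}" "j \<in> {1..n}" for i j
      using that e by (auto simp: bij_betw_def dest: inj_onD)
    have \<rho>_mult: "\<rho> (g \<otimes>\<^bsub>G\<^esub> h) = \<rho> g \<circ> \<rho> h" if "g \<in> carrier G" "h \<in> carrier G" for g h
    proof
      fix i
      show "\<rho> (g \<otimes>\<^bsub>G\<^esub> h) i = (\<rho> g \<circ> \<rho> h) i"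
      proof (cases "i \<in> {1..n}")
        case True
        then have "e (\<rho> (g \<otimes>\<^bsub>G\<^esub> h) i) = e (\<rho> g (\<rho> h i))"
          using that \<rho>_in[of h i] e_in by (simp only: e_\<rho> G.m_closed G.m_assoc)
        then show ?thesis using that True \<rho>_in by (intro e_inj) simp_all
      qed (auto simp: \<rho>_def)
    qed
    have fixp: "g = \<one>\<^bsub>G\<^esub>" if "g \<in> carrier G" "i \<in> {1..n}" "\<rho> g i = i" for g i
      using e_\<rho>[OF that(1,2)] e_in[OF that(2)] that(1,3) by simp
    interpret braid_action n G \<rho>
    proof
      show "inj_on \<rho> (carrier G)"
      proof (rule inj_onI)
        fix g h assume gh: "g \<in> carrier G" "h \<in> carrier G" "\<rho> g = \<rho> h"
        have "0 < n" using assms(2) G.one_closed by (auto simp: n card_gt_0_iff)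
        then have 1: "1 \<in> {1..n}" by simp
        then have "g \<otimes>\<^bsub>G\<^esub> e 1 = h \<otimes>\<^bsub>G\<^esub> e 1" using e_\<rho> gh by metis
        then show "g = h" using gh e_in[OF 1] by simp
      qed
    qed (fact \<rho>_perm \<rho>_mult)+
    have order2: "g = \<one>\<^bsub>G\<^esub>" if g: "g \<in> carrier G" "i \<in> {1..n}" "\<rho> g (\<rho> g i) = i" for g i
    proof -
      have "g \<otimes>\<^bsub>G\<^esub> g = \<one>\<^bsub>G\<^esub>" using g by (intro fixp[of _ i]) (simp_all add: \<rho>_mult)
      then have "g [^]\<^bsub>G\<^esub> (2::nat) = \<one>\<^bsub>G\<^esub>" using g by (simp add: numeral_2_eq_2)
      then show ?thesis using G.pow_coprime_eq_one[OF g(1)] cop[of 2] assms(3) by auto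
    qed
    have free2: "g = \<one>\<^bsub>G\<^esub>" if g: "g \<in> carrier G" and T: "T \<in> k_subsets 2" "\<rho> g ` T = T" for g T
    proof -
      obtain a b where ab: "T = {a, b}" "a \<in> {1..n}" "b \<in> {1..n}" using T(1) by (auto simp: k_subsets_def card_2_iff)
      have "\<rho> g a \<in> {a, b}" "\<rho> g b \<in> {a, b}" using T(2) ab by auto
      \<comment> \<open>Either \<open>g\<close> fixes a point of \<open>T\<close>, or its square
        fixes \<open>a\<close>.\<close>
      then have "\<rho> g a = a \<or> \<rho> g b = b \<or> \<rho> g (\<rho> g a) = a" by auto
      then show ?thesis using fixp[OF g] order2[OF g] ab by blast
    qed
    have free3: "g = \<one>\<^bsub>G\<^esub>" if k: "k = 3" and g: "g \<in> carrier G" and T: "T \<in> k_subsets 3" "\<rho> g ` T = T" for g T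
    proof -
      obtain a b c where abc: "T = {a, b, c}" "a \<in> {1..n}" "b \<in> {1..n}" "c \<in> {1..n}"
        using T(1) by (auto simp: k_subsets_def card_3_iff)
      have im: "\<rho> g a \<in> {a, b, c}" "\<rho> g b \<in> {a, b, c}" "\<rho> g c \<in> {a, b, c}" using T(2) abc by auto
      have order3: ?thesis if "\<rho> g (\<rho> g (\<rho> g a)) = a"
      proof -
        have "g \<otimes>\<^bsub>G\<^esub> g \<otimes>\<^bsub>G\<^esub> g = \<one>\<^bsub>G\<^esub>"
          using g that abc(2) by (intro fixp[of _ a]) (simp_all add: \<rho>_mult)
        then have "g [^]\<^bsub>G\<^esub> (3::nat) = \<one>\<^bsub>G\<^esub>" using g by (simp add: numeral_3_eq_3)
        then show ?thesis using G.pow_coprime_eq_one[OF g] cop[of 3] k by auto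
      qed
      \<comment> \<open>A self-map of three points without a fixed point has a 2-cycle, which meets
        \<open>a\<close> or \<open>b\<close>, or is a 3-cycle.\<close>
      consider "\<rho> g a = a" | "\<rho> g b = b" | "\<rho> g c = c" | "\<rho> g (\<rho> g a) = a" | "\<rho> g (\<rho> g b) = b" |
          "\<rho> g (\<rho> g (\<rho> g a)) = a"
        using im by (elim insertE emptyE) simp_all
      then show ?thesis using fixp[OF g] order2[OF g] order3 abc by cases blast+
    qed
    have "\<exists>S. subgroup S B \<and> S \<subseteq> lifts \<and> (\<forall>g\<in>carrier G. \<exists>x\<in>S. \<pi> x = \<rho> g) \<and> S \<inter> P = lcs k"
    proof (cases "k = 2")
      case True
      show ?thesis unfolding True by (rule complement_2) (rule free2)
    next
      case False
      then have k: "k = 3" using assms(3) by simp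
      show ?thesis unfolding k by (rule complement_3) (rule free2, assumption+, rule free3[OF k])
    qed
    then obtain S where "subgroup S B" "S \<subseteq> lifts" "\<forall>g\<in>carrier G. \<exists>x\<in>S. \<pi> x = \<rho> g" "S \<inter> P = lcs k"
      by (elim exE conjE)
    then show "embeds_in G (B Mod lcs k)" by (intro embeds_if_complement) auto
  qed
  then show ?thesis by (simp only: n_def)
qed

end
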